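(* Let $A\subset[0,1]$ be a compact subset of the interval $[0,1]$ with $\varepsilon_n(A)\preccurlyeq n^{-\delta}(\log(n+1))^\theta$ for some $\delta\ge1$ and $\theta\in\mathbb R$. Then for the classical Riemann-Liouville operator $R_\alpha:L_p[0,1]\to C(A)$, $2\le p<\infty$, $\alpha>1/p$, we have the estimate $$e_n(R_\alpha:L_p[0,1]\to C(A))\preccurlyeq n^{-1/p-\delta(\alpha-1/p)}(\log(n+1))^{\theta(\alpha-1/p)},$$ and in the case $p=2$, $\alpha>1/2$, we also obtain $$d_n(R_\alpha:L_2[0,1]\to C(A))\preccurlyeq n^{-1/2-\delta(\alpha-1/2)}(\log(n+1))^{\theta(\alpha-1/2)}.$$
   Context: The Riemann-Liouville operator is $(R_\alpha f)(t)=\frac1{\Gamma(\alpha)}\int_0^t(t-x)^{\alpha-1}f(x)\,dx$; as an operator into $C(A)$ it is considered for $t\in A$. $\log$ is the logarithm to base 2. $x_n\preccurlyeq y_n$ means that there is a constant $c>0$ with $x_n\le c\,y_n$ for all $n\in\mathbb N$. Entropy numbers: for a bounded subset $A$ of a metric space $M$, $\varepsilon_n(A)=\inf\{\varepsilon\ge0:\exists x_1,\dots,x_n\in M,\ A\subset\bigcup_{i=1}^n B_M(x_i,\varepsilon)\}$ with closed balls, $e_n(A)=\varepsilon_{2^{n-1}}(A)$; here $\varepsilon_n(A)$ is taken with respect to the absolute value. For a bounded linear operator $T:X\to Y$ between Banach spaces, $e_n(T)=e_n(T(B_X))$ with $B_X$ the closed unit ball of $X$, and the $n$-th Kolmogorov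 number is $d_n(T)=\inf\{\|Q_F^YT\|:F\text{ subspace of }Y,\ \dim F<n\}$, where $Q_F^Y:Y\to Y/F$ is the quotient map. *)

theory Defs
  imports "HOL-Analysis.Analysis" "HOL-Library.Function_Algebras"
begin

section \<open>Pointwise real vector space structure on function types\<close>

instantiation "fun" :: (type, real_vector) real_vector
begin

definition scaleR_fun :: "real \<Rightarrow> ('a \<Rightarrow> 'b) \<Rightarrow> 'a \<Rightarrow> 'b"
  where "scaleR_fun c f = (\<lambda>x. c *\<^sub>R f x)"

instance
  by standard (auto simp: scaleR_fun_def fun_eq_iff algebra_simps)

end

lemma scaleR_fun_apply [simp]: "(c *\<^sub>R f) x = c *\<^sub>R f x"
  by (simp add: scaleR_fun_def)


section \<open>Normed spaces with an explicit carrier\<close>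

text \<open>
  The exponent \<open>p\<close> and the set \<open>A\<close> vary, so \<open>L\<^sub>p\<close> and \<open>C(A)\<close> cannot be types; they are
  linear subspaces \<open>vecs X\<close> of a real vector space together with a norm \<open>vnorm X\<close>.
\<close>

record 'v nspace =
  vecs :: "'v set"
  vnorm :: "'v \<Rightarrow> real"

definition unit_ball :: "'v nspace \<Rightarrow> 'v set"
  where "unit_ball X = {x \<in> vecs X. vnorm X x \<le> 1}"

text \<open>The distance is cut off outside the carrier because \<^locale>\<open>Metric_space\<close> demands
  nonnegativity and symmetry on the whole type.\<close>

definition norm_metric :: "'v::real_vector nspace \<Rightarrow> 'v metric"
  where "norm_metric X =
    metric (vecs X, \<lambda>x y. if x \<in> vecs X \<and> y \<in> vecs X then vnorm X (x - y) else 0)"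


section \<open>Entropy numbers and Kolmogorov numbers\<close>

text \<open>
  All these quantities are valued in \<^typ>\<open>ennreal\<close>, so that infima over the empty set and
  suprema of unbounded sets have the value \<open>\<infinity>\<close>. The points \<open>x 1, \<dots>, x n\<close> need not be distinct.
\<close>

definition covering_entropy :: "'a metric \<Rightarrow> 'a set \<Rightarrow> nat \<Rightarrow> ennreal"
  where "covering_entropy M A n =
    (INF \<epsilon>\<in>{\<epsilon>. 0 \<le> \<epsilon> \<and> (\<exists>x :: nat \<Rightarrow> 'a. (\<forall>i\<in>{1..n}. x i \<in> mspace M) \<and>
                             A \<subseteq> (\<Union>i\<in>{1..n}. mcball_of M (x i) \<epsilon>))}. ennreal \<epsilon>)"

definition dyadic_entropy :: "'a metric \<Rightarrow> 'a set \<Rightarrow> nat \<Rightarrow> ennreal"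
  where "dyadic_entropy M A n = covering_entropy M A (2 ^ (n - 1))"

definition operator_entropy ::
    "'a nspace \<Rightarrow> 'b::real_vector nspace \<Rightarrow> ('a \<Rightarrow> 'b) \<Rightarrow> nat \<Rightarrow> ennreal"
  where "operator_entropy X Y T n = dyadic_entropy (norm_metric Y) (T ` unit_ball X) n"

text \<open>The norm of the coset \<open>y + F\<close> in the quotient space \<open>Y / F\<close>.\<close>

definition quotient_norm :: "'b::real_vector nspace \<Rightarrow> 'b set \<Rightarrow> 'b \<Rightarrow> ennreal"
  where "quotient_norm Y F y = (INF f\<in>F. ennreal (vnorm Y (y - f)))"

text \<open>
  Finite dimensionality is required explicitly because \<^const>\<open>dim\<close> is \<open>0\<close> for
  infinite-dimensional subspaces.
\<close>

definition kolmogorov_number ::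
    "'a nspace \<Rightarrow> 'b::real_vector nspace \<Rightarrow> ('a \<Rightarrow> 'b) \<Rightarrow> nat \<Rightarrow> ennreal"
  where "kolmogorov_number X Y T n =
    (INF F\<in>{F. subspace F \<and> F \<subseteq> vecs Y \<and> (\<exists>B. finite B \<and> F = span B) \<and> dim F < n}.
       SUP x\<in>unit_ball X. quotient_norm Y F (T x))"


section \<open>The spaces and the operator\<close>

text \<open>
  Elements of \<open>L\<^sub>p\<close> are represented by functions rather than by almost-everywhere classes, so
  \<open>vnorm\<close> is only a seminorm here. As source space of an operator that respects almost-everywhere
  equality, this yields the same image of the unit ball.
\<close>

definition Lp_space :: "'a measure \<Rightarrow> real \<Rightarrow> ('a \<Rightarrow> real) nspace"
  where "Lp_space M p =
    \<lparr>vecs = {f \<in> borel_measurable M. integrable M (\<lambda>x. \<bar>f x\<bar> powr p)},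
     vnorm = (\<lambda>f. (\<integral>x. \<bar>f x\<bar> powr p \<partial>M) powr (1 / p))\<rparr>"

text \<open>Continuous functions on \<open>A\<close> are represented by their extension by \<open>0\<close>.\<close>

definition C_space :: "real set \<Rightarrow> (real \<Rightarrow> real) nspace"
  where "C_space A =
    \<lparr>vecs = {f. continuous_on A f \<and> (\<forall>t. t \<notin> A \<longrightarrow> f t = 0)},
     vnorm = (\<lambda>f. if A = {} then 0 else (SUP t\<in>A. \<bar>f t\<bar>))\<rparr>"

definition riemann_liouville :: "real \<Rightarrow> (real \<Rightarrow> real) \<Rightarrow> real \<Rightarrow> real"
  where "riemann_liouville \<alpha> f t =
    1 / Gamma \<alpha> * (\<integral>x. (t - x) powr (\<alpha> - 1) * f x \<partial>lebesgue_on {0..t})"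

definition riemann_liouville_on :: "real set \<Rightarrow> real \<Rightarrow> (real \<Rightarrow> real) \<Rightarrow> real \<Rightarrow> real"
  where "riemann_liouville_on A \<alpha> f = (\<lambda>t. if t \<in> A then riemann_liouville \<alpha> f t else 0)"

definition asymp_le :: "(nat \<Rightarrow> ennreal) \<Rightarrow> (nat \<Rightarrow> real) \<Rightarrow> bool"  (infix "\<preceq>" 50)
  where "x \<preceq> y \<longleftrightarrow> (\<exists>c>0. \<forall>n\<ge>1. x n \<le> ennreal (c * y n))"


section \<open>\<open>C(A)\<close> is a normed space\<close>

lemma subspace_C_space: "subspace (vecs (C_space A))"
  by (auto simp: C_space_def subspace_def plus_fun_def zero_fun_def scaleR_fun_def
      intro!: continuous_intros)

lemma C_space_bdd:
  assumes "compact A" "f \<in> vecs (C_space A)"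
  shows "bdd_above ((\<lambda>t. \<bar>f t\<bar>) ` A)"
proof -
  have "continuous_on A (\<lambda>t. \<bar>f t\<bar>)"
    using assms(2) by (auto simp: C_space_def intro!: continuous_intros)
  then show ?thesis
    using assms(1) by (meson bounded_imp_bdd_above compact_continuous_image compact_imp_bounded)
qed

lemma C_space_norm_ge:
  assumes "compact A" "f \<in> vecs (C_space A)"
  shows "\<bar>f t\<bar> \<le> vnorm (C_space A) f"
proof (cases "t \<in> A")
  case True
  then show ?thesis
    using cSUP_upper[OF True C_space_bdd[OF assms]] by (auto simp: C_space_def)
next
  case False
  have "0 \<le> vnorm (C_space A) f"
  proof (cases "A = {}")
    case nonempty: False
    then obtain s where "s \<in> A" by blast
    have "0 \<le> \<bar>f s\<bar>" by simp
    also have "\<dots> \<le> (SUP t\<in>A. \<bar>f t\<bar>)"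
      by (rule cSUP_upper[OF \<open>s \<in> A\<close> C_space_bdd[OF assms]])
    finally show ?thesis using nonempty by (simp add: C_space_def)
  qed (simp add: C_space_def)
  with False assms(2) show ?thesis by (simp add: C_space_def)
qed

lemma C_space_norm_le:
  assumes "0 \<le> b" "\<And>t. t \<in> A \<Longrightarrow> \<bar>f t\<bar> \<le> b"
  shows "vnorm (C_space A) f \<le> b"
  using assms by (auto simp: C_space_def intro!: cSUP_least)

lemma Metric_space_C_space:
  assumes "compact A"
  shows "Metric_space (vecs (C_space A))
    (\<lambda>f g. if f \<in> vecs (C_space A) \<and> g \<in> vecs (C_space A) then vnorm (C_space A) (f - g) else 0)"
proof (unfold_locales, goal_cases)
  case (1 f g)
  then show ?case
    using C_space_norm_ge[OF assms subspace_diff[OF subspace_C_space], of f g]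
    by (auto intro: order_trans[OF abs_ge_zero])
next
  case (2 f g)
  have "vnorm (C_space A) (f - g) = vnorm (C_space A) (g - f)"
    by (simp add: C_space_def abs_minus_commute)
  then show ?case by auto
next
  case (3 f g)
  have "f t = g t" if "vnorm (C_space A) (f - g) = 0" for t
    using C_space_norm_ge[OF assms subspace_diff[OF subspace_C_space 3], of t] that by simp
  moreover have "vnorm (C_space A) (g - g) = 0"
    by (simp add: C_space_def)
  ultimately show ?case using 3 by auto
next
  case (4 f g h)
  let ?N = "vnorm (C_space A)"
  have ge: "\<bar>u t - v t\<bar> \<le> ?N (u - v)" if "u \<in> vecs (C_space A)" "v \<in> vecs (C_space A)" for u v t
    using C_space_norm_ge[OF assms subspace_diff[OF subspace_C_space that], of t] by simp
  have "?N (f - h) \<le> ?N (f - g) + ?N (g - h)"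
  proof (rule C_space_norm_le)
    show "0 \<le> ?N (f - g) + ?N (g - h)"
      using ge[of f g 0] ge[of g h 0] 4 by linarith
    show "\<bar>(f - h) t\<bar> \<le> ?N (f - g) + ?N (g - h)" for t
      using ge[of f g t] ge[of g h t] 4 by simp
  qed
  with 4 show ?case by simp
qed

lemma
  assumes "compact A"
  shows mspace_C_space: "mspace (norm_metric (C_space A)) = vecs (C_space A)"
    and mdist_C_space: "f \<in> vecs (C_space A) \<Longrightarrow> g \<in> vecs (C_space A) \<Longrightarrow>
      mdist (norm_metric (C_space A)) f g = vnorm (C_space A) (f - g)"
  unfolding norm_metric_def
  using Metric_space.mspace_metric[OF Metric_space_C_space[OF assms]]
    Metric_space.mdist_metric[OF Metric_space_C_space[OF assms]] by simp_all

end

theory Submission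
  imports Defs "HOL-Computational_Algebra.Polynomial"
begin

text \<open>
  Write \<open>s = \<alpha> - 1 / p\<close> and \<open>\<phi> n = n powr (- \<delta>) * (log 2 (n + 1)) powr \<theta>\<close>.  Both assertions say that the
  numbers in question are at most of the order \<open>n powr (- 1 / p) * \<phi> n powr s\<close>.  The factor \<open>\<phi> n powr s\<close> is
  the error of piecewise polynomial approximation of a function of smoothness \<open>s\<close> on \<open>n\<close> intervals of
  length \<open>\<phi> n\<close> that cover \<open>A\<close>.  The factor \<open>n powr (- 1 / p)\<close> is gained because the local errors at a fixed
  scale are bounded not only individually: their \<open>p\<close>-norm over all intervals is bounded.

  The local estimate is \<open>rl_integral_local_polynomial\<close>.  Around a grid node, the part of \<open>f\<close> far to the
  left contributes a smooth function, which is close to its Taylor polynomial, and the remaining part is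
  small by the Hoelder inequality, as \<open>\<alpha> > 1 / p\<close>.  Both errors are controlled by an \<open>L\<^sub>p\<close> norm of
  \<open>f\<close> with a weight that is concentrated at the node, and the weights of all nodes have a bounded sum.  At
  least \<open>\<alpha> + 1\<close> Taylor terms are taken, so that the remainder decays fast enough with the distance for the
  weights to be summable.

  On each dyadic grid, interpolating polynomials are glued together with hat functions, and only nodes
  close to \<open>A\<close> are kept.  The difference of two consecutive scales is a sum of products of hat functions
  and Lagrange polynomials, whose coefficients are values of local errors
  (\<open>quasi_interpolant_eq_level_sum\<close>, \<open>level_coeff_bound\<close>).  So on level \<open>q\<close> the operator is, up to
  constants, \<open>2 powr (- s * q)\<close> times the identity from \<open>l\<^sub>p\<close> to \<open>l\<^sub>\<infinity>\<close> in a dimension proportional to the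
  number of active nodes.  For this identity two facts are needed.  Its entropy follows from counting
  integer vectors (\<open>card_lattice_ball\<close>, \<open>quantize_level\<close>).  For \<open>p = 2\<close> its Kolmogorov numbers are
  estimated in \<open>euclidean_ball_sup_norm_approximation\<close> with a random sign matrix.

  Given \<open>n\<close>, let \<open>Q\<close> be the level with \<open>2 powr (- Q)\<close> comparable to \<open>\<phi> n\<close>, or the coarsest level if
  \<open>\<phi> n \<ge> 1\<close>.  By \<open>critical_scale\<close> it has at most of the order of \<open>n\<close> active nodes, the bound decreases geometrically below \<open>Q\<close>, and it grows at most by a factor
  of \<open>2\<close> per level above \<open>Q\<close>.  If the bits or dimensions spent on a level decrease geometrically with its
  distance from \<open>Q\<close>, the total is proportional to \<open>n\<close>, and the errors still sum up to a multiple of the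
  error of the critical level (\<open>finite_approximation\<close>, \<open>finite_dimensional_approximation\<close>).
\<close>

section \<open>Counting integer vectors\<close>

definition lattice_ball :: "'i set \<Rightarrow> real \<Rightarrow> ('i \<Rightarrow> int) set"
  where "lattice_ball I T = {z. (\<forall>i. i \<notin> I \<longrightarrow> z i = 0) \<and> (\<Sum>i\<in>I. \<bar>real_of_int (z i)\<bar>) \<le> T}"

lemma sum_exp_abs_int_le:
  fixes \<mu> :: real
  assumes "\<mu> > 0"
  shows "(\<Sum>b\<in>{- int B..int B}. exp (- \<mu> * \<bar>real_of_int b\<bar>)) \<le> 1 + 2 / (exp \<mu> - 1)"
proof -
  have pos: "exp \<mu> - 1 > 0" using assms by simp
  have "(\<Sum>b\<in>{- int B..int B}. exp (- \<mu> * \<bar>real_of_int b\<bar>))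
          = 1 + 2 / (exp \<mu> - 1) * (1 - exp (- \<mu> * real B))"
  proof (induction B)
    case (Suc B)
    have split: "{- int (Suc B)..int (Suc B)}
        = insert (- int (Suc B)) (insert (int (Suc B)) {- int B..int B})"
      by auto
    have e: "exp (- \<mu> * real B) = exp (- \<mu> * real (Suc B)) * exp \<mu>"
      by (simp add: exp_add [symmetric] algebra_simps)
    have "(\<Sum>b\<in>{- int (Suc B)..int (Suc B)}. exp (- \<mu> * \<bar>real_of_int b\<bar>))
        = 2 * exp (- \<mu> * real (Suc B)) + (1 + 2 / (exp \<mu> - 1) * (1 - exp (- \<mu> * real B)))"
      unfolding split using Suc.IH by (simp add: algebra_simps)
    also have "\<dots> = 1 + 2 / (exp \<mu> - 1) * (1 - exp (- \<mu> * real (Suc B)))"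
      unfolding e using pos by (simp add: field_simps)
    finally show ?case .
  qed simp
  also have "\<dots> \<le> 1 + 2 / (exp \<mu> - 1) * 1"
    using pos by (intro add_left_mono mult_left_mono) auto
  finally show ?thesis by simp
qed

text \<open>The generating function of \<open>z \<mapsto> exp (- \<mu> * \<bar>z\<bar>)\<close> factorises over the coordinates;
  comparing it with its smallest term on the ball gives the count.  The free parameter \<open>\<mu>\<close>
  interpolates between few coordinates with large entries (small \<open>\<mu>\<close>) and many coordinates most
  of which vanish (large \<open>\<mu>\<close>).\<close>

lemma card_lattice_ball:
  fixes \<mu> :: real
  assumes "finite I" and "\<mu> > 0"
  shows "finite (lattice_ball I T)"
    and "real (card (lattice_ball I T)) \<le> exp (\<mu> * T) * (1 + 2 / (exp \<mu> - 1)) ^ card I"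
    and "real (card (lattice_ball I T)) \<le> exp (\<mu> * T + 2 / (exp \<mu> - 1) * real (card I))"
proof -
  define w where "w = 1 + 2 / (exp \<mu> - 1)"
  have w1: "w \<ge> 1" using assms(2) by (simp add: w_def)
  have main: "finite (lattice_ball I T) \<and>
      real (card (lattice_ball I T)) \<le> exp (\<mu> * T) * w ^ card I" for T
    using assms(1)
  proof (induction I arbitrary: T rule: finite_induct)
    case empty
    have "lattice_ball {} T \<subseteq> {\<lambda>_. 0}" by (auto simp: lattice_ball_def)
    moreover have "lattice_ball {} T = {}" if "T < 0" using that by (auto simp: lattice_ball_def)
    ultimately show ?case
    proof (cases "T < 0")
      case False
      have "card (lattice_ball {} T :: ('a \<Rightarrow> int) set) \<le> card {\<lambda>_::'a. 0::int}"
        using \<open>lattice_ball {} T \<subseteq> {\<lambda>_. 0}\<close> by (intro card_mono) auto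
      then have "real (card (lattice_ball {} T :: ('a \<Rightarrow> int) set)) \<le> 1" by simp
      also have "1 \<le> exp (\<mu> * T)" using False assms(2) by simp
      finally show ?thesis using \<open>lattice_ball {} T \<subseteq> {\<lambda>_. 0}\<close>
        by (auto intro: finite_subset)
    qed (simp add: \<open>T < 0 \<Longrightarrow> lattice_ball {} T = {}\<close>)
  next
    case (insert j I)
    define B where "B = nat \<lfloor>T\<rfloor>"
    let ?L = "\<lambda>b. lattice_ball I (T - \<bar>real_of_int b\<bar>)"
    let ?U = "\<Union>b\<in>{- int B..int B}. (\<lambda>z. z(j := b)) ` ?L b"
    have sub: "lattice_ball (insert j I) T \<subseteq> ?U"
    proof
      fix z assume z: "z \<in> lattice_ball (insert j I) T"
      then have s: "\<bar>real_of_int (z j)\<bar> + (\<Sum>i\<in>I. \<bar>real_of_int (z i)\<bar>) \<le> T"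
        using insert.hyps by (simp add: lattice_ball_def)
      have "(\<Sum>i\<in>I. \<bar>real_of_int (z i)\<bar>) \<ge> 0" by (intro sum_nonneg) auto
      with s have "\<bar>real_of_int (z j)\<bar> \<le> T" by linarith
      then have "\<bar>z j\<bar> \<le> \<lfloor>T\<rfloor>" by (simp add: le_floor_iff)
      then have zB: "z j \<in> {- int B..int B}" unfolding B_def by simp linarith
      have "(\<Sum>i\<in>I. \<bar>real_of_int ((z(j := 0)) i)\<bar>) = (\<Sum>i\<in>I. \<bar>real_of_int (z i)\<bar>)"
        using insert.hyps by (intro sum.cong) auto
      then have "z(j := 0) \<in> ?L (z j)"
        using z s by (auto simp: lattice_ball_def)
      moreover have "z = (z(j := 0))(j := z j)" by simp
      ultimately show "z \<in> ?U" using zB by blast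
    qed
    have fin: "finite ?U" using insert.IH by auto
    have "real (card (lattice_ball (insert j I) T)) \<le> real (card ?U)"
      using card_mono[OF fin sub] by simp
    also have "card ?U \<le> (\<Sum>b\<in>{- int B..int B}. card ((\<lambda>z. z(j := b)) ` ?L b))"
      by (rule card_UN_le) simp
    also have "\<dots> \<le> (\<Sum>b\<in>{- int B..int B}. card (?L b))"
      using insert.IH by (intro sum_mono card_image_le) auto
    also have "real (\<Sum>b\<in>{- int B..int B}. card (?L b))
        \<le> (\<Sum>b\<in>{- int B..int B}. exp (\<mu> * (T - \<bar>real_of_int b\<bar>)) * w ^ card I)"
      unfolding of_nat_sum using insert.IH by (intro sum_mono) auto
    also have "\<dots> = exp (\<mu> * T) * w ^ card I * (\<Sum>b\<in>{- int B..int B}. exp (- \<mu> * \<bar>real_of_int b\<bar>))"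
      unfolding sum_distrib_left
      by (intro sum.cong) (auto simp: exp_add [symmetric] exp_diff algebra_simps exp_minus divide_inverse)
    also have "\<dots> \<le> exp (\<mu> * T) * w ^ card I * w"
      using sum_exp_abs_int_le[OF assms(2), of B] w1 unfolding w_def
      by (intro mult_left_mono mult_nonneg_nonneg) auto
    finally show ?case using sub fin insert.hyps by (auto intro: finite_subset simp: mult_ac)
  qed
  show "finite (lattice_ball I T)" using main by blast
  show "real (card (lattice_ball I T)) \<le> exp (\<mu> * T) * (1 + 2 / (exp \<mu> - 1)) ^ card I"
    using main unfolding w_def by blast
  have "w ^ card I \<le> exp (2 / (exp \<mu> - 1)) ^ card I"
    using w1 unfolding w_def by (intro power_mono) auto
  also have "\<dots> = exp (2 / (exp \<mu> - 1) * real (card I))"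
    by (simp add: exp_of_nat_mult [symmetric] mult.commute)
  finally have "exp (\<mu> * T) * w ^ card I \<le> exp (\<mu> * T) * exp (2 / (exp \<mu> - 1) * real (card I))"
    by (intro mult_left_mono) auto
  with main[of T] show "real (card (lattice_ball I T)) \<le> exp (\<mu> * T + 2 / (exp \<mu> - 1) * real (card I))"
    unfolding exp_add by linarith
qed

section \<open>Random sign matrices\<close>

text \<open>A choice of signs on \<open>I\<close> is encoded by the set \<open>S \<subseteq> I\<close> of the indices that get \<open>+1\<close>.\<close>

definition sign_of :: "'i set \<Rightarrow> 'i \<Rightarrow> real"
  where "sign_of S i = (if i \<in> S then 1 else -1)"

definition signed_sum :: "'i set \<Rightarrow> ('i \<Rightarrow> real) \<Rightarrow> 'i set \<Rightarrow> real"
  where "signed_sum I a S = (\<Sum>i\<in>I. sign_of S i * a i)"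

lemma sum_Pow_insert:
  assumes "finite I" "j \<notin> I"
  shows "(\<Sum>S\<in>Pow (insert j I). F S) = (\<Sum>S\<in>Pow I. F S) + (\<Sum>S\<in>Pow I. F (insert j S))"
proof -
  have inj: "inj_on (insert j) (Pow I)"
    using assms(2) by (auto simp: inj_on_def)
  have "(\<Sum>S\<in>Pow (insert j I). F S) = (\<Sum>S\<in>Pow I. F S) + (\<Sum>S\<in>insert j ` Pow I. F S)"
    unfolding Pow_insert using assms by (intro sum.union_disjoint) auto
  then show ?thesis by (simp add: sum.reindex[OF inj])
qed

lemma signed_sum_insert:
  assumes "finite I" "j \<notin> I" "S \<subseteq> I"
  shows "signed_sum (insert j I) a S = - a j + signed_sum I a S"
    and "signed_sum (insert j I) a (insert j S) = a j + signed_sum I a S"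
proof -
  have "j \<notin> S" using assms by auto
  have "signed_sum I a (insert j S) = signed_sum I a S"
    unfolding signed_sum_def using assms by (intro sum.cong) (auto simp: sign_of_def)
  moreover have "signed_sum (insert j I) a (insert j S) = a j + signed_sum I a (insert j S)"
    using assms by (simp add: signed_sum_def sign_of_def)
  ultimately show "signed_sum (insert j I) a (insert j S) = a j + signed_sum I a S" by simp
  show "signed_sum (insert j I) a S = - a j + signed_sum I a S"
    using assms \<open>j \<notin> S\<close> by (simp add: signed_sum_def sign_of_def)
qed

lemma sum_signed_sum_mult:
  assumes "finite I"
  shows "(\<Sum>S\<in>Pow I. signed_sum I a S * signed_sum I b S) = 2 ^ card I * (\<Sum>i\<in>I. a i * b i)"
proof -
  have "(\<Sum>S\<in>Pow I. (y + signed_sum I a S) * (w + signed_sum I b S))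
      = 2 ^ card I * (y * w + (\<Sum>i\<in>I. a i * b i))" for y w
    using assms
  proof (induction I arbitrary: y w rule: finite_induct)
    case empty
    then show ?case by (simp add: signed_sum_def)
  next
    case (insert j I)
    have "(\<Sum>S\<in>Pow (insert j I). (y + signed_sum (insert j I) a S) * (w + signed_sum (insert j I) b S))
        = (\<Sum>S\<in>Pow I. ((y - a j) + signed_sum I a S) * ((w - b j) + signed_sum I b S))
        + (\<Sum>S\<in>Pow I. ((y + a j) + signed_sum I a S) * ((w + b j) + signed_sum I b S))"
      unfolding sum_Pow_insert[OF insert.hyps]
      using insert.hyps by (intro arg_cong2[of _ _ _ _ "(+)"] sum.cong) (auto simp: signed_sum_insert algebra_simps)
    also have "\<dots> = 2 ^ card I * ((y - a j) * (w - b j) + (\<Sum>i\<in>I. a i * b i))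
       + 2 ^ card I * ((y + a j) * (w + b j) + (\<Sum>i\<in>I. a i * b i))"
      by (simp only: insert.IH)
    also have "\<dots> = 2 ^ card (insert j I) * (y * w + (\<Sum>i\<in>insert j I. a i * b i))"
      using insert.hyps by (simp add: algebra_simps)
    finally show ?case .
  qed
  from this[of 0 0] show ?thesis by simp
qed

lemma cosh_le_exp_square:
  fixes x :: real
  shows "exp x + exp (- x) \<le> 2 * exp (x\<^sup>2 / 2)"
proof -
  have aux: "exp x + exp (- x) \<le> 2 * exp (x\<^sup>2 / 2)" if "x \<ge> 0" for x :: real
  proof -
    let ?k = "\<lambda>u. u\<^sup>2 / 2 - ln (exp u + exp (- u)) :: real"
    have tanh_le: "(exp u - exp (- u)) / (exp u + exp (- u)) \<le> u" if "u \<ge> 0" for u :: real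
    proof -
      let ?m = "\<lambda>u. u * (exp u + exp (- u)) - (exp u - exp (- u)) :: real"
      have "?m 0 \<le> ?m u"
      proof (rule DERIV_nonneg_imp_nondecreasing[OF that])
        fix y :: real assume "0 \<le> y" "y \<le> u"
        show "\<exists>D. (?m has_real_derivative D) (at y) \<and> 0 \<le> D"
        proof (intro exI conjI)
          show "(?m has_real_derivative y * (exp y - exp (- y))) (at y)"
            by (auto intro!: derivative_eq_intros simp: algebra_simps)
          show "0 \<le> y * (exp y - exp (- y))" using \<open>0 \<le> y\<close> by simp
        qed
      qed
      moreover have "exp u + exp (- u) > 0" by (simp add: add_pos_pos)
      ultimately show ?thesis by (simp add: divide_le_eq)
    qed
    have "?k 0 \<le> ?k x"
    proof (rule DERIV_nonneg_imp_nondecreasing[OF that])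
      fix y :: real assume y: "0 \<le> y" "y \<le> x"
      have pos: "exp y + exp (- y) > 0" by (simp add: add_pos_pos)
      show "\<exists>D. (?k has_real_derivative D) (at y) \<and> 0 \<le> D"
      proof (intro exI conjI)
        show "(?k has_real_derivative y - (exp y - exp (- y)) / (exp y + exp (- y))) (at y)"
          using pos by (auto intro!: derivative_eq_intros simp: field_simps power2_eq_square)
        show "0 \<le> y - (exp y - exp (- y)) / (exp y + exp (- y))"
          using tanh_le[OF y(1)] by simp
      qed
    qed
    then have "ln (exp x + exp (- x)) \<le> x\<^sup>2 / 2 + ln 2" by simp
    then have "exp (ln (exp x + exp (- x))) \<le> exp (x\<^sup>2 / 2 + ln 2)" by simp
    then show ?thesis by (simp add: exp_add add_pos_pos)
  qed
  show ?thesis using aux[of x] aux[of "- x"] by (cases "x \<ge> 0") auto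
qed

text \<open>One sign is integrated out at a time.  If \<open>c\<close> is the coefficient of the square, adding a term
  \<open>\<plusminus>a\<close> replaces \<open>c\<close> by at most \<open>c + 2 * c\<^sup>2 * a\<^sup>2\<close>, so that \<open>1 / c\<close> decreases by at most \<open>2 * a\<^sup>2\<close>; this is
  why the bound is stated for \<open>r = 1 / c\<close> and for sums with an arbitrary offset \<open>y\<close>.\<close>

lemma sum_exp_signed_sum_square_offset:
  assumes "finite I" "r - 2 * (\<Sum>i\<in>I. (a i)\<^sup>2) \<ge> 2"
  shows "(\<Sum>S\<in>Pow I. exp ((y + signed_sum I a S)\<^sup>2 / r))
     \<le> 2 ^ card I * exp (y\<^sup>2 / (r - 2 * (\<Sum>i\<in>I. (a i)\<^sup>2)) + (\<Sum>i\<in>I. (a i)\<^sup>2) / 2)"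
  using assms
proof (induction I arbitrary: y r rule: finite_induct)
  case empty
  then show ?case by (simp add: signed_sum_def)
next
  case (insert j I)
  define s where "s = (\<Sum>i\<in>I. (a i)\<^sup>2)"
  define R where "R = r - 2 * s"
  have s0: "s \<ge> 0" unfolding s_def by (intro sum_nonneg) auto
  have tot: "(\<Sum>i\<in>insert j I. (a i)\<^sup>2) = (a j)\<^sup>2 + s" using insert.hyps by (simp add: s_def)
  have R2: "R - 2 * (a j)\<^sup>2 \<ge> 2" using insert.prems tot by (simp add: R_def)
  then have Rpos: "R \<ge> 2" "R > 0" by (smt (verit) zero_le_power2)+
  have ih: "(\<Sum>S\<in>Pow I. exp ((y' + signed_sum I a S)\<^sup>2 / r)) \<le> 2 ^ card I * exp (y'\<^sup>2 / R + s / 2)" for y'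
    using insert.IH[of r y'] Rpos by (simp add: R_def s_def)
  have "(\<Sum>S\<in>Pow (insert j I). exp ((y + signed_sum (insert j I) a S)\<^sup>2 / r))
      = (\<Sum>S\<in>Pow I. exp (((y - a j) + signed_sum I a S)\<^sup>2 / r))
      + (\<Sum>S\<in>Pow I. exp (((y + a j) + signed_sum I a S)\<^sup>2 / r))"
    unfolding sum_Pow_insert[OF insert.hyps]
    using insert.hyps by (intro arg_cong2[of _ _ _ _ "(+)"] sum.cong) (auto simp: signed_sum_insert algebra_simps)
  also have "\<dots> \<le> 2 ^ card I * exp ((y - a j)\<^sup>2 / R + s / 2) + 2 ^ card I * exp ((y + a j)\<^sup>2 / R + s / 2)"
    by (intro add_mono ih)
  also have "\<dots> = 2 ^ card I * exp (y\<^sup>2 / R + (a j)\<^sup>2 / R + s / 2)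
      * (exp (2 * y * a j / R) + exp (- (2 * y * a j / R)))"
  proof -
    have "(y - a j)\<^sup>2 / R + s / 2 = (y\<^sup>2 / R + (a j)\<^sup>2 / R + s / 2) + - (2 * y * a j / R)"
      "(y + a j)\<^sup>2 / R + s / 2 = (y\<^sup>2 / R + (a j)\<^sup>2 / R + s / 2) + 2 * y * a j / R"
      using Rpos by (simp_all add: field_simps power2_eq_square)
    then show ?thesis by (simp only: exp_add) (simp add: algebra_simps)
  qed
  also have "\<dots> \<le> 2 ^ card I * exp (y\<^sup>2 / R + (a j)\<^sup>2 / R + s / 2) * (2 * exp ((2 * y * a j / R)\<^sup>2 / 2))"
    by (intro mult_left_mono cosh_le_exp_square) auto
  also have "\<dots> = 2 ^ Suc (card I) * exp ((y\<^sup>2 / R + (2 * y * a j / R)\<^sup>2 / 2) + (a j)\<^sup>2 / R + s / 2)"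
    by (simp add: exp_add mult_ac)
  also have "\<dots> \<le> 2 ^ Suc (card I) * exp (y\<^sup>2 / (R - 2 * (a j)\<^sup>2) + (a j)\<^sup>2 / 2 + s / 2)"
  proof -
    have "(a j)\<^sup>2 / R \<le> (a j)\<^sup>2 / 2" using Rpos by (intro divide_left_mono) auto
    moreover have "y\<^sup>2 / R + (2 * y * a j / R)\<^sup>2 / 2 \<le> y\<^sup>2 / (R - 2 * (a j)\<^sup>2)"
    proof -
      let ?u = "2 * (a j)\<^sup>2"
      have "(R + ?u) * (R - ?u) \<le> R * R" by (simp add: algebra_simps)
      then have "(R + ?u) / (R * R) \<le> 1 / (R - ?u)"
        using R2 Rpos by (simp add: field_simps)
      then have "y\<^sup>2 * ((R + ?u) / (R * R)) \<le> y\<^sup>2 * (1 / (R - ?u))"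
        by (intro mult_left_mono) auto
      moreover have "y\<^sup>2 / R + (2 * y * a j / R)\<^sup>2 / 2 = y\<^sup>2 * ((R + ?u) / (R * R))"
        using Rpos by (simp add: field_simps power2_eq_square)
      ultimately show ?thesis by simp
    qed
    ultimately have "(y\<^sup>2 / R + (2 * y * a j / R)\<^sup>2 / 2) + (a j)\<^sup>2 / R + s / 2
        \<le> y\<^sup>2 / (R - 2 * (a j)\<^sup>2) + (a j)\<^sup>2 / 2 + s / 2"
      by linarith
    then show ?thesis by (intro mult_left_mono) (simp_all only: exp_le_cancel_iff, simp)
  qed
  also have "\<dots> = 2 ^ card (insert j I) *
      exp (y\<^sup>2 / (r - 2 * (\<Sum>i\<in>insert j I. (a i)\<^sup>2)) + (\<Sum>i\<in>insert j I. (a i)\<^sup>2) / 2)"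
    unfolding tot using insert.hyps by (simp add: R_def algebra_simps add_divide_distrib)
  finally show ?case .
qed

lemma sum_exp_signed_sum_square:
  assumes "finite I" "(\<Sum>i\<in>I. (a i)\<^sup>2) \<le> 1"
  shows "(\<Sum>S\<in>Pow I. exp ((signed_sum I a S)\<^sup>2 / 4)) \<le> 2 ^ card I * exp (1/2)"
proof -
  have "(\<Sum>S\<in>Pow I. exp ((signed_sum I a S)\<^sup>2 / 4)) \<le> 2 ^ card I * exp ((\<Sum>i\<in>I. (a i)\<^sup>2) / 2)"
    using sum_exp_signed_sum_square_offset[of I 4 a 0] assms by simp
  also have "\<dots> \<le> 2 ^ card I * exp (1/2)" using assms by simp
  finally show ?thesis .
qed

lemma exp_le_quadratic:
  fixes x :: real
  shows "exp x \<le> 1 + x + x\<^sup>2 * exp \<bar>x\<bar>"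
proof -
  obtain t where t: "\<bar>t\<bar> \<le> \<bar>x\<bar>" "exp x = (\<Sum>m<2. x ^ m / fact m) + exp t / fact 2 * x ^ 2"
    using Maclaurin_exp_le[of x 2] by blast
  have "exp t \<le> exp \<bar>x\<bar>" using t(1) by simp
  then have "exp t / 2 \<le> exp \<bar>x\<bar>" using exp_gt_zero[of t] by linarith
  then have "exp t / 2 * x\<^sup>2 \<le> exp \<bar>x\<bar> * x\<^sup>2" by (intro mult_right_mono) auto
  then show ?thesis using t(2) by (simp add: numeral_2_eq_2 mult.commute)
qed

text \<open>By the arithmetic-geometric mean inequality the previous bound also gives an exponential moment
  for the product of two signed sums.  After its mean \<open>\<Sum>i. a i * b i\<close> has been subtracted, the linear
  term of the Laplace transform vanishes and only an error of order \<open>\<mu>\<^sup>2\<close> is left; this is what makes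
  the deviations in the next lemma exponentially unlikely.\<close>

lemma laplace_signed_sum_product:
  assumes I: "finite I" and a: "(\<Sum>i\<in>I. (a i)\<^sup>2) \<le> 1" and b: "(\<Sum>i\<in>I. (b i)\<^sup>2) \<le> 1"
    and l: "\<bar>\<mu>\<bar> \<le> 1/8"
  shows "(\<Sum>S\<in>Pow I. exp (\<mu> * (signed_sum I a S * signed_sum I b S - (\<Sum>i\<in>I. a i * b i))))
    \<le> 2 ^ card I * exp (384 * \<mu>\<^sup>2)"
proof -
  let ?ab = "\<Sum>i\<in>I. a i * b i"
  let ?X = "\<lambda>S. signed_sum I a S * signed_sum I b S - ?ab"
  let ?U = "\<lambda>S. exp ((signed_sum I a S)\<^sup>2 / 4)" and ?V = "\<lambda>S. exp ((signed_sum I b S)\<^sup>2 / 4)"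
  have prod_le: "\<bar>x * y\<bar> \<le> (x\<^sup>2 + y\<^sup>2) / 2" for x y :: real
    using sum_squares_bound[of "\<bar>x\<bar>" "\<bar>y\<bar>"] by (simp add: abs_mult)
  have "\<bar>?ab\<bar> \<le> (\<Sum>i\<in>I. \<bar>a i * b i\<bar>)" by (rule sum_abs)
  also have "\<dots> \<le> (\<Sum>i\<in>I. ((a i)\<^sup>2 + (b i)\<^sup>2) / 2)" by (intro sum_mono prod_le)
  also have "\<dots> = ((\<Sum>i\<in>I. (a i)\<^sup>2) + (\<Sum>i\<in>I. (b i)\<^sup>2)) / 2"
    by (simp add: sum.distrib sum_divide_distrib [symmetric])
  finally have ab1: "\<bar>?ab\<bar> \<le> 1" using a b by simp
  have point: "exp (\<mu> * ?X S) \<le> 1 + \<mu> * ?X S + \<mu>\<^sup>2 * (128 * exp (1/4) * ((?U S + ?V S) / 2))" for S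
  proof -
    let ?x = "?X S"
    have lx: "\<bar>\<mu> * ?x\<bar> \<le> \<bar>?x\<bar> / 8" using mult_right_mono[OF l, of "\<bar>?x\<bar>"] by (simp add: abs_mult)
    have "(\<bar>?x\<bar> / 8)\<^sup>2 / 2 \<le> exp (\<bar>?x\<bar> / 8)"
      using exp_lower_Taylor_quadratic[of "\<bar>?x\<bar> / 8"] abs_ge_zero[of ?x]
      by (smt (verit) divide_nonneg_nonneg)
    then have x2: "?x\<^sup>2 \<le> 128 * exp (\<bar>?x\<bar> / 8)" by (simp add: power_divide)
    have xle: "\<bar>?x\<bar> \<le> ((signed_sum I a S)\<^sup>2 + (signed_sum I b S)\<^sup>2) / 2 + 1"
      using prod_le[of "signed_sum I a S" "signed_sum I b S"] ab1 by linarith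
    have quarter: "v / 4 \<le> 1/4 + x / 8 + y / 8" if "v \<le> (x + y) / 2 + 1" for v x y :: real
      using that by (simp add: field_simps)
    have "exp (\<bar>?x\<bar> / 4) \<le> exp (1/4 + (signed_sum I a S)\<^sup>2 / 8 + (signed_sum I b S)\<^sup>2 / 8)"
      unfolding exp_le_cancel_iff by (rule quarter[OF xle])
    also have "\<dots> = exp (1/4) * (exp ((signed_sum I a S)\<^sup>2 / 8) * exp ((signed_sum I b S)\<^sup>2 / 8))"
      by (simp add: exp_add)
    also have "\<dots> \<le> exp (1/4) * (((exp ((signed_sum I a S)\<^sup>2 / 8))\<^sup>2 + (exp ((signed_sum I b S)\<^sup>2 / 8))\<^sup>2) / 2)"
      using prod_le[of "exp ((signed_sum I a S)\<^sup>2 / 8)" "exp ((signed_sum I b S)\<^sup>2 / 8)"]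
      by (intro mult_left_mono) auto
    also have "\<dots> = exp (1/4) * ((?U S + ?V S) / 2)"
      by (simp add: exp_double [symmetric])
    finally have e4: "exp (\<bar>?x\<bar> / 4) \<le> exp (1/4) * ((?U S + ?V S) / 2)" .
    have "exp (\<mu> * ?x) \<le> 1 + \<mu> * ?x + (\<mu> * ?x)\<^sup>2 * exp \<bar>\<mu> * ?x\<bar>" by (rule exp_le_quadratic)
    also have "(\<mu> * ?x)\<^sup>2 * exp \<bar>\<mu> * ?x\<bar> \<le> (\<mu>\<^sup>2 * (128 * exp (\<bar>?x\<bar> / 8))) * exp (\<bar>?x\<bar> / 8)"
      unfolding power_mult_distrib using x2 lx by (intro mult_mono mult_left_mono) auto
    also have "\<dots> = \<mu>\<^sup>2 * (128 * exp (\<bar>?x\<bar> / 4))"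
      using exp_add[of "\<bar>?x\<bar> / 8" "\<bar>?x\<bar> / 8"] by simp
    also have "\<dots> \<le> \<mu>\<^sup>2 * (128 * (exp (1/4) * ((?U S + ?V S) / 2)))"
      using e4 by (intro mult_left_mono) auto
    finally show ?thesis by (simp add: mult_ac)
  qed
  have mean: "(\<Sum>S\<in>Pow I. ?X S) = 0"
    using I by (simp add: sum_subtractf sum_signed_sum_mult card_Pow)
  have "(\<Sum>S\<in>Pow I. exp (\<mu> * ?X S))
     \<le> (\<Sum>S\<in>Pow I. 1 + \<mu> * ?X S + \<mu>\<^sup>2 * (128 * exp (1/4) * ((?U S + ?V S) / 2)))"
    by (intro sum_mono point)
  also have "\<dots> = 2 ^ card I + \<mu> * (\<Sum>S\<in>Pow I. ?X S)
       + \<mu>\<^sup>2 * (128 * exp (1/4) * (((\<Sum>S\<in>Pow I. ?U S) + (\<Sum>S\<in>Pow I. ?V S)) / 2))"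
    using I by (simp add: sum.distrib sum_distrib_left [symmetric] sum_divide_distrib [symmetric] card_Pow)
  also have "\<dots> \<le> 2 ^ card I + 0 + \<mu>\<^sup>2 * (128 * exp (1/4) * ((2 ^ card I * exp (1/2) + 2 ^ card I * exp (1/2)) / 2))"
    using mean sum_exp_signed_sum_square[OF I a] sum_exp_signed_sum_square[OF I b]
    by (intro add_mono mult_left_mono divide_right_mono) auto
  also have "\<dots> = 2 ^ card I * (1 + 128 * \<mu>\<^sup>2 * exp (3/4))"
    using exp_add[of "1/4 :: real" "1/2"] by (simp add: algebra_simps)
  also have "\<dots> \<le> 2 ^ card I * (1 + 384 * \<mu>\<^sup>2)"
  proof -
    have "exp (3/4 :: real) \<le> exp 1" by simp
    also have "exp (1 :: real) \<le> 3" by (rule exp_le)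
    finally have "\<mu>\<^sup>2 * exp (3/4) \<le> \<mu>\<^sup>2 * 3" by (intro mult_left_mono) auto
    then show ?thesis by simp
  qed
  also have "\<dots> \<le> 2 ^ card I * exp (384 * \<mu>\<^sup>2)"
    by (intro mult_left_mono) auto
  finally show ?thesis .
qed

text \<open>Chernoff's method for \<open>m\<close> independent rows of signs.  With the parameter \<open>\<mu> = 1 / 6144\<close> the gain
  \<open>\<mu> / 8 = 1 / 49152\<close> per row is twice the loss \<open>384 * \<mu>\<^sup>2 = 1 / 98304\<close>.\<close>

lemma card_sign_rows_large_deviation:
  assumes I: "finite I" and a: "(\<Sum>i\<in>I. (a i)\<^sup>2) \<le> 1" and b: "(\<Sum>i\<in>I. (b i)\<^sup>2) \<le> 1"
  shows "real (card {G \<in> {..<m} \<rightarrow>\<^sub>E Pow I.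
      real m / 8 \<le> \<bar>\<Sum>l<m. signed_sum I a (G l) * signed_sum I b (G l) - (\<Sum>i\<in>I. a i * b i)\<bar>})
    \<le> 2 * exp (- real m / 98304) * real (card ({..<m} \<rightarrow>\<^sub>E Pow I))"
proof -
  let ?X = "\<lambda>S. signed_sum I a S * signed_sum I b S - (\<Sum>i\<in>I. a i * b i)"
  let ?R = "{..<m} \<rightarrow>\<^sub>E Pow I"
  have finR: "finite ?R" using I by (intro finite_PiE) auto
  have cardR: "real (card ?R) = (2 ^ card I) ^ m"
    using I by (simp add: card_PiE card_Pow)
  have tail: "real (card {G \<in> ?R. real m / 8 \<le> c * (\<Sum>l<m. ?X (G l))})
      \<le> exp (- real m / 98304) * real (card ?R)" if c: "\<bar>c\<bar> = 1" for c :: real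
  proof -
    let ?B = "{G \<in> ?R. real m / 8 \<le> c * (\<Sum>l<m. ?X (G l))}"
    define \<mu> :: real where "\<mu> = c / 6144"
    have mu: "\<bar>\<mu>\<bar> \<le> 1/8" "\<mu>\<^sup>2 = 1 / 37748736"
      using c by (auto simp: \<mu>_def abs_eq_iff' power2_eq_square)
    have "real (card ?B) * exp (real m / 49152) = (\<Sum>G\<in>?B. exp (real m / 49152))" by simp
    also have "\<dots> \<le> (\<Sum>G\<in>?B. exp (\<mu> * (\<Sum>l<m. ?X (G l))))"
      by (intro sum_mono) (auto simp: \<mu>_def)
    also have "\<dots> \<le> (\<Sum>G\<in>?R. exp (\<mu> * (\<Sum>l<m. ?X (G l))))"
      using finR by (intro sum_mono2) auto
    also have "\<dots> = (\<Sum>G\<in>?R. \<Prod>l<m. exp (\<mu> * ?X (G l)))"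
      by (simp add: sum_distrib_left exp_sum)
    also have "\<dots> = (\<Prod>l<m. \<Sum>S\<in>Pow I. exp (\<mu> * ?X S))"
      using I by (intro prod_sum_PiE [symmetric]) auto
    also have "\<dots> \<le> (\<Prod>l<m. 2 ^ card I * exp (384 * \<mu>\<^sup>2))"
      using laplace_signed_sum_product[OF I a b mu(1)] by (intro prod_mono) (auto intro: sum_nonneg)
    also have "\<dots> = real (card ?R) * exp (real m / 98304)"
      by (simp add: cardR mu power_mult_distrib exp_of_nat_mult [symmetric])
    finally have "real (card ?B) * exp (real m / 49152) \<le> real (card ?R) * exp (real m / 98304)" .
    moreover have "exp (real m / 49152) = exp (real m / 98304) * exp (real m / 98304)"
      using exp_add[of "real m / 98304" "real m / 98304"] by simp
    ultimately have "real (card ?B) * exp (real m / 98304) \<le> real (card ?R)"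
      by (simp add: mult.assoc [symmetric])
    then show ?thesis by (simp add: exp_minus field_simps)
  qed
  have "{G \<in> ?R. real m / 8 \<le> \<bar>\<Sum>l<m. ?X (G l)\<bar>}
     \<subseteq> {G \<in> ?R. real m / 8 \<le> 1 * (\<Sum>l<m. ?X (G l))} \<union> {G \<in> ?R. real m / 8 \<le> -1 * (\<Sum>l<m. ?X (G l))}"
    (is "?B \<subseteq> ?B1 \<union> ?B2") by (auto simp: abs_if)
  then have "card ?B \<le> card (?B1 \<union> ?B2)" using finR by (intro card_mono) auto
  also have "\<dots> \<le> card ?B1 + card ?B2" by (rule card_Un_le)
  finally have "real (card ?B) \<le> real (card ?B1) + real (card ?B2)" by linarith
  then show ?thesis using tail[of 1] tail[of "-1"] by simp
qed

lemma exists_sign_rows_almost_isometric: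
  assumes I: "finite I" and Z: "finite Z" "\<And>a. a \<in> Z \<Longrightarrow> (\<Sum>i\<in>I. (a i)\<^sup>2) \<le> 1"
    and m: "2 * (real (card Z))\<^sup>2 * exp (- real m / 98304) < 1"
  shows "\<exists>G :: nat \<Rightarrow> 'i set. \<forall>a\<in>Z. \<forall>b\<in>Z.
    \<bar>(\<Sum>l<m. signed_sum I a (G l) * signed_sum I b (G l)) - real m * (\<Sum>i\<in>I. a i * b i)\<bar> < real m / 8"
proof -
  let ?R = "{..<m} \<rightarrow>\<^sub>E Pow I"
  let ?X = "\<lambda>a b S. signed_sum I a S * signed_sum I b S - (\<Sum>i\<in>I. a i * b i)"
  let ?B = "\<lambda>ab. {G \<in> ?R. real m / 8 \<le> \<bar>\<Sum>l<m. ?X (fst ab) (snd ab) (G l)\<bar>}"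
  have finR: "finite ?R" using I by (intro finite_PiE) auto
  have "?R \<noteq> {}" by (auto simp: PiE_eq_empty_iff)
  then have posR: "real (card ?R) > 0" using finR by (simp add: card_gt_0_iff)
  have "real (card (\<Union>ab\<in>Z \<times> Z. ?B ab)) \<le> (\<Sum>ab\<in>Z \<times> Z. real (card (?B ab)))"
    using card_UN_le[of "Z \<times> Z" ?B] Z(1) unfolding of_nat_sum [symmetric] by (intro of_nat_mono) auto
  also have "\<dots> \<le> (\<Sum>ab\<in>Z \<times> Z. 2 * exp (- real m / 98304) * real (card ?R))"
    using Z(2) by (intro sum_mono card_sign_rows_large_deviation[OF I]) auto
  also have "\<dots> = (2 * (real (card Z))\<^sup>2 * exp (- real m / 98304)) * real (card ?R)"
    by (simp add: card_cartesian_product power2_eq_square)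
  also have "\<dots> < 1 * real (card ?R)"
    by (intro mult_strict_right_mono m posR)
  finally have "card (\<Union>ab\<in>Z \<times> Z. ?B ab) < card ?R" by simp
  moreover have finB: "finite (\<Union>ab\<in>Z \<times> Z. ?B ab)" using finR Z(1) by (intro finite_UN_I) auto
  ultimately have "\<not> ?R \<subseteq> (\<Union>ab\<in>Z \<times> Z. ?B ab)"
    using card_mono[OF finB, of ?R] by linarith
  then obtain G where G: "G \<in> ?R" "G \<notin> (\<Union>ab\<in>Z \<times> Z. ?B ab)" by blast
  show ?thesis
  proof (intro exI ballI)
    fix a b assume "a \<in> Z" "b \<in> Z"
    then have "\<not> real m / 8 \<le> \<bar>\<Sum>l<m. ?X a b (G l)\<bar>" using G by force
    then show "\<bar>(\<Sum>l<m. signed_sum I a (G l) * signed_sum I b (G l)) - real m * (\<Sum>i\<in>I. a i * b i)\<bar> < real m / 8"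
      by (simp add: sum_subtractf)
  qed
qed


section \<open>Sup-norm approximation of the Euclidean ball by a low-dimensional space\<close>

text \<open>Rounding towards \<open>0\<close>, so that neither the size nor the sign of a number is exceeded.\<close>

definition trunc :: "real \<Rightarrow> int"
  where "trunc x = (if x \<ge> 0 then \<lfloor>x\<rfloor> else \<lceil>x\<rceil>)"

lemma abs_diff_trunc_le: "\<bar>x - real_of_int (trunc x)\<bar> \<le> 1"
  unfolding trunc_def by (simp split: if_splits) linarith

lemma abs_trunc_le: "\<bar>real_of_int (trunc x)\<bar> \<le> \<bar>x\<bar>"
proof (cases "x \<ge> 0")
  case False
  then have "\<lceil>x\<rceil> \<le> 0" by simp
  moreover have "x \<le> real_of_int \<lceil>x\<rceil>" by simp
  ultimately show ?thesis using False by (simp add: trunc_def)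
qed (simp add: trunc_def)

lemma trunc_square_le: "(real_of_int (trunc x))\<^sup>2 \<le> x\<^sup>2"
  using abs_trunc_le[of x] by (simp only: abs_le_square_iff)

lemma trunc_pos_imp: "trunc x > 0 \<Longrightarrow> x > 0"
  and trunc_neg_imp: "trunc x < 0 \<Longrightarrow> x < 0"
  by (simp_all add: trunc_def split: if_splits)

lemma exists_subset_sum_between:
  fixes f :: "'i \<Rightarrow> real"
  assumes "finite I" "0 \<le> t" "\<And>i. i \<in> I \<Longrightarrow> 0 \<le> f i" "\<And>i. i \<in> I \<Longrightarrow> f i \<le> t" "t < sum f I"
  shows "\<exists>J\<subseteq>I. t / 2 \<le> sum f J \<and> sum f J \<le> t"
  using assms
proof (induction I rule: finite_induct)
  case empty
  then show ?case by (intro exI[of _ "{}"]) auto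
next
  case (insert j I)
  consider "t < sum f I" | "sum f I \<le> t" "t / 2 \<le> sum f I" | "sum f I < t / 2" by linarith
  then show ?case
  proof cases
    case 1
    then show ?thesis using insert by blast
  next
    case 2
    then show ?thesis by blast
  next
    case 3
    then have "t / 2 \<le> f j" using insert by simp
    then show ?thesis using insert by (intro exI[of _ "{j}"]) auto
  qed
qed

text \<open>Either one entry is large enough to be cut down to \<open>\<plusminus>r\<close>, or all entries are small and a suitable
  subset of them is kept.\<close>

lemma exists_shrunk_integer_vector:
  fixes z :: "'i \<Rightarrow> int" and r :: nat
  assumes "finite I" and "r \<ge> 1" and big: "(real r)\<^sup>2 < (\<Sum>i\<in>I. (real_of_int (z i))\<^sup>2)"
  shows "\<exists>w :: 'i \<Rightarrow> int. (\<forall>i. i \<notin> I \<longrightarrow> w i = 0) \<and> (\<forall>i. \<bar>w i\<bar> \<le> \<bar>z i\<bar> \<and> 0 \<le> w i * z i)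
    \<and> (real r)\<^sup>2 / 2 \<le> (\<Sum>i\<in>I. (real_of_int (w i))\<^sup>2) \<and> (\<Sum>i\<in>I. (real_of_int (w i))\<^sup>2) \<le> (real r)\<^sup>2"
proof (cases "\<exists>j\<in>I. int r \<le> \<bar>z j\<bar>")
  case True
  then obtain j where j: "j \<in> I" "int r \<le> \<bar>z j\<bar>" by blast
  define w where "w = (\<lambda>i. if i = j then sgn (z j) * int r else 0)"
  have "z j \<noteq> 0" using j assms(2) by auto
  then have sq: "(real_of_int (sgn (z j) * int r))\<^sup>2 = (real r)\<^sup>2"
    by (auto simp: sgn_if)
  have "(\<Sum>i\<in>I. (real_of_int (w i))\<^sup>2) = (\<Sum>i\<in>I. if i = j then (real r)\<^sup>2 else 0)"
    using sq by (intro sum.cong) (auto simp: w_def)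
  also have "\<dots> = (real r)\<^sup>2" using j assms(1) by simp
  finally have tot: "(\<Sum>i\<in>I. (real_of_int (w i))\<^sup>2) = (real r)\<^sup>2" .
  have "\<bar>w i\<bar> \<le> \<bar>z i\<bar> \<and> 0 \<le> w i * z i" for i
    using j by (auto simp: w_def abs_mult sgn_if mult_nonneg_nonneg mult_nonneg_nonpos)
  moreover have "\<forall>i. i \<notin> I \<longrightarrow> w i = 0" using j by (auto simp: w_def)
  ultimately show ?thesis using tot by (intro exI[of _ w]) auto
next
  case False
  then have small: "(real_of_int (z i))\<^sup>2 \<le> (real r)\<^sup>2" if "i \<in> I" for i
  proof -
    have "\<bar>z i\<bar> \<le> int r" using False that by force
    then have "\<bar>real_of_int (z i)\<bar> \<le> \<bar>real r\<bar>" by linarith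
    then show ?thesis by (simp only: abs_le_square_iff)
  qed
  obtain J where J: "J \<subseteq> I" "(real r)\<^sup>2 / 2 \<le> (\<Sum>i\<in>J. (real_of_int (z i))\<^sup>2)"
      "(\<Sum>i\<in>J. (real_of_int (z i))\<^sup>2) \<le> (real r)\<^sup>2"
    using exists_subset_sum_between[OF assms(1) _ _ small big] by auto
  have "(\<Sum>i\<in>I. (real_of_int (if i \<in> J then z i else 0))\<^sup>2) = (\<Sum>i\<in>J. (real_of_int (z i))\<^sup>2)"
    using J(1) assms(1) by (intro sum.mono_neutral_cong_right) auto
  then show ?thesis
    using J by (intro exI[of _ "\<lambda>i. if i \<in> J then z i else 0"]) auto
qed

text \<open>Rounding the coordinates of a vector of the Euclidean unit ball to multiples of \<open>1 / r\<close> gives one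
  of these vectors.  They have at most \<open>r\<^sup>2\<close> nonzero coordinates, so there are few of them.\<close>

definition flat_vectors :: "'i set \<Rightarrow> nat \<Rightarrow> ('i \<Rightarrow> real) set"
  where "flat_vectors I r = {\<lambda>i. real_of_int (z i) / real r |z.
     (\<forall>i. i \<notin> I \<longrightarrow> z i = 0) \<and> (\<Sum>i\<in>I. (real_of_int (z i))\<^sup>2) \<le> (real r)\<^sup>2}"

lemma flat_vectors_norm_le:
  assumes "a \<in> flat_vectors I r" "r \<ge> 1"
  shows "(\<Sum>i\<in>I. (a i)\<^sup>2) \<le> 1"
proof -
  obtain z where z: "a = (\<lambda>i. real_of_int (z i) / real r)" "(\<Sum>i\<in>I. (real_of_int (z i))\<^sup>2) \<le> (real r)\<^sup>2"
    using assms(1) unfolding flat_vectors_def by auto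
  have "(\<Sum>i\<in>I. (a i)\<^sup>2) = (\<Sum>i\<in>I. (real_of_int (z i))\<^sup>2) / (real r)\<^sup>2"
    unfolding z(1) by (simp add: power_divide sum_divide_distrib)
  also have "\<dots> \<le> 1" using z(2) assms(2) by simp
  finally show ?thesis .
qed

lemma card_flat_vectors:
  assumes "finite I" "\<mu> > 0"
  shows "finite (flat_vectors I r)"
    and "real (card (flat_vectors I r)) \<le> exp (\<mu> * (real r)\<^sup>2 + 2 / (exp \<mu> - 1) * real (card I))"
proof -
  let ?L = "lattice_ball I ((real r)\<^sup>2)"
  have sub: "flat_vectors I r \<subseteq> (\<lambda>z i. real_of_int (z i) / real r) ` ?L"
  proof
    fix a assume "a \<in> flat_vectors I r"
    then obtain z where z: "a = (\<lambda>i. real_of_int (z i) / real r)" "\<forall>i. i \<notin> I \<longrightarrow> z i = 0"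
      "(\<Sum>i\<in>I. (real_of_int (z i))\<^sup>2) \<le> (real r)\<^sup>2"
      unfolding flat_vectors_def by auto
    have "\<bar>real_of_int k\<bar> \<le> (real_of_int k)\<^sup>2" for k :: int
    proof (cases "k = 0")
      case False
      then have "1 \<le> \<bar>real_of_int k\<bar>" by linarith
      then have "\<bar>real_of_int k\<bar> * 1 \<le> \<bar>real_of_int k\<bar> * \<bar>real_of_int k\<bar>"
        by (intro mult_left_mono) auto
      then show ?thesis by (simp add: power2_eq_square)
    qed simp
    then have "(\<Sum>i\<in>I. \<bar>real_of_int (z i)\<bar>) \<le> (\<Sum>i\<in>I. (real_of_int (z i))\<^sup>2)"
      by (intro sum_mono)
    then have "z \<in> ?L" using z by (simp add: lattice_ball_def)
    then show "a \<in> (\<lambda>z i. real_of_int (z i) / real r) ` ?L" using z(1) by blast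
  qed
  note L = card_lattice_ball[OF assms, of "(real r)\<^sup>2"]
  show "finite (flat_vectors I r)" using sub L(1) by (auto intro: finite_subset)
  have "card (flat_vectors I r) \<le> card ((\<lambda>z i. real_of_int (z i) / real r) ` ?L)"
    using sub L(1) by (intro card_mono) auto
  also have "\<dots> \<le> card ?L" using L(1) by (rule card_image_le)
  finally show "real (card (flat_vectors I r)) \<le> exp (\<mu> * (real r)\<^sup>2 + 2 / (exp \<mu> - 1) * real (card I))"
    using L(3) by linarith
qed

text \<open>The Kolmogorov widths of the Euclidean ball in the supremum norm (Kashin, Garnaev and Gluskin).
  The approximating space is spanned by the rows \<open>w l\<close> of a sign matrix \<open>G\<close> that preserves the inner
  products of flat vectors up to \<open>1 / 8\<close>.

  A vector \<open>x\<close> of the unit ball is a flat vector \<open>a\<close> plus an error of at most \<open>1 / r\<close> in each coordinate,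
  and \<open>a\<close> is \<open>G\<^sup>T G a / m\<close>, which lies in the row space, plus \<open>h\<close>.  The point is that \<open>2 * h\<close> again is
  a flat vector up to \<open>1 / r\<close> in each coordinate: if its rounding had Euclidean norm more than \<open>1\<close>, it
  could be shrunk to a flat vector whose inner product with \<open>h\<close> is at least \<open>1 / 4\<close>, but this inner
  product measures how far \<open>G\<close> is from an isometry.  So the argument can be repeated with \<open>h\<close> in place
  of \<open>x\<close>, with a gain of a factor \<open>2\<close> each time.\<close>

theorem euclidean_ball_sup_norm_approximation:
  fixes I :: "'i set" and r m :: nat
  assumes I: "finite I" and r: "r \<ge> 1" and mu: "\<mu> > 0"
    and m: "98304 * (2 * \<mu> * (real r)\<^sup>2 + 4 / (exp \<mu> - 1) * real (card I) + 1) \<le> real m"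
  shows "\<exists>w :: nat \<Rightarrow> 'i \<Rightarrow> real. \<forall>x. (\<Sum>i\<in>I. (x i)\<^sup>2) \<le> 1 \<longrightarrow>
    (\<exists>y. \<forall>i\<in>I. \<bar>x i - (\<Sum>l<m. y l * w l i)\<bar> \<le> 4 / real r)"
proof -
  let ?Z = "flat_vectors I r"
  have mpos: "real m > 0"
  proof -
    have "0 \<le> 2 * \<mu> * (real r)\<^sup>2" "0 \<le> 4 / (exp \<mu> - 1) * real (card I)" using mu by auto
    moreover have "0 < M" if "0 \<le> P" "0 \<le> Q" "98304 * (P + Q + 1) \<le> M" for P Q M :: real
      using that by argo
    ultimately show ?thesis using m by blast
  qed
  have "2 * (real (card ?Z))\<^sup>2 * exp (- real m / 98304) < 1"
  proof -
    have "(real (card ?Z))\<^sup>2 \<le> (exp (\<mu> * (real r)\<^sup>2 + 2 / (exp \<mu> - 1) * real (card I)))\<^sup>2"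
      using card_flat_vectors(2)[OF I mu] by (intro power_mono) auto
    also have "\<dots> = exp (2 * \<mu> * (real r)\<^sup>2 + 4 / (exp \<mu> - 1) * real (card I))"
      by (subst exp_double [symmetric]) (simp add: distrib_left mult.assoc)
    also have "\<dots> \<le> exp (real m / 98304 - 1)" using m by (simp add: field_simps)
    finally have "2 * (real (card ?Z))\<^sup>2 * exp (- real m / 98304)
       \<le> 2 * exp (real m / 98304 - 1) * exp (- real m / 98304)"
      by (intro mult_right_mono mult_left_mono) auto
    also have "\<dots> = 2 * exp (- 1)" by (simp add: mult.assoc mult_exp_exp)
    also have "\<dots> < 1"
    proof -
      have "(2::real) < exp 1" using exp_lower_Taylor_quadratic[of "1::real"] by simp
      then show ?thesis by (simp add: exp_minus field_simps)
    qed
    finally show ?thesis .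
  qed
  from exists_sign_rows_almost_isometric[OF I card_flat_vectors(1)[OF I mu] flat_vectors_norm_le[OF _ r] this]
  obtain G :: "nat \<Rightarrow> 'i set" where G: "\<And>a b. a \<in> ?Z \<Longrightarrow> b \<in> ?Z \<Longrightarrow>
    \<bar>(\<Sum>l<m. signed_sum I a (G l) * signed_sum I b (G l)) - real m * (\<Sum>i\<in>I. a i * b i)\<bar> < real m / 8"
    by blast
  define w where "w = (\<lambda>l. sign_of (G l))"
  (* The errors of the steps add up to 3 / r; the remainder after K steps is smaller than 1 / r. *)
  have iter: "\<exists>y. \<forall>i\<in>I. \<bar>x i - (\<Sum>l<m. y l * w l i)\<bar> \<le> 3 / real r + (1/2) ^ K"
    if "(\<Sum>i\<in>I. (x i)\<^sup>2) \<le> 1" for K x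
    using that
  proof (induction K arbitrary: x)
    case 0
    have "\<bar>x i\<bar> \<le> 1" if "i \<in> I" for i
    proof -
      have "(x i)\<^sup>2 \<le> (\<Sum>i\<in>I. (x i)\<^sup>2)" using I that by (intro member_le_sum) auto
      then have "(x i)\<^sup>2 \<le> 1" using 0 by linarith
      then show ?thesis by (simp add: abs_square_le_1)
    qed
    moreover have "1 \<le> 3 / real r + (1/2) ^ (0::nat)" by simp
    ultimately have "\<bar>x i - (\<Sum>l<m. 0 * w l i)\<bar> \<le> 3 / real r + (1/2) ^ 0" if "i \<in> I" for i
      using that by (force intro: order_trans[of _ 1])
    then show ?case by (intro exI[of _ "\<lambda>_. 0"]) simp
  next
    case (Suc K)
    have round: "(\<lambda>i. real_of_int (if i \<in> I then trunc (real r * v i) else 0) / real r) \<in> ?Z"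
      if "(\<Sum>i\<in>I. (real_of_int (trunc (real r * v i)))\<^sup>2) \<le> (real r)\<^sup>2" for v :: "'i \<Rightarrow> real"
      unfolding flat_vectors_def using that
      by (intro CollectI exI[of _ "\<lambda>i. if i \<in> I then trunc (real r * v i) else 0"]) auto
    define a where "a = (\<lambda>i. real_of_int (if i \<in> I then trunc (real r * x i) else 0) / real r)"
    have "(\<Sum>i\<in>I. (real_of_int (trunc (real r * x i)))\<^sup>2) \<le> (\<Sum>i\<in>I. (real r * x i)\<^sup>2)"
      by (intro sum_mono trunc_square_le)
    also have "\<dots> = (real r)\<^sup>2 * (\<Sum>i\<in>I. (x i)\<^sup>2)" by (simp add: power_mult_distrib sum_distrib_left)
    also have "\<dots> \<le> (real r)\<^sup>2 * 1" using Suc.prems by (intro mult_left_mono) auto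
    finally have aZ: "a \<in> ?Z" unfolding a_def by (intro round) simp
    define u where "u = (\<lambda>l. signed_sum I a (G l) / real m)"
    define h where "h = (\<lambda>i. a i - (\<Sum>l<m. u l * w l i))"
    have pairing: "\<bar>\<Sum>i\<in>I. h i * b i\<bar> < 1 / 8" if "b \<in> ?Z" for b
    proof -
      have "(\<Sum>i\<in>I. h i * b i) = (\<Sum>i\<in>I. a i * b i) - (\<Sum>i\<in>I. \<Sum>l<m. u l * (w l i * b i))"
        by (simp add: h_def left_diff_distrib sum_subtractf sum_distrib_right mult.assoc)
      also have "(\<Sum>i\<in>I. \<Sum>l<m. u l * (w l i * b i)) = (\<Sum>l<m. u l * signed_sum I b (G l))"
        by (subst sum.swap) (simp add: w_def signed_sum_def sum_distrib_left)
      also have "\<dots> = (\<Sum>l<m. signed_sum I a (G l) * signed_sum I b (G l)) / real m"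
        by (simp add: u_def sum_divide_distrib)
      finally have "real m * (\<Sum>i\<in>I. h i * b i)
          = real m * (\<Sum>i\<in>I. a i * b i) - (\<Sum>l<m. signed_sum I a (G l) * signed_sum I b (G l))"
        using mpos by (simp add: right_diff_distrib)
      then have "\<bar>real m * (\<Sum>i\<in>I. h i * b i)\<bar> < real m / 8"
        using G[OF aZ that] by linarith
      then have "real m * \<bar>\<Sum>i\<in>I. h i * b i\<bar> < real m * (1 / 8)"
        by (simp add: abs_mult)
      then show ?thesis using mpos by (simp only: mult_less_cancel_left_pos)
    qed
    define x1 where "x1 = (\<lambda>i. real_of_int (if i \<in> I then trunc (real r * (2 * h i)) else 0) / real r)"
    have "(\<Sum>i\<in>I. (real_of_int (trunc (real r * (2 * h i))))\<^sup>2) \<le> (real r)\<^sup>2"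
    proof (rule ccontr)
      assume "\<not> ?thesis"
      then have big: "(real r)\<^sup>2 < (\<Sum>i\<in>I. (real_of_int (trunc (real r * (2 * h i))))\<^sup>2)" by simp
      from exists_shrunk_integer_vector[OF I r big] obtain z :: "'i \<Rightarrow> int" where
        z0: "\<And>i. i \<notin> I \<Longrightarrow> z i = 0"
        and z: "\<And>i. \<bar>z i\<bar> \<le> \<bar>trunc (real r * (2 * h i))\<bar>" "\<And>i. 0 \<le> z i * trunc (real r * (2 * h i))"
        and zs: "(real r)\<^sup>2 / 2 \<le> (\<Sum>i\<in>I. (real_of_int (z i))\<^sup>2)" "(\<Sum>i\<in>I. (real_of_int (z i))\<^sup>2) \<le> (real r)\<^sup>2"
        by blast
      have bZ: "(\<lambda>i. real_of_int (z i) / real r) \<in> ?Z"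
        unfolding flat_vectors_def using z0 zs by blast
      have coord: "(real_of_int (z i))\<^sup>2 \<le> real r * (2 * h i) * real_of_int (z i)" for i
      proof -
        let ?t = "trunc (real r * (2 * h i))"
        have "\<bar>real_of_int (z i)\<bar> \<le> \<bar>real_of_int ?t\<bar>" using z(1)[of i] by linarith
        also have "\<dots> \<le> \<bar>real r * (2 * h i)\<bar>" by (rule abs_trunc_le)
        finally have "\<bar>real_of_int (z i)\<bar> * \<bar>real_of_int (z i)\<bar> \<le> \<bar>real r * (2 * h i)\<bar> * \<bar>real_of_int (z i)\<bar>"
          by (intro mult_right_mono) auto
        moreover have "\<bar>real r * (2 * h i)\<bar> * \<bar>real_of_int (z i)\<bar> = real r * (2 * h i) * real_of_int (z i)"
        proof -
          consider "z i = 0" | "z i > 0" "?t > 0" | "z i < 0" "?t < 0"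
            using z(1,2)[of i] by (cases "z i" "0::int" rule: linorder_cases)
              (auto simp: zero_le_mult_iff)
          then show ?thesis
          proof cases
            case 2
            then show ?thesis using trunc_pos_imp[OF 2(2)] by simp
          next
            case 3
            then show ?thesis using trunc_neg_imp[OF 3(2)] by (simp add: abs_of_neg)
          qed simp
        qed
        ultimately show ?thesis by (simp add: power2_eq_square)
      qed
      have "(real r)\<^sup>2 / 2 \<le> (\<Sum>i\<in>I. real r * (2 * h i) * real_of_int (z i))"
        by (rule order_trans[OF zs(1)]) (intro sum_mono coord)
      also have "\<dots> = 2 * (real r)\<^sup>2 * (\<Sum>i\<in>I. h i * (real_of_int (z i) / real r))"
        using r by (simp add: sum_distrib_left power2_eq_square mult_ac)
      also have "\<dots> < 2 * (real r)\<^sup>2 * (1/8)"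
        using pairing[OF bZ] r by (intro mult_strict_left_mono) auto
      finally show False using r by simp
    qed
    then have x1Z: "x1 \<in> ?Z" unfolding x1_def by (rule round)
    obtain y1 where y1: "\<And>i. i \<in> I \<Longrightarrow> \<bar>x1 i - (\<Sum>l<m. y1 l * w l i)\<bar> \<le> 3 / real r + (1/2) ^ K"
      using Suc.IH[OF flat_vectors_norm_le[OF x1Z r]] by blast
    have round_err: "\<bar>v - real_of_int (trunc (real r * v)) / real r\<bar> \<le> 1 / real r" for v
    proof -
      have "v - real_of_int (trunc (real r * v)) / real r = (real r * v - real_of_int (trunc (real r * v))) / real r"
        using r by (simp add: diff_divide_distrib)
      then have "\<bar>v - real_of_int (trunc (real r * v)) / real r\<bar> = \<bar>real r * v - real_of_int (trunc (real r * v))\<bar> / real r"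
        by (simp add: abs_divide)
      also have "\<dots> \<le> 1 / real r" by (intro divide_right_mono abs_diff_trunc_le) auto
      finally show ?thesis .
    qed
    have tri: "\<bar>e1 + e2 / 2 + e3 / 2\<bar> \<le> 3 * \<rho> + \<kappa> / 2"
      if "\<bar>e1\<bar> \<le> \<rho>" "\<bar>e2\<bar> \<le> \<rho>" "\<bar>e3\<bar> \<le> 3 * \<rho> + \<kappa>" for e1 e2 e3 \<rho> \<kappa> :: real
      using that by linarith
    show ?case
    proof (intro exI ballI)
      fix i assume i: "i \<in> I"
      have e1: "\<bar>x i - a i\<bar> \<le> 1 / real r" using round_err[of "x i"] i by (simp add: a_def)
      have e2: "\<bar>2 * h i - x1 i\<bar> \<le> 1 / real r" using round_err[of "2 * h i"] i by (simp add: x1_def)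
      have "(\<Sum>l<m. (u l + y1 l / 2) * w l i) = (\<Sum>l<m. u l * w l i) + (\<Sum>l<m. y1 l * w l i) / 2"
        by (simp add: distrib_right sum.distrib sum_divide_distrib)
      then have eq: "x i - (\<Sum>l<m. (u l + y1 l / 2) * w l i)
         = (x i - a i) + (2 * h i - x1 i) / 2 + (x1 i - (\<Sum>l<m. y1 l * w l i)) / 2"
        by (simp add: h_def diff_divide_distrib)
      have "\<bar>x1 i - (\<Sum>l<m. y1 l * w l i)\<bar> \<le> 3 * (1 / real r) + (1/2) ^ K" using y1[OF i] by simp
      from tri[OF e1 e2 this] show "\<bar>x i - (\<Sum>l<m. (u l + y1 l / 2) * w l i)\<bar> \<le> 3 / real r + (1/2) ^ Suc K"
        unfolding eq by simp
    qed
  qed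
  obtain K where K: "(1/2 :: real) ^ K < 1 / real r"
    using real_arch_pow_inv[of "1 / real r" "1/2"] r by auto
  show ?thesis
  proof (rule exI[of _ w], intro allI impI)
    fix x :: "'i \<Rightarrow> real" assume "(\<Sum>i\<in>I. (x i)\<^sup>2) \<le> 1"
    from iter[OF this, of K] obtain y where
      "\<And>i. i \<in> I \<Longrightarrow> \<bar>x i - (\<Sum>l<m. y l * w l i)\<bar> \<le> 3 / real r + (1/2) ^ K" by blast
    moreover have "3 / real r + (1/2) ^ K \<le> 4 / real r" using K by simp
    ultimately show "\<exists>y. \<forall>i\<in>I. \<bar>x i - (\<Sum>l<m. y l * w l i)\<bar> \<le> 4 / real r"
      by (meson order_trans)
  qed
qed

section \<open>Inequalities for integrals\<close>

text \<open>Hoelder's inequality, with the first norm replaced by an upper bound because the norms of the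
  kernels below are only estimated.\<close>

lemma holder_integral:
  fixes a b :: "'a \<Rightarrow> real"
  assumes pq: "p > 1" "q > 1" "1 / p + 1 / q = 1"
    and meas: "a \<in> borel_measurable M" "b \<in> borel_measurable M"
    and nonneg: "\<And>x. 0 \<le> a x" "\<And>x. 0 \<le> b x"
    and int: "integrable M (\<lambda>x. a x powr q)" "integrable M (\<lambda>x. b x powr p)"
    and A: "(\<integral>x. a x powr q \<partial>M) \<le> A" "A > 0"
  shows "integrable M (\<lambda>x. a x * b x)"
    and "(\<integral>x. a x * b x \<partial>M) \<le> A powr (1 / q) * (\<integral>x. b x powr p \<partial>M) powr (1 / p)"
proof -
  have young: "a x * b x \<le> a x powr q / q + b x powr p / p" for x
    using Youngs_inequality[of q p "a x" "b x"] pq nonneg by (simp add: add.commute)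
  show "integrable M (\<lambda>x. a x * b x)"
  proof (rule Bochner_Integration.integrable_bound)
    show "integrable M (\<lambda>x. a x powr q / q + b x powr p / p)" using int by simp
    show "(\<lambda>x. a x * b x) \<in> borel_measurable M" using meas by measurable
    show "AE x in M. norm (a x * b x) \<le> norm (a x powr q / q + b x powr p / p)"
    proof (intro AE_I2)
      fix x
      have "0 \<le> a x * b x" using nonneg by simp
      then show "norm (a x * b x) \<le> norm (a x powr q / q + b x powr p / p)"
        using young[of x] by (simp only: real_norm_def)
    qed
  qed
  define B where "B = (\<integral>x. b x powr p \<partial>M)"
  show "(\<integral>x. a x * b x \<partial>M) \<le> A powr (1 / q) * B powr (1 / p)"
  proof (cases "B = 0")
    case True
    then have "AE x in M. b x powr p = 0"
      using integral_nonneg_eq_0_iff_AE[OF int(2)] by (simp add: B_def)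
    then have "AE x in M. a x * b x = 0" by (auto elim!: AE_mp)
    then have "(\<integral>x. a x * b x \<partial>M) = (\<integral>x. 0 \<partial>M)"
      using meas by (intro integral_cong_AE) auto
    then show ?thesis by simp
  next
    case False
    then have B: "B > 0" unfolding B_def 
      by (metis Bochner_Integration.integral_nonneg powr_ge_zero order_le_less)
    define s t where "s = A powr (1 / q)" and "t = B powr (1 / p)"
    have st: "s > 0" "t > 0" "s powr q = A" "t powr p = B"
      using A B pq by (auto simp: s_def t_def powr_powr)
    have point: "a x * b x \<le> s * t * (a x powr q / (A * q) + b x powr p / (B * p))" for x
    proof -
      have "(a x / s) * (b x / t) \<le> (a x / s) powr q / q + (b x / t) powr p / p"
        using Youngs_inequality[of q p "a x / s" "b x / t"] pq nonneg[of x] st by (simp add: add.commute)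
      also have "\<dots> = a x powr q / (A * q) + b x powr p / (B * p)"
        using nonneg[of x] st by (simp add: powr_divide)
      finally have "s * t * ((a x / s) * (b x / t)) \<le> s * t * (a x powr q / (A * q) + b x powr p / (B * p))"
        using st by (intro mult_left_mono) auto
      then show ?thesis using st by simp
    qed
    have "(\<integral>x. a x * b x \<partial>M) \<le> (\<integral>x. s * t * (a x powr q / (A * q) + b x powr p / (B * p)) \<partial>M)"
      using int by (intro integral_mono \<open>integrable M (\<lambda>x. a x * b x)\<close> point) auto
    also have "\<dots> = s * t * ((\<integral>x. a x powr q \<partial>M) / (A * q) + B / (B * p))"
      using int by (simp add: B_def)
    also have "\<dots> \<le> s * t * (A / (A * q) + B / (B * p))"
      using st A pq by (intro mult_left_mono add_right_mono divide_right_mono) auto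
    also have "\<dots> = s * t" using A B pq by (simp add: add.commute)
    finally show ?thesis by (simp add: s_def t_def)
  qed
qed

abbreviation I01 :: "real measure"
  where "I01 \<equiv> lebesgue_on {0..1}"

text \<open>The condition \<open>\<gamma> > -1\<close> is where the assumption \<open>\<alpha> > 1 / p\<close> enters, with \<open>\<gamma> = (\<alpha> - 1) * q\<close> for the
  conjugate exponent \<open>q\<close>.\<close>

lemma power_kernel_integral:
  fixes \<gamma> c v :: real
  assumes "\<gamma> > -1" "c \<ge> 0"
  shows "integrable I01 (\<lambda>x. indicator {v - c..v} x * (v - x) powr \<gamma>)"
    and "(\<integral>x. indicator {v - c..v} x * (v - x) powr \<gamma> \<partial>I01) \<le> c powr (\<gamma> + 1) / (\<gamma> + 1)"
proof -
  let ?K = "\<lambda>x. indicator {v - c..v} x * (v - x) powr \<gamma>"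
  have "((\<lambda>x. x powr \<gamma>) has_integral (c powr (\<gamma> + 1) / (\<gamma> + 1))) (cbox 0 c)"
    using has_integral_powr_from_0[OF assms] by simp
  from has_integral_affinity[OF this, of "-1" v]
  have hi: "((\<lambda>x. (v - x) powr \<gamma>) has_integral (c powr (\<gamma> + 1) / (\<gamma> + 1))) {v - c..v}"
    using assms(2) by (simp add: image_affinity_atLeastAtMost cbox_interval algebra_simps
      add.commute)
  then have ai: "(\<lambda>x. (v - x) powr \<gamma>) absolutely_integrable_on {v - c..v}"
    by (intro nonnegative_absolutely_integrable_1) (auto simp: integrable_on_def)
  then have iK: "integrable lebesgue ?K"
    unfolding set_integrable_def by simp
  have vK: "integral\<^sup>L lebesgue ?K = c powr (\<gamma> + 1) / (\<gamma> + 1)"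
    using set_lebesgue_integral_eq_integral(2)[OF ai] integral_unique[OF hi]
    unfolding set_lebesgue_integral_def by simp
  have i01: "integrable lebesgue (\<lambda>x. indicator {0..1} x * ?K x)"
    using integrable_mult_indicator[OF _ iK, of "{0..1}"] by simp
  then show "integrable I01 ?K" by (subst integrable_restrict_space) auto
  have "integral\<^sup>L I01 ?K = integral\<^sup>L lebesgue (\<lambda>x. indicator {0..1} x * ?K x)"
    by (subst integral_restrict_space) auto
  also have "\<dots> \<le> integral\<^sup>L lebesgue ?K"
    by (intro integral_mono i01 iK) (auto simp: indicator_def)
  finally show "integral\<^sup>L I01 ?K \<le> c powr (\<gamma> + 1) / (\<gamma> + 1)" by (simp add: vK)
qed

text \<open>The weight that measures how much \<open>f\<close> near \<open>x\<close> contributes at scale \<open>1 / D\<close> around the node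
  \<open>i / D\<close>.  Its quadratic decay makes it summable both over \<open>x\<close> and over \<open>i\<close>.\<close>

definition node_weight :: "real \<Rightarrow> int \<Rightarrow> real \<Rightarrow> real"
  where "node_weight D i x = 1 / (1 + (D * x - real_of_int i)\<^sup>2)"

lemma node_weight_pos: "0 < node_weight D i x"
  and node_weight_le_1: "node_weight D i x \<le> 1"
proof -
  have "1 + (D * x - real_of_int i)\<^sup>2 \<ge> 1" by simp
  then have pos: "1 + (D * x - real_of_int i)\<^sup>2 > 0" by linarith
  then show "0 < node_weight D i x" by (simp add: node_weight_def)
  show "node_weight D i x \<le> 1" using pos by (simp add: node_weight_def divide_le_eq)
qed

lemma continuous_node_weight: "continuous_on S (node_weight D i)"
proof -
  have "1 + (D * x - real_of_int i)\<^sup>2 \<noteq> 0" for x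
    by (smt (verit) zero_le_power2)
  then show ?thesis unfolding node_weight_def by (intro continuous_intros) auto
qed

lemma node_weight_measurable [measurable]: "node_weight D i \<in> borel_measurable I01"
  by (intro continuous_imp_measurable_on_sets_lebesgue continuous_node_weight) auto

lemma node_weight_integral:
  assumes "D > 0"
  shows "integrable I01 (node_weight D i)"
    and "(\<integral>x. node_weight D i x \<partial>I01) \<le> pi / D"
proof -
  show int: "integrable I01 (node_weight D i)"
    by (intro continuous_imp_integrable_real continuous_node_weight)
  have "((\<lambda>x. node_weight D i x) has_integral (arctan (D * 1 - real_of_int i) / D - arctan (D * 0 - real_of_int i) / D)) {0..1}"
  proof (rule fundamental_theorem_of_calculus)
    fix x :: real assume "x \<in> {0..1}"
    have "((\<lambda>x. arctan (D * x - real_of_int i) / D) has_real_derivative node_weight D i x) (at x within {0..1})"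
      unfolding node_weight_def using assms
      by (auto intro!: derivative_eq_intros simp: field_simps add_nonneg_eq_0_iff)
    then show "((\<lambda>x. arctan (D * x - real_of_int i) / D) has_vector_derivative node_weight D i x) (at x within {0..1})"
      by (simp add: has_real_derivative_iff_has_vector_derivative)
  qed simp
  then have "(\<integral>x. node_weight D i x \<partial>I01) = (arctan (D - real_of_int i) - arctan (- real_of_int i)) / D"
    by (subst lebesgue_integral_eq_integral[OF int]) (auto simp: integral_unique diff_divide_distrib)
  also have "\<dots> \<le> pi / D"
    using arctan_ubound[of "D - real_of_int i"] arctan_lbound[of "- real_of_int i"] assms
    by (intro divide_right_mono) auto
  finally show "(\<integral>x. node_weight D i x \<partial>I01) \<le> pi / D" .
qed

lemma sum_node_weight_le:
  assumes "finite J"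
  shows "(\<Sum>i\<in>J. node_weight D i x) \<le> 15"
proof -
  define n where "n = \<lfloor>D * x\<rfloor>"
  define c where "c = (\<lambda>d::int. 1 / (1 + (real_of_int d)\<^sup>2))"
  have c0: "c d \<ge> 0" for d by (simp add: c_def)
  have "node_weight D i x \<le> 3 * c (i - n)" for i
  proof -
    define r where "r = D * x - real_of_int n"
    have r: "0 \<le> r" "r < 1" by (auto simp: r_def n_def) linarith+
    define d where "d = real_of_int (i - n)"
    have e: "D * x - real_of_int i = r - d" by (simp add: r_def d_def)
    have "r\<^sup>2 \<le> 1" using r by (simp add: power_le_one)
    moreover have "d\<^sup>2 \<le> 2 * (r - d)\<^sup>2 + 2 * r\<^sup>2"
      using zero_le_power2[of "2 * r - d"] by (simp add: power2_eq_square algebra_simps)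
    ultimately have "1 + d\<^sup>2 \<le> 3 * (1 + (r - d)\<^sup>2)" using zero_le_power2[of "r - d"] by argo
    moreover have "1 + d\<^sup>2 > 0" "1 + (r - d)\<^sup>2 > 0" by (simp_all add: add_pos_nonneg)
    ultimately show ?thesis
      unfolding node_weight_def c_def e d_def [symmetric] by (simp add: field_simps)
  qed
  then have "(\<Sum>i\<in>J. node_weight D i x) \<le> (\<Sum>i\<in>J. 3 * c (i - n))" by (intro sum_mono)
  also have "\<dots> = 3 * (\<Sum>d\<in>(\<lambda>i. i - n) ` J. c d)"
    by (subst sum.reindex) (auto simp: inj_on_def sum_distrib_left)
  also have "(\<Sum>d\<in>(\<lambda>i. i - n) ` J. c d) \<le> 5"
  proof -
    let ?J = "(\<lambda>i. i - n) ` J"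
    have sq: "(\<Sum>d\<in>{- int K..int K}. c d) \<le> 5 - 4 / (real K + 1)" for K
    proof (induction K)
      case 0
      then show ?case by (simp add: c_def)
    next
      case (Suc K)
      have split: "{- int (Suc K)..int (Suc K)} = insert (- int (Suc K)) (insert (int (Suc K)) {- int K..int K})"
        by auto
      have "(\<Sum>d\<in>{- int (Suc K)..int (Suc K)}. c d) = 2 * (1 / (1 + (real K + 1)\<^sup>2)) + (\<Sum>d\<in>{- int K..int K}. c d)"
        unfolding split by (simp add: c_def power2_eq_square algebra_simps)
      also have "\<dots> \<le> 2 * (2 / ((real K + 1) * (real K + 2))) + (5 - 4 / (real K + 1))"
      proof (intro add_mono mult_left_mono Suc.IH)
        have "(real K + 1) * (real K + 2) \<le> 2 * (1 + (real K + 1)\<^sup>2)"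
          by (simp add: power2_eq_square algebra_simps)
        moreover have "1 + (real K + 1)\<^sup>2 > 0" by (simp add: add_pos_nonneg)
        ultimately show "1 / (1 + (real K + 1)\<^sup>2) \<le> 2 / ((real K + 1) * (real K + 2))"
          by (simp add: divide_le_eq le_divide_eq mult.commute)
      qed simp
      also have "\<dots> = 5 - 4 / (real (Suc K) + 1)"
        by (simp add: divide_simps) (simp add: algebra_simps)
      finally show ?case .
    qed
    define K where "K = nat (\<Sum>d\<in>?J. \<bar>d\<bar>)"
    have "?J \<subseteq> {- int K..int K}"
    proof
      fix d assume d: "d \<in> ?J"
      have "\<bar>d\<bar> \<le> (\<Sum>d\<in>?J. \<bar>d\<bar>)" using d assms by (intro member_le_sum) auto
      then show "d \<in> {- int K..int K}" unfolding K_def by auto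
    qed
    then have "(\<Sum>d\<in>?J. c d) \<le> (\<Sum>d\<in>{- int K..int K}. c d)"
      using c0 by (intro sum_mono2) auto
    also have "\<dots> \<le> 5 - 4 / (real K + 1)" by (rule sq)
    also have "\<dots> \<le> 5" by simp
    finally show ?thesis .
  qed
  finally show ?thesis by simp
qed

section \<open>Local polynomial approximation of Riemann-Liouville integrals\<close>

lemma powr_le_endpoints:
  fixes a b x e :: real
  assumes "0 < a" "a \<le> x" "x \<le> b"
  shows "x powr e \<le> a powr e + b powr e"
proof (cases "e \<ge> 0")
  case True
  then have "x powr e \<le> b powr e" using assms by (intro powr_mono2) auto
  then show ?thesis by (simp add: add_increasing)
next
  case False
  then have "x powr e \<le> a powr e" using assms by (intro powr_mono2') auto
  then show ?thesis by (simp add: add_increasing2)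
qed

lemma one_plus_powr_taylor:
  fixes \<beta> :: real
  assumes k: "k > 0"
  obtains b :: "nat \<Rightarrow> real" and C where "C \<ge> 0"
    and "\<And>z. -1/2 \<le> z \<Longrightarrow> z \<le> 1 \<Longrightarrow> \<bar>(1 + z) powr \<beta> - (\<Sum>m<k. b m * z ^ m)\<bar> \<le> C * \<bar>z\<bar> ^ k"
proof -
  define d where "d = (\<lambda>m z. (\<Prod>j<m. (\<beta> - real j)) * (1 + z) powr (\<beta> - real m))"
  define C where "C = \<bar>\<Prod>j<k. (\<beta> - real j)\<bar> * ((1/2) powr (\<beta> - real k) + 2 powr (\<beta> - real k)) / fact k"
  have C0: "C \<ge> 0" by (simp add: C_def)
  have der: "\<forall>m t. m < k \<and> - 1/2 \<le> t \<and> t \<le> 1 \<longrightarrow> DERIV (d m) t :> d (Suc m) t"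
  proof (intro allI impI)
    fix m and t :: real assume "m < k \<and> - 1/2 \<le> t \<and> t \<le> 1"
    then have pos: "1 + t > 0" by simp
    have "((\<lambda>z. (1 + z) powr (\<beta> - real m)) has_real_derivative (\<beta> - real m) * (1 + t) powr (\<beta> - real m - 1) * (0 + 1)) (at t)"
      by (rule DERIV_chain2[where g = "\<lambda>z. 1 + z" and x = t and f = "\<lambda>z. z powr (\<beta> - real m)",
          OF has_real_derivative_powr[OF pos]]) (intro derivative_intros)
    from DERIV_cmult[OF this, of "\<Prod>j<m. (\<beta> - real j)"]
    show "DERIV (d m) t :> d (Suc m) t"
      unfolding d_def by (simp add: algebra_simps)
  qed
  have bound: "\<bar>(1 + z) powr \<beta> - (\<Sum>m<k. d m 0 / fact m * z ^ m)\<bar> \<le> C * \<bar>z\<bar> ^ k"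
    if z: "-1/2 \<le> z" "z \<le> 1" for z
  proof (cases "z = 0")
    case True
    have "(\<Sum>m<k. d m 0 / fact m * 0 ^ m) = (\<Sum>m<k. if m = 0 then 1 else 0)"
      by (intro sum.cong) (auto simp: d_def)
    also have "\<dots> = (1::real)" using k by simp
    finally show ?thesis using True k C0 by simp
  next
    case False
    have "\<exists>t. (if z < 0 then z < t \<and> t < 0 else 0 < t \<and> t < z) \<and>
      d 0 z = (\<Sum>m<k. (d m 0 / fact m) * (z - 0) ^ m) + (d k t / fact k) * (z - 0) ^ k"
      using Taylor[OF k refl der, of 0 z] z False by auto
    then obtain t where t: "if z < 0 then z < t \<and> t < 0 else 0 < t \<and> t < z"
      "d 0 z = (\<Sum>m<k. (d m 0 / fact m) * z ^ m) + (d k t / fact k) * z ^ k" by auto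
    have "1/2 \<le> 1 + t" "1 + t \<le> 2" using t(1) z by (auto split: if_splits)
    then have "(1 + t) powr (\<beta> - real k) \<le> (1/2) powr (\<beta> - real k) + 2 powr (\<beta> - real k)"
      by (intro powr_le_endpoints) auto
    then have "\<bar>d k t\<bar> / fact k \<le> C"
      unfolding d_def C_def abs_mult by (intro divide_right_mono mult_left_mono) auto
    then have "\<bar>d k t\<bar> / fact k * \<bar>z\<bar> ^ k \<le> C * \<bar>z\<bar> ^ k" by (intro mult_right_mono) auto
    moreover have "(1 + z) powr \<beta> - (\<Sum>m<k. d m 0 / fact m * z ^ m) = (d k t / fact k) * z ^ k"
      using t(2) by (simp add: d_def)
    ultimately show ?thesis by (simp add: abs_mult power_abs)
  qed
  show ?thesis by (rule that[OF C0 bound])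
qed

text \<open>The Riemann-Liouville integral without its constant factor.  As a function on the whole line it
  can be sampled at grid nodes outside \<open>A\<close>.\<close>

definition rl_kernel :: "real \<Rightarrow> real \<Rightarrow> real \<Rightarrow> real"
  where "rl_kernel \<beta> v x = (if x < v then (v - x) powr \<beta> else 0)"

definition rl_integral :: "real \<Rightarrow> (real \<Rightarrow> real) \<Rightarrow> real \<Rightarrow> real"
  where "rl_integral \<beta> f v = (\<integral>x. rl_kernel \<beta> v x * f x \<partial>I01)"

lemma riemann_liouville_eq:
  assumes "t \<in> {0..1}"
  shows "riemann_liouville \<alpha> f t = 1 / Gamma \<alpha> * rl_integral (\<alpha> - 1) f t"
proof -
  have "(\<integral>x. (t - x) powr (\<alpha> - 1) * f x \<partial>lebesgue_on {0..t})
      = (\<integral>x. indicator {0..t} x * ((t - x) powr (\<alpha> - 1) * f x) \<partial>lebesgue)"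
    by (subst integral_restrict_space) auto
  also have "\<dots> = (\<integral>x. indicator {0..1} x * (rl_kernel (\<alpha> - 1) t x * f x) \<partial>lebesgue)"
    using assms by (intro Bochner_Integration.integral_cong) (auto simp: indicator_def rl_kernel_def)
  also have "\<dots> = rl_integral (\<alpha> - 1) f t"
    unfolding rl_integral_def by (subst integral_restrict_space) auto
  finally show ?thesis by (simp add: riemann_liouville_def)
qed

lemma rl_kernel_eq_indicator:
  assumes "0 \<le> x" "v \<le> c"
  shows "rl_kernel \<beta> v x = indicator {v - c..v} x * (v - x) powr \<beta>"
  using assms by (auto simp: rl_kernel_def indicator_def)

lemma rl_kernel_measurable [measurable]: "rl_kernel \<beta> v \<in> borel_measurable I01"
proof -
  have "rl_kernel \<beta> v \<in> borel_measurable borel" unfolding rl_kernel_def by measurable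
  then have "rl_kernel \<beta> v \<in> borel_measurable lebesgue" by (intro measurable_completion) simp
  then show ?thesis by (rule measurable_restrict_space1)
qed

lemma indicator_kernel_holder:
  fixes \<beta> p q c v :: real and b :: "real \<Rightarrow> real"
  assumes pq: "p > 1" "q > 1" "1 / p + 1 / q = 1" and beta: "\<beta> * q > -1" and c: "c > 0"
    and b: "b \<in> borel_measurable I01" "\<And>x. 0 \<le> b x" "integrable I01 (\<lambda>x. b x powr p)"
  shows "integrable I01 (\<lambda>x. indicator {v - c..v} x * (v - x) powr \<beta> * b x)"
    and "(\<integral>x. indicator {v - c..v} x * (v - x) powr \<beta> * b x \<partial>I01)
      \<le> (c powr (\<beta> * q + 1) / (\<beta> * q + 1)) powr (1 / q) * (\<integral>x. b x powr p \<partial>I01) powr (1 / p)"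
proof -
  let ?a = "\<lambda>x. indicator {v - c..v} x * (v - x) powr \<beta>"
  have aq: "?a x powr q = indicator {v - c..v} x * (v - x) powr (\<beta> * q)" for x
    by (auto simp: indicator_def powr_powr)
  have meas: "?a \<in> borel_measurable I01"
  proof -
    have "?a \<in> borel_measurable borel" by measurable
    then have "?a \<in> borel_measurable lebesgue" by (intro measurable_completion) simp
    then show ?thesis by (rule measurable_restrict_space1)
  qed
  have pos: "c powr (\<beta> * q + 1) / (\<beta> * q + 1) > 0" using c beta by simp
  note K = power_kernel_integral[OF beta less_imp_le[OF c], of v]
  show "integrable I01 (\<lambda>x. ?a x * b x)"
    by (rule holder_integral(1)[OF pq meas b(1) _ b(2) _ b(3) _ pos]) (use K in \<open>auto simp: aq\<close>)
  show "(\<integral>x. ?a x * b x \<partial>I01)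
      \<le> (c powr (\<beta> * q + 1) / (\<beta> * q + 1)) powr (1 / q) * (\<integral>x. b x powr p \<partial>I01) powr (1 / p)"
    by (rule holder_integral(2)[OF pq meas b(1) _ b(2) _ b(3) _ pos]) (use K in \<open>auto simp: aq\<close>)
qed

lemma rl_integral_bounded:
  fixes \<beta> p q v :: real
  assumes pq: "p > 1" "q > 1" "1 / p + 1 / q = 1" and beta: "\<beta> * q > -1" and c: "c > 0" "v \<le> c"
    and f: "f \<in> borel_measurable I01" "integrable I01 (\<lambda>x. \<bar>f x\<bar> powr p)"
  shows "integrable I01 (\<lambda>x. rl_kernel \<beta> v x * f x)"
    and "\<bar>rl_integral \<beta> f v\<bar> \<le> (c powr (\<beta> * q + 1) / (\<beta> * q + 1)) powr (1 / q) * (\<integral>x. \<bar>f x\<bar> powr p \<partial>I01) powr (1 / p)"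
proof -
  have meas: "(\<lambda>x. \<bar>f x\<bar>) \<in> borel_measurable I01" using f(1) by measurable
  note K = indicator_kernel_holder[OF pq beta c(1) meas _ f(2), of v, simplified]
  have eq: "\<bar>rl_kernel \<beta> v x * f x\<bar> = indicator {v - c..v} x * (v - x) powr \<beta> * \<bar>f x\<bar>" if "x \<in> space I01" for x
    using rl_kernel_eq_indicator[of x v c \<beta>] that c(2) by (simp add: abs_mult)
  have "integrable I01 (\<lambda>x. \<bar>rl_kernel \<beta> v x * f x\<bar>)"
    using K(1) by (subst Bochner_Integration.integrable_cong[OF refl eq]) auto
  moreover have "(\<lambda>x. rl_kernel \<beta> v x * f x) \<in> borel_measurable I01" using f(1) by measurable
  ultimately show int: "integrable I01 (\<lambda>x. rl_kernel \<beta> v x * f x)"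
    by (simp add: integrable_abs_iff)
  have "\<bar>rl_integral \<beta> f v\<bar> \<le> (\<integral>x. \<bar>rl_kernel \<beta> v x * f x\<bar> \<partial>I01)"
    unfolding rl_integral_def by (rule integral_abs_bound)
  also have "\<dots> = (\<integral>x. indicator {v - c..v} x * (v - x) powr \<beta> * \<bar>f x\<bar> \<partial>I01)"
    by (intro Bochner_Integration.integral_cong refl eq)
  finally show "\<bar>rl_integral \<beta> f v\<bar> \<le> (c powr (\<beta> * q + 1) / (\<beta> * q + 1)) powr (1 / q) * (\<integral>x. \<bar>f x\<bar> powr p \<partial>I01) powr (1 / p)"
    using K(2) by linarith
qed

text \<open>The weights of all nodes add up to at most \<open>15\<close> at every point, so the local norms of \<open>f\<close> at one
  scale are \<open>p\<close>-summable.  This is the source of the factor \<open>n powr (- 1 / p)\<close> in the final rates.\<close>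

lemma node_weight_Lp:
  fixes p :: real
  assumes f: "f \<in> borel_measurable I01" "integrable I01 (\<lambda>x. \<bar>f x\<bar> powr p)"
  shows "integrable I01 (\<lambda>x. node_weight D i x * \<bar>f x\<bar> powr p)"
    and "finite J \<Longrightarrow> (\<Sum>i\<in>J. \<integral>x. node_weight D i x * \<bar>f x\<bar> powr p \<partial>I01) \<le> 15 * (\<integral>x. \<bar>f x\<bar> powr p \<partial>I01)"
proof -
  show int: "integrable I01 (\<lambda>x. node_weight D i x * \<bar>f x\<bar> powr p)" for i
  proof (rule Bochner_Integration.integrable_bound[OF f(2)])
    show "(\<lambda>x. node_weight D i x * \<bar>f x\<bar> powr p) \<in> borel_measurable I01" using f(1) by measurable
    show "AE x in I01. norm (node_weight D i x * \<bar>f x\<bar> powr p) \<le> norm (\<bar>f x\<bar> powr p)"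
      using node_weight_pos[of D i] node_weight_le_1[of D i]
      by (intro AE_I2) (auto simp: abs_mult less_imp_le intro!: mult_left_le_one_le)
  qed
  show "(\<Sum>i\<in>J. \<integral>x. node_weight D i x * \<bar>f x\<bar> powr p \<partial>I01) \<le> 15 * (\<integral>x. \<bar>f x\<bar> powr p \<partial>I01)" if "finite J"
  proof -
    have "(\<Sum>i\<in>J. \<integral>x. node_weight D i x * \<bar>f x\<bar> powr p \<partial>I01) = (\<integral>x. (\<Sum>i\<in>J. node_weight D i x) * \<bar>f x\<bar> powr p \<partial>I01)"
      using int by (simp add: sum_distrib_right)
    also have "\<dots> \<le> (\<integral>x. 15 * \<bar>f x\<bar> powr p \<partial>I01)"
    proof (rule integral_mono)
      show "integrable I01 (\<lambda>x. (\<Sum>i\<in>J. node_weight D i x) * \<bar>f x\<bar> powr p)"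
        using int by (simp add: sum_distrib_right)
      show "integrable I01 (\<lambda>x. 15 * \<bar>f x\<bar> powr p)" using f(2) by simp
      show "(\<Sum>i\<in>J. node_weight D i x) * \<bar>f x\<bar> powr p \<le> 15 * \<bar>f x\<bar> powr p" for x
        by (intro mult_right_mono sum_node_weight_le[OF that]) simp
    qed
    finally show ?thesis by simp
  qed
qed

text \<open>Seen from the interval of length \<open>3 / D\<close> around the node \<open>i / D\<close>, the part of \<open>f\<close> to the left of
  \<open>(i - 2) / D\<close> contributes a smooth function, which is replaced by its Taylor polynomial; the
  remaining part is bounded by the Hoelder inequality.  If the degree is large enough, the Taylor
  remainder decays fast enough for both errors to be controlled by the same weighted norm of \<open>f\<close>.\<close>

lemma rl_integral_local_polynomial:
  fixes \<beta> p q :: real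
  assumes pq: "p > 1" "q > 1" "1 / p + 1 / q = 1" and beta: "\<beta> * q > -1"
    and k: "real k \<ge> \<beta> + 2" "k > 0"
  obtains C where "C > 0"
    and "\<And>D i f. D > 0 \<Longrightarrow> f \<in> borel_measurable I01 \<Longrightarrow> integrable I01 (\<lambda>x. \<bar>f x\<bar> powr p) \<Longrightarrow>
      \<exists>P :: real poly. degree P < k \<and> (\<forall>y\<in>{-1..2}. \<bar>rl_integral \<beta> f ((real_of_int i + y) / D) - poly P y\<bar>
        \<le> C * D powr (- (\<beta> + 1 / q)) * (\<integral>x. node_weight D i x * \<bar>f x\<bar> powr p \<partial>I01) powr (1 / p))"
proof -
  obtain b C0 where C0: "C0 \<ge> 0" and taylor: "\<And>z. -1/2 \<le> z \<Longrightarrow> z \<le> 1 \<Longrightarrow>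
      \<bar>(1 + z) powr \<beta> - (\<Sum>m<k. b m * z ^ m)\<bar> \<le> C0 * \<bar>z\<bar> ^ k"
    using one_plus_powr_taylor[OF k(2)] by blast
  define C1 where "C1 = (4 powr (\<beta> * q + 1) / (\<beta> * q + 1)) powr (1 / q) * 5 powr (1 / p)"
  define C2 where "C2 = C0 * 2 ^ (k + 1) * pi powr (1 / q)"
  have C1: "C1 > 0" using beta by (simp add: C1_def)
  have C2: "C2 \<ge> 0" using C0 by (simp add: C2_def)
  show ?thesis
  proof (rule that[of "C1 + C2"])
    show "C1 + C2 > 0" using C1 C2 by simp
    fix D :: real and i :: int and f :: "real \<Rightarrow> real"
    assume D: "D > 0" and f: "f \<in> borel_measurable I01" "integrable I01 (\<lambda>x. \<bar>f x\<bar> powr p)"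
    define w where "w = node_weight D i"
    define \<rho> where "\<rho> = (\<lambda>x. real_of_int i - D * x)"
    define W where "W = (\<integral>x. w x * \<bar>f x\<bar> powr p \<partial>I01)"
    define S where "S = D powr (- (\<beta> + 1 / q))"
    have w: "0 \<le> w x" "w \<in> borel_measurable I01" "w x = 1 / (1 + (\<rho> x)\<^sup>2)" for x
      using node_weight_pos[of D i x] by (auto simp: w_def node_weight_def \<rho>_def power2_commute)
    have iW: "integrable I01 (\<lambda>x. w x * \<bar>f x\<bar> powr p)"
      unfolding w_def by (rule node_weight_Lp(1)[OF f])
    have W0: "W \<ge> 0" unfolding W_def using w by (intro Bochner_Integration.integral_nonneg) auto
    have abs_f: "(\<lambda>x. \<bar>f x\<bar>) \<in> borel_measurable I01" using f(1) by measurable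

    have div_D: "(c / D) powr e = c powr e * D powr (- e)" if "c \<ge> 0" for c e
      using D that by (simp add: powr_divide powr_minus_divide)

    define b1 where "b1 = (\<lambda>x. (5 * w x) powr (1 / p) * \<bar>f x\<bar>)"
    have b1p: "b1 x powr p = 5 * (w x * \<bar>f x\<bar> powr p)" for x
      using pq(1) w(1)[of x] by (simp add: b1_def powr_mult powr_powr)
    have b1: "b1 \<in> borel_measurable I01" "0 \<le> b1 x" "integrable I01 (\<lambda>x. b1 x powr p)" for x
    proof -
      show "b1 \<in> borel_measurable I01" unfolding b1_def using abs_f w(2) by measurable
      show "0 \<le> b1 x" by (simp add: b1_def)
      show "integrable I01 (\<lambda>x. b1 x powr p)" unfolding b1p using iW by simp
    qed
    have near_int: "integrable I01 (\<lambda>x. indicator {v - 4 / D..v} x * (v - x) powr \<beta> * b1 x)" for v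
      using indicator_kernel_holder(1)[OF pq beta _ b1(1) b1(2) b1(3), of "4 / D" v] D by simp
    have near: "(\<integral>x. indicator {v - 4 / D..v} x * (v - x) powr \<beta> * b1 x \<partial>I01) \<le> C1 * S * W powr (1 / p)" for v
    proof -
      have "(\<integral>x. indicator {v - 4 / D..v} x * (v - x) powr \<beta> * b1 x \<partial>I01)
        \<le> ((4 / D) powr (\<beta> * q + 1) / (\<beta> * q + 1)) powr (1 / q) * (\<integral>x. b1 x powr p \<partial>I01) powr (1 / p)"
        using indicator_kernel_holder(2)[OF pq beta _ b1(1) b1(2) b1(3), of "4 / D" v] D by simp
      also have "(\<integral>x. b1 x powr p \<partial>I01) = 5 * W" by (simp add: b1p W_def)
      also have "((4 / D) powr (\<beta> * q + 1) / (\<beta> * q + 1)) powr (1 / q)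
          = (4 powr (\<beta> * q + 1) / (\<beta> * q + 1)) powr (1 / q) * S"
      proof -
        define e where "e = \<beta> * q + 1"
        have e: "e > 0" "- e * (1 / q) = - (\<beta> + 1 / q)" using beta pq by (auto simp: e_def field_simps)
        have "((4 / D) powr e / e) powr (1 / q) = ((4 powr e / e) * D powr (- e)) powr (1 / q)"
          by (subst div_D) simp_all
        also have "\<dots> = (4 powr e / e) powr (1 / q) * D powr (- e * (1 / q))"
          using e(1) by (subst powr_mult) (simp_all add: powr_powr)
        also have "D powr (- e * (1 / q)) = S" by (simp only: e(2) S_def)
        finally show ?thesis by (simp only: e_def)
      qed
      also have "(5 * W) powr (1 / p) = 5 powr (1 / p) * W powr (1 / p)" using W0 by (simp add: powr_mult)
      finally show ?thesis by (simp add: C1_def mult_ac)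
    qed

    define b2 where "b2 = (\<lambda>x. w x powr (1 / p) * \<bar>f x\<bar>)"
    have b2p: "b2 x powr p = w x * \<bar>f x\<bar> powr p" for x
      using pq(1) w(1)[of x] by (simp add: b2_def powr_mult powr_powr)
    have wq: "(w x powr (1 / q)) powr q = w x" for x
      using pq w(1)[of x] by (simp add: powr_powr)
    have wb2: "w x powr (1 / q) * b2 x = w x * \<bar>f x\<bar>" for x
      using pq(3) node_weight_pos[of D i x]
      by (simp add: b2_def w_def mult.assoc [symmetric] powr_add [symmetric] add.commute)
    have b2: "b2 \<in> borel_measurable I01" "0 \<le> b2 x" "integrable I01 (\<lambda>x. b2 x powr p)" for x
    proof -
      show "b2 \<in> borel_measurable I01" unfolding b2_def using abs_f w(2) by measurable
      show "0 \<le> b2 x" by (simp add: b2_def)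
      show "integrable I01 (\<lambda>x. b2 x powr p)" unfolding b2p using iW by simp
    qed
    have wqm: "(\<lambda>x. w x powr (1 / q)) \<in> borel_measurable I01" using w(2) by measurable
    note holder2 = holder_integral[OF pq wqm b2(1) _ b2(2) _ b2(3), of "pi / D", unfolded wq wb2 b2p]
    have pD: "0 < pi / D" using D by simp
    have far_int: "integrable I01 (\<lambda>x. w x * \<bar>f x\<bar>)"
      using holder2(1) node_weight_integral[OF D, of i] pD by (simp add: w_def)
    have far: "D powr (- \<beta>) * (\<integral>x. w x * \<bar>f x\<bar> \<partial>I01) \<le> pi powr (1 / q) * S * W powr (1 / p)"
    proof -
      have "(\<integral>x. w x * \<bar>f x\<bar> \<partial>I01) \<le> (pi / D) powr (1 / q) * W powr (1 / p)"
        using holder2(2) node_weight_integral[OF D, of i] pD by (simp add: w_def W_def)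
      then have "D powr (- \<beta>) * (\<integral>x. w x * \<bar>f x\<bar> \<partial>I01) \<le> D powr (- \<beta>) * ((pi / D) powr (1 / q) * W powr (1 / p))"
        by (intro mult_left_mono) auto
      also have "\<dots> = pi powr (1 / q) * (D powr (- \<beta>) * D powr (- (1 / q))) * W powr (1 / p)"
        by (subst div_D) (simp_all add: mult_ac)
      also have "D powr (- \<beta>) * D powr (- (1 / q)) = S"
        by (simp add: S_def powr_add [symmetric])
      finally show ?thesis .
    qed

    define E where "E = (\<lambda>m x. if \<rho> x \<ge> 2 then D powr (- \<beta>) * (b m * \<rho> x powr (\<beta> - real m)) * f x else 0)"
    have abs_f_int: "integrable I01 (\<lambda>x. \<bar>f x\<bar>)"
    proof (rule Bochner_Integration.integrable_bound)
      have "integrable I01 (\<lambda>x::real. 1::real)"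
        by (intro continuous_imp_integrable_real continuous_intros)
      then show "integrable I01 (\<lambda>x. 1 + \<bar>f x\<bar> powr p)" using f(2) by simp
      show "AE x in I01. norm \<bar>f x\<bar> \<le> norm (1 + \<bar>f x\<bar> powr p)"
      proof (intro AE_I2)
        fix x
        have "\<bar>f x\<bar> \<le> 1 + \<bar>f x\<bar> powr p"
        proof (cases "\<bar>f x\<bar> \<le> 1")
          case False
          then have "\<bar>f x\<bar> powr 1 \<le> \<bar>f x\<bar> powr p" using pq by (intro powr_mono) auto
          then show ?thesis using False by simp
        qed (simp add: add_increasing2)
        then show "norm \<bar>f x\<bar> \<le> norm (1 + \<bar>f x\<bar> powr p)" by simp
      qed
    qed (rule abs_f)
    have E_int: "integrable I01 (E m)" for m
    proof (rule Bochner_Integration.integrable_bound)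
      let ?B = "D powr (- \<beta>) * (\<bar>b m\<bar> * (2 powr (\<beta> - real m) + (\<bar>real_of_int i\<bar> + 2) powr (\<beta> - real m)))"
      show "integrable I01 (\<lambda>x. ?B * \<bar>f x\<bar>)" using abs_f_int by simp
      have "\<rho> \<in> borel_measurable borel" unfolding \<rho>_def by measurable
      then have [measurable]: "\<rho> \<in> borel_measurable I01"
        by (intro measurable_restrict_space1 measurable_completion) simp
      show "E m \<in> borel_measurable I01" unfolding E_def using f(1) by measurable
      show "AE x in I01. norm (E m x) \<le> norm (?B * \<bar>f x\<bar>)"
      proof (intro AE_I2)
        fix x assume "x \<in> space I01"
        then have x: "0 \<le> x" by simp
        show "norm (E m x) \<le> norm (?B * \<bar>f x\<bar>)"
        proof (cases "\<rho> x \<ge> 2")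
          case True
          have "D * x \<ge> 0" using D x by simp
          then have "\<rho> x \<le> \<bar>real_of_int i\<bar> + 2" by (simp add: \<rho>_def)
          then have "\<rho> x powr (\<beta> - real m) \<le> 2 powr (\<beta> - real m) + (\<bar>real_of_int i\<bar> + 2) powr (\<beta> - real m)"
            using True by (intro powr_le_endpoints) auto
          then have "D powr (- \<beta>) * (\<bar>b m\<bar> * \<rho> x powr (\<beta> - real m)) * \<bar>f x\<bar> \<le> ?B * \<bar>f x\<bar>"
            by (intro mult_right_mono mult_left_mono) auto
          then show ?thesis using True by (simp add: E_def abs_mult)
        qed (simp add: E_def)
      qed
    qed
    define P where "P = (\<Sum>m<k. monom (\<integral>x. E m x \<partial>I01) m)"
    have degP: "degree P < k"
    proof -
      have "degree P \<le> k - 1" unfolding P_def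
        by (intro degree_sum_le) (auto intro: order_trans[OF degree_monom_le])
      then show ?thesis using k(2) by linarith
    qed
    have point: "\<bar>rl_kernel \<beta> ((real_of_int i + y) / D) x * f x - (\<Sum>m<k. y ^ m * E m x)\<bar>
       \<le> indicator {(real_of_int i + y) / D - 4 / D..(real_of_int i + y) / D} x
            * ((real_of_int i + y) / D - x) powr \<beta> * b1 x
         + C0 * 2 ^ (k + 1) * (D powr (- \<beta>) * (w x * \<bar>f x\<bar>))"
      (is "?lhs \<le> ?near + ?far") if y: "y \<in> {-1..2}" for x y
    proof -
      let ?v = "(real_of_int i + y) / D"
      have vx: "?v - x = (\<rho> x + y) / D" using D by (simp add: \<rho>_def field_simps)
      have far0: "0 \<le> ?far" using C0 w(1)[of x] by simp
      have near0: "0 \<le> ?near" using b1(2)[of x] by simp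
      show ?thesis
      proof (cases "\<rho> x \<ge> 2")
        case True
        define z where "z = y / \<rho> x"
        have z: "-1/2 \<le> z" "z \<le> 1" "\<bar>z\<bar> \<le> 2 / \<rho> x"
          using True y by (auto simp: z_def field_simps abs_le_iff)
        have pos: "\<rho> x + y > 0" "1 + z > 0" using True y z by auto
        have ker: "rl_kernel \<beta> ?v x = D powr (- \<beta>) * (\<rho> x powr \<beta> * (1 + z) powr \<beta>)"
        proof -
          have "x < ?v" using vx pos(1) D by (smt (verit) divide_pos_pos)
          then have "rl_kernel \<beta> ?v x = ((\<rho> x + y) / D) powr \<beta>" by (simp add: rl_kernel_def vx)
          also have "\<rho> x + y = \<rho> x * (1 + z)" using True by (simp add: z_def field_simps)
          also have "(\<rho> x * (1 + z) / D) powr \<beta> = (\<rho> x * (1 + z)) powr \<beta> * D powr (- \<beta>)"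
            using True pos(2) by (intro div_D) auto
          finally show ?thesis using True pos(2)
            by (simp add: powr_mult mult_ac)
        qed
        have Em: "y ^ m * E m x = D powr (- \<beta>) * (\<rho> x powr \<beta> * (b m * z ^ m)) * f x" for m
        proof -
          have "\<rho> x powr (\<beta> - real m) = \<rho> x powr \<beta> / \<rho> x ^ m"
            using True by (simp add: powr_diff powr_realpow)
          then show ?thesis using True by (simp add: E_def z_def power_divide)
        qed
        have "?lhs = \<bar>D powr (- \<beta>) * (\<rho> x powr \<beta> * ((1 + z) powr \<beta> - (\<Sum>m<k. b m * z ^ m))) * f x\<bar>"
          unfolding ker Em by (simp add: sum_distrib_left sum_distrib_right algebra_simps)
        also have "\<dots> = D powr (- \<beta>) * (\<rho> x powr \<beta> * \<bar>(1 + z) powr \<beta> - (\<Sum>m<k. b m * z ^ m)\<bar>) * \<bar>f x\<bar>"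
          by (simp add: abs_mult)
        also have "\<dots> \<le> D powr (- \<beta>) * (\<rho> x powr \<beta> * (C0 * (2 / \<rho> x) ^ k)) * \<bar>f x\<bar>"
        proof (intro mult_right_mono mult_left_mono)
          have "\<bar>(1 + z) powr \<beta> - (\<Sum>m<k. b m * z ^ m)\<bar> \<le> C0 * \<bar>z\<bar> ^ k" by (rule taylor[OF z(1,2)])
          also have "\<dots> \<le> C0 * (2 / \<rho> x) ^ k" using C0 z(3) by (intro mult_left_mono power_mono) auto
          finally show "\<bar>(1 + z) powr \<beta> - (\<Sum>m<k. b m * z ^ m)\<bar> \<le> C0 * (2 / \<rho> x) ^ k" .
        qed auto
        also have "\<dots> = D powr (- \<beta>) * (C0 * 2 ^ k * \<rho> x powr (\<beta> - real k)) * \<bar>f x\<bar>"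
          using True by (simp add: powr_diff powr_realpow power_divide)
        also have "\<dots> \<le> D powr (- \<beta>) * (C0 * 2 ^ k * (2 * w x)) * \<bar>f x\<bar>"
        proof -
          have "\<rho> x powr (\<beta> - real k) \<le> \<rho> x powr (- 2)" using True k(1) by (intro powr_mono) auto
          also have "\<dots> = 1 / (\<rho> x)\<^sup>2" using True by (simp add: powr_minus powr_numeral divide_inverse)
          also have "\<dots> \<le> 2 * w x"
          proof -
            have "2 * 2 \<le> \<rho> x * \<rho> x" using True by (intro mult_mono) auto
            then have "1 + (\<rho> x)\<^sup>2 \<le> 2 * (\<rho> x)\<^sup>2" by (simp add: power2_eq_square)
            then show ?thesis unfolding w(3) using True by (simp add: field_simps add_pos_nonneg)
          qed
          finally show ?thesis using C0 by (intro mult_right_mono mult_left_mono) auto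
        qed
        also have "\<dots> = ?far" by simp
        finally show ?thesis using near0 by linarith
      next
        case False
        then have E0: "(\<Sum>m<k. y ^ m * E m x) = 0" by (simp add: E_def)
        show ?thesis
        proof (cases "x < ?v")
          case True
          then have "\<rho> x + y > 0" using vx D by (smt (verit) divide_nonpos_pos)
          then have r: "- 2 \<le> \<rho> x" "\<rho> x \<le> 2" "\<rho> x + y \<le> 4" using False y by auto
          have "(\<rho> x + y) / D \<le> 4 / D" using r(3) D by (simp add: divide_right_mono)
          then have "x \<in> {?v - 4 / D..?v}" using True vx by auto
          moreover have "\<bar>f x\<bar> \<le> b1 x"
          proof -
            have "\<bar>\<rho> x\<bar> \<le> 2" using r by auto
            then have "(\<rho> x)\<^sup>2 \<le> 2\<^sup>2" by (metis abs_le_square_iff abs_numeral)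
            then have "1 \<le> 5 * w x" unfolding w(3) by (simp add: field_simps add_pos_nonneg)
            then have "1 powr (1 / p) \<le> (5 * w x) powr (1 / p)" using pq by (intro powr_mono2) auto
            then show ?thesis by (simp add: b1_def mult_left_le_one_le mult_le_cancel_right1)
          qed
          ultimately have "?lhs \<le> ?near"
            using True unfolding E0 by (auto simp: rl_kernel_def abs_mult intro!: mult_left_mono)
          then show ?thesis using far0 by linarith
        next
          case False
          then have "?lhs = 0" unfolding E0 by (simp add: rl_kernel_def)
          then show ?thesis using near0 far0 by linarith
        qed
      qed
    qed
    have "\<bar>rl_integral \<beta> f ((real_of_int i + y) / D) - poly P y\<bar> \<le> (C1 + C2) * S * W powr (1 / p)"
      if y: "y \<in> {-1..2}" for y
    proof -
      let ?v = "(real_of_int i + y) / D"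
      let ?near = "\<lambda>x. indicator {?v - 4 / D..?v} x * (?v - x) powr \<beta> * b1 x"
      let ?far = "\<lambda>x. C0 * 2 ^ (k + 1) * (D powr (- \<beta>) * (w x * \<bar>f x\<bar>))"
      let ?d = "\<lambda>x. rl_kernel \<beta> ?v x * f x - (\<Sum>m<k. y ^ m * E m x)"
      have ker_int: "integrable I01 (\<lambda>x. rl_kernel \<beta> ?v x * f x)"
        by (rule rl_integral_bounded(1)[OF pq beta _ _ f, of "max ?v 1"]) auto
      have "rl_integral \<beta> f ?v - poly P y = (\<integral>x. ?d x \<partial>I01)"
        using ker_int E_int
        by (simp add: rl_integral_def P_def poly_sum poly_monom mult.commute)
      then have "\<bar>rl_integral \<beta> f ?v - poly P y\<bar> \<le> (\<integral>x. \<bar>?d x\<bar> \<partial>I01)"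
        by (simp add: integral_abs_bound)
      also have "\<dots> \<le> (\<integral>x. ?near x + ?far x \<partial>I01)"
        using ker_int E_int near_int[of ?v] far_int
        by (intro integral_mono point[OF y]) (auto intro!: Bochner_Integration.integrable_abs)
      also have "\<dots> = (\<integral>x. ?near x \<partial>I01) + C0 * 2 ^ (k + 1) * (D powr (- \<beta>) * (\<integral>x. w x * \<bar>f x\<bar> \<partial>I01))"
        using near_int[of ?v] far_int by simp
      also have "\<dots> \<le> C1 * S * W powr (1 / p) + C0 * 2 ^ (k + 1) * (pi powr (1 / q) * S * W powr (1 / p))"
        using C0 by (intro add_mono near mult_left_mono far) auto
      finally show ?thesis by (simp add: C2_def algebra_simps)
    qed
    then show "\<exists>P :: real poly. degree P < k \<and> (\<forall>y\<in>{-1..2}. \<bar>rl_integral \<beta> f ((real_of_int i + y) / D) - poly P y\<bar>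
        \<le> (C1 + C2) * D powr (- (\<beta> + 1 / q)) * (\<integral>x. node_weight D i x * \<bar>f x\<bar> powr p \<partial>I01) powr (1 / p))"
      using degP unfolding S_def W_def w_def by blast
  qed
qed

section \<open>Multiscale interpolation\<close>

text \<open>Local polynomials are glued together with hat functions, because the approximants have to be
  continuous on \<open>A\<close>.\<close>

definition hat :: "real \<Rightarrow> real"
  where "hat y = max 0 (1 - \<bar>y\<bar>)"

lemma hat_nonneg: "0 \<le> hat y"
  and hat_eq_0: "1 \<le> \<bar>y\<bar> \<Longrightarrow> hat y = 0"
  and continuous_on_hat: "continuous_on S h \<Longrightarrow> continuous_on S (\<lambda>x. hat (h x))"
  unfolding hat_def by (auto intro!: continuous_intros)

lemma hat_sum:
  fixes X :: "int \<Rightarrow> real"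
  assumes "finite J" and J: "\<And>i. \<bar>y - real_of_int i\<bar> < 1 \<Longrightarrow> i \<in> J"
  shows "(\<Sum>i\<in>J. hat (y - real_of_int i) * X i)
    = (1 - frac y) * X \<lfloor>y\<rfloor> + frac y * X (\<lfloor>y\<rfloor> + 1)"
proof -
  have fr: "0 \<le> frac y" "frac y < 1" "y = real_of_int \<lfloor>y\<rfloor> + frac y"
    by (rule frac_ge_0, rule frac_lt_1, simp add: frac_def)
  let ?N = "{i. \<bar>y - real_of_int i\<bar> < 1}"
  have "i \<in> {\<lfloor>y\<rfloor>, \<lfloor>y\<rfloor> + 1}" if "i \<in> ?N" for i
  proof -
    have "\<bar>y - real_of_int i\<bar> < 1" using that by simp
    then have "real_of_int i < real_of_int \<lfloor>y\<rfloor> + 2" "real_of_int \<lfloor>y\<rfloor> - 1 < real_of_int i"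
      using fr by linarith+
    then show ?thesis by (simp, linarith)
  qed
  then have N: "?N \<subseteq> {\<lfloor>y\<rfloor>, \<lfloor>y\<rfloor> + 1}" by blast
  have "(\<Sum>i\<in>J. hat (y - real_of_int i) * X i) = (\<Sum>i\<in>?N. hat (y - real_of_int i) * X i)"
    using assms by (intro sum.mono_neutral_right) (auto simp: hat_eq_0)
  also have "\<dots> = (\<Sum>i\<in>{\<lfloor>y\<rfloor>, \<lfloor>y\<rfloor> + 1}. hat (y - real_of_int i) * X i)"
    using N by (intro sum.mono_neutral_left) (auto simp: hat_eq_0)
  also have "\<dots> = hat (y - real_of_int \<lfloor>y\<rfloor>) * X \<lfloor>y\<rfloor> + hat (y - real_of_int (\<lfloor>y\<rfloor> + 1)) * X (\<lfloor>y\<rfloor> + 1)"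
    by simp
  also have "y - real_of_int \<lfloor>y\<rfloor> = frac y" by (simp add: frac_def)
  also have "y - real_of_int (\<lfloor>y\<rfloor> + 1) = frac y - 1" by (simp add: frac_def)
  also have "hat (frac y) = 1 - frac y" using fr by (simp add: hat_def)
  also have "hat (frac y - 1) = frac y" using fr by (simp add: hat_def)
  finally show ?thesis .
qed

lemma hat_partition_of_unity:
  assumes "finite J" "\<And>i. \<bar>y - real_of_int i\<bar> < 1 \<Longrightarrow> i \<in> J"
  shows "(\<Sum>i\<in>J. hat (y - real_of_int i)) = 1"
  using hat_sum[OF assms, where X = "\<lambda>_. 1"] by simp

text \<open>Polynomials are represented by their values at the points \<open>m / k\<close> of the unit interval.  The
  coefficients of a function are then point evaluations, and local errors of approximation bound
  them directly.\<close>

definition lagrange_basis :: "nat \<Rightarrow> nat \<Rightarrow> real \<Rightarrow> real"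
  where "lagrange_basis k m y = (\<Prod>l\<in>{..<k} - {m}. (y - real l / real k) / (real m / real k - real l / real k))"

lemma continuous_on_lagrange_basis:
  "continuous_on S h \<Longrightarrow> continuous_on S (\<lambda>x. lagrange_basis k m (h x))"
  unfolding lagrange_basis_def divide_inverse by (intro continuous_intros)

definition lagrange_poly :: "nat \<Rightarrow> nat \<Rightarrow> real poly"
  where "lagrange_poly k m = (\<Prod>l\<in>{..<k} - {m}.
    smult (1 / (real m / real k - real l / real k)) [:- (real l / real k), 1:])"

lemma poly_lagrange_poly: "poly (lagrange_poly k m) y = lagrange_basis k m y"
  unfolding lagrange_poly_def lagrange_basis_def poly_prod
  by (intro prod.cong) (auto simp: diff_divide_distrib)

lemma degree_lagrange_poly:
  assumes "m < k"
  shows "degree (lagrange_poly k m) \<le> k - 1"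
proof -
  have "degree (lagrange_poly k m) \<le> (\<Sum>l\<in>{..<k} - {m}.
      degree (smult (1 / (real m / real k - real l / real k)) [:- (real l / real k), 1:]))"
    unfolding lagrange_poly_def by (rule order_trans[OF degree_prod_sum_le]) auto
  also have "\<dots> \<le> (\<Sum>l\<in>{..<k} - {m}. 1)"
    by (intro sum_mono) (auto intro: order_trans[OF degree_smult_le])
  also have "\<dots> = k - 1" using assms by simp
  finally show ?thesis .
qed

lemma lagrange_basis_reproduces:
  fixes P :: "real poly"
  assumes k: "degree P < k"
  shows "(\<Sum>m<k. poly P (real m / real k) * lagrange_basis k m y) = poly P y"
proof -
  have k0: "k > 0" using k by simp
  define Q where "Q = (\<Sum>m<k. smult (poly P (real m / real k)) (lagrange_poly k m))"
  have "degree Q \<le> k - 1"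
    unfolding Q_def
    by (intro degree_sum_le order_trans[OF degree_smult_le degree_lagrange_poly]) (simp_all only: finite_lessThan lessThan_iff)
  then have degQ: "degree Q < k" using k0 by linarith
  let ?N = "(\<lambda>m. real m / real k) ` {..<k}"
  have cardN: "card ?N = k" using k0 by (subst card_image) (auto simp: inj_on_def)
  have "Q = P"
  proof (rule poly_eqI_degree[of ?N])
    fix x assume "x \<in> ?N"
    then obtain j where j: "j < k" "x = real j / real k" by auto
    have delta: "lagrange_basis k m x = (if m = j then 1 else 0)" if "m < k" for m
    proof (cases "m = j")
      case True
      have "(x - real l / real k) / (real m / real k - real l / real k) = 1" if "l \<in> {..<k} - {m}" for l
        using that True j k0 by (simp add: diff_divide_distrib [symmetric])
      then have "lagrange_basis k m x = 1"
        unfolding lagrange_basis_def by (intro prod.neutral ballI)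
      then show ?thesis using True by simp
    next
      case False
      then show ?thesis unfolding lagrange_basis_def using j by (auto intro!: prod_zero)
    qed
    have "poly Q x = (\<Sum>m<k. poly P (real m / real k) * lagrange_basis k m x)"
      by (simp add: Q_def poly_sum poly_lagrange_poly)
    also have "\<dots> = (\<Sum>m<k. if m = j then poly P (real m / real k) else 0)"
      by (intro sum.cong) (auto simp: delta)
    also have "\<dots> = poly P x" using j by simp
    finally show "poly Q x = poly P x" .
  qed (use cardN k degQ in auto)
  moreover have "poly Q y = (\<Sum>m<k. poly P (real m / real k) * lagrange_basis k m y)"
    by (simp add: Q_def poly_sum poly_lagrange_poly)
  ultimately show ?thesis by simp
qed

text \<open>The interval contains all points of the grid cells next to a node, also those of the next finer
  grid.\<close>

lemma lagrange_basis_bound: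
  assumes "m < k" "y \<in> {-1..2}"
  shows "\<bar>lagrange_basis k m y\<bar> \<le> (3 * real k) ^ k"
proof -
  have k: "real k \<ge> 1" using assms(1) by simp
  have "\<bar>lagrange_basis k m y\<bar> \<le> (\<Prod>l\<in>{..<k} - {m}. 3 * real k)"
    unfolding lagrange_basis_def abs_prod
  proof (intro prod_mono conjI)
    fix l assume l: "l \<in> {..<k} - {m}"
    have "real l / real k \<le> 1" "0 \<le> real l / real k" using l k by auto
    then have num: "\<bar>y - real l / real k\<bar> \<le> 3"
      using assms(2) by (simp only: atLeastAtMost_iff abs_le_iff) linarith
    have "1 \<le> \<bar>real m - real l\<bar>" using l by (auto simp: abs_if)
    then have den: "1 / real k \<le> \<bar>real m / real k - real l / real k\<bar>"
      unfolding diff_divide_distrib [symmetric] abs_divide by (simp add: divide_right_mono)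
    have "\<bar>y - real l / real k\<bar> / \<bar>real m / real k - real l / real k\<bar> \<le> 3 / (1 / real k)"
      using num den k by (intro frac_le) auto
    then show "\<bar>(y - real l / real k) / (real m / real k - real l / real k)\<bar> \<le> 3 * real k"
      by (simp add: abs_divide)
  qed auto
  also have "\<dots> = (3 * real k) ^ (k - 1)" using assms(1) by simp
  also have "\<dots> \<le> (3 * real k) ^ k" using k by (intro power_increasing) auto
  finally show ?thesis .
qed

definition interpolation_const :: "nat \<Rightarrow> real"
  where "interpolation_const k = 1 + real k * (3 * real k) ^ k"

lemma interpolation_const_ge_1: "1 \<le> interpolation_const k"
  by (simp add: interpolation_const_def)

lemma interpolation_error:
  fixes P :: "real poly"
  assumes k: "degree P < k" and a: "\<And>y. y \<in> {-1..2} \<Longrightarrow> \<bar>G y - poly P y\<bar> \<le> a"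
    and y: "y \<in> {-1..2}"
  shows "\<bar>G y - (\<Sum>m<k. G (real m / real k) * lagrange_basis k m y)\<bar> \<le> interpolation_const k * a"
proof -
  have a0: "a \<ge> 0" using a[OF y] by linarith
  have "\<bar>\<Sum>m<k. (G (real m / real k) - poly P (real m / real k)) * lagrange_basis k m y\<bar>
      \<le> (\<Sum>m<k. a * (3 * real k) ^ k)"
  proof (rule order_trans[OF sum_abs], rule sum_mono)
    fix m assume m: "m \<in> {..<k}"
    have "0 \<le> real m / real k" "real m / real k \<le> 1" using m by auto
    then have "real m / real k \<in> {-1..2}" by (simp, linarith)
    then show "\<bar>(G (real m / real k) - poly P (real m / real k)) * lagrange_basis k m y\<bar> \<le> a * (3 * real k) ^ k"
      unfolding abs_mult using a0 m y by (intro mult_mono a lagrange_basis_bound) auto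
  qed
  also have "\<dots> = real k * (3 * real k) ^ k * a" by simp
  finally have "\<bar>(\<Sum>m<k. G (real m / real k) * lagrange_basis k m y) - poly P y\<bar> \<le> real k * (3 * real k) ^ k * a"
    using lagrange_basis_reproduces[OF k, of y] by (simp add: left_diff_distrib sum_subtractf)
  then have "\<bar>G y - (\<Sum>m<k. G (real m / real k) * lagrange_basis k m y)\<bar> \<le> a + real k * (3 * real k) ^ k * a"
    using a[OF y] by linarith
  then show ?thesis by (simp add: interpolation_const_def algebra_simps)
qed

text \<open>The nodes of the dyadic grid of width \<open>1 / 2 ^ q\<close> whose hat functions do not vanish on \<open>A\<close>.\<close>

definition active_nodes :: "real set \<Rightarrow> nat \<Rightarrow> int set"
  where "active_nodes A q = {i. \<exists>t\<in>A. \<bar>2 ^ q * t - real_of_int i\<bar> < 1}"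

lemma active_nodes_subset:
  assumes "A \<subseteq> {0..1}"
  shows "active_nodes A q \<subseteq> {0..2 ^ q}"
proof
  fix i assume "i \<in> active_nodes A q"
  then obtain t where t: "t \<in> A" "\<bar>2 ^ q * t - real_of_int i\<bar> < 1" by (auto simp: active_nodes_def)
  have "0 \<le> t" "t \<le> 1" using assms t(1) by auto
  then have "0 \<le> 2 ^ q * t" "2 ^ q * t \<le> 2 ^ q" by auto
  then have "- 1 < real_of_int i" "real_of_int i < 2 ^ q + 1" using t(2) by linarith+
  then have "real_of_int (- 1) < real_of_int i" "real_of_int i < real_of_int (2 ^ q + 1)" by simp_all
  then have "- 1 < i" "i < 2 ^ q + 1" by (simp_all only: of_int_less_iff)
  then show "i \<in> {0..2 ^ q}" by (simp only: atLeastAtMost_iff) linarith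
qed

lemma finite_active_nodes: "A \<subseteq> {0..1} \<Longrightarrow> finite (active_nodes A q)"
  by (rule finite_subset[OF active_nodes_subset]) auto

definition local_interpolant :: "nat \<Rightarrow> (real \<Rightarrow> real) \<Rightarrow> nat \<Rightarrow> int \<Rightarrow> real \<Rightarrow> real"
  where "local_interpolant k g q i y =
    (\<Sum>m<k. g ((real_of_int i + real m / real k) / 2 ^ q) * lagrange_basis k m y)"

definition quasi_interpolant :: "nat \<Rightarrow> real set \<Rightarrow> (real \<Rightarrow> real) \<Rightarrow> nat \<Rightarrow> real \<Rightarrow> real"
  where "quasi_interpolant k A g q t = (\<Sum>i\<in>active_nodes A q.
     hat (2 ^ q * t - real_of_int i) * local_interpolant k g q i (2 ^ q * t - real_of_int i))"

text \<open>Differences of consecutive quasi-interpolants are written in terms of products of hat functions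
  of two consecutive scales and a Lagrange polynomial of the finer scale.  Level \<open>0\<close> holds the
  coarsest quasi-interpolant itself, level \<open>q + 1\<close> the difference between scales \<open>q\<close> and \<open>q + 1\<close>.
  The second index component \<open>e\<close> numbers the fine nodes \<open>2 * i + e - 2\<close> whose hat functions overlap
  with that of the coarse node \<open>i\<close>.\<close>

definition level_index :: "nat \<Rightarrow> real set \<Rightarrow> nat \<Rightarrow> (int \<times> nat \<times> nat) set"
  where "level_index k A q = active_nodes A (q - 1) \<times> {..<5} \<times> {..<k}"

fun level_basis :: "nat \<Rightarrow> nat \<Rightarrow> int \<times> nat \<times> nat \<Rightarrow> real \<Rightarrow> real" where
  "level_basis k 0 (i, e, m) t =
     (if e = 0 then hat (t - real_of_int i) * lagrange_basis k m (t - real_of_int i) else 0)"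
| "level_basis k (Suc q) (i, e, m) t =
     hat (2 ^ q * t - real_of_int i) * hat (2 ^ Suc q * t - real_of_int (2 * i + int e - 2))
       * lagrange_basis k m (2 ^ Suc q * t - real_of_int (2 * i + int e - 2))"

fun level_coeff :: "nat \<Rightarrow> (real \<Rightarrow> real) \<Rightarrow> nat \<Rightarrow> int \<times> nat \<times> nat \<Rightarrow> real" where
  "level_coeff k g 0 (i, e, m) = g (real_of_int i + real m / real k)"
| "level_coeff k g (Suc q) (i, e, m) =
     g ((real_of_int i + (real e - 2 + real m / real k) / 2) / 2 ^ q)
       - local_interpolant k g q i ((real e - 2 + real m / real k) / 2)"

lemma sum_fine_nodes:
  fixes y :: real and F :: "int \<Rightarrow> real"
  assumes "\<bar>y - real_of_int i\<bar> < 1"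
  shows "(\<Sum>e<5. hat (2 * y - real_of_int (2 * i + int e - 2)) * F (2 * i + int e - 2))
    = (1 - frac (2 * y)) * F \<lfloor>2 * y\<rfloor> + frac (2 * y) * F (\<lfloor>2 * y\<rfloor> + 1)"
proof -
  have "(\<Sum>e<5. hat (2 * y - real_of_int (2 * i + int e - 2)) * F (2 * i + int e - 2))
      = (\<Sum>j\<in>{2 * i - 2..2 * i + 2}. hat (2 * y - real_of_int j) * F j)"
    by (rule sum.reindex_bij_witness[of _ "\<lambda>j. nat (j - 2 * i + 2)" "\<lambda>e. 2 * i + int e - 2"]) auto
  also have "\<dots> = (1 - frac (2 * y)) * F \<lfloor>2 * y\<rfloor> + frac (2 * y) * F (\<lfloor>2 * y\<rfloor> + 1)"
  proof (rule hat_sum)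
    fix j assume "\<bar>2 * y - real_of_int j\<bar> < 1"
    then have "real_of_int j < real_of_int (2 * i + 3)" "real_of_int (2 * i - 3) < real_of_int j"
      using assms by (auto simp: abs_if split: if_splits)
    then show "j \<in> {2 * i - 2..2 * i + 2}" unfolding of_int_less_iff by auto
  qed simp
  finally show ?thesis .
qed

lemma sum_active_nodes:
  assumes "A \<subseteq> {0..1}" "t \<in> A"
  shows "(\<Sum>i\<in>active_nodes A q. hat (2 ^ q * t - real_of_int i) * X i)
    = (1 - frac (2 ^ q * t)) * X \<lfloor>2 ^ q * t\<rfloor> + frac (2 ^ q * t) * X (\<lfloor>2 ^ q * t\<rfloor> + 1)"
  using assms by (intro hat_sum finite_active_nodes) (auto simp: active_nodes_def)

lemma quasi_interpolant_0:
  "k > 0 \<Longrightarrow> quasi_interpolant k A g 0 t = (\<Sum>r\<in>level_index k A 0. level_coeff k g 0 r * level_basis k 0 r t)"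
proof -
  assume "k > 0"
  have node: "(\<Sum>e<5. \<Sum>m<k. level_coeff k g 0 (i, e, m) * level_basis k 0 (i, e, m) t)
      = hat (t - real_of_int i) * local_interpolant k g 0 i (t - real_of_int i)" (is "_ = ?R") for i
  proof -
    have "(\<Sum>m<k. level_coeff k g 0 (i, 0, m) * level_basis k 0 (i, 0, m) t) = ?R"
      unfolding local_interpolant_def sum_distrib_left level_coeff.simps level_basis.simps
      by (intro sum.cong refl) (simp only: simp_thms if_True power_0 div_by_1 mult.left_commute)
    moreover have "(\<Sum>m<k. level_coeff k g 0 (i, e, m) * level_basis k 0 (i, e, m) t) = 0" if "e \<noteq> 0" for e
      using that by simp
    ultimately have "(\<Sum>m<k. level_coeff k g 0 (i, e, m) * level_basis k 0 (i, e, m) t) = (if e = 0 then ?R else 0)" for e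
      by (cases "e = 0") (simp_all only: simp_thms if_True if_False)
    then have "(\<Sum>e<5. \<Sum>m<k. level_coeff k g 0 (i, e, m) * level_basis k 0 (i, e, m) t) = (\<Sum>e<5. if e = (0::nat) then ?R else 0)"
      by (simp only:)
    also have "\<dots> = ?R" by simp
    finally show ?thesis .
  qed
  have "(\<Sum>r\<in>level_index k A 0. level_coeff k g 0 r * level_basis k 0 r t)
      = (\<Sum>i\<in>active_nodes A 0. \<Sum>e<5. \<Sum>m<k. level_coeff k g 0 (i, e, m) * level_basis k 0 (i, e, m) t)"
    unfolding level_index_def diff_0_eq_0 sum.cartesian_product' by (rule refl)
  also have "\<dots> = quasi_interpolant k A g 0 t"
    unfolding node quasi_interpolant_def by simp
  finally show ?thesis by simp
qed

text \<open>The coarse polynomial at \<open>i\<close> is reproduced by the interpolation at the nodes of the overlapping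
  fine cells, and the fine hat functions add up to \<open>1\<close>; hence subtracting the coarse polynomial from
  the fine ones amounts to interpolating the local error of the coarse one.\<close>

lemma quasi_interpolant_Suc:
  assumes A: "A \<subseteq> {0..1}" "t \<in> A" and k: "k > 0"
  shows "quasi_interpolant k A g (Suc q) t - quasi_interpolant k A g q t
    = (\<Sum>r\<in>level_index k A (Suc q). level_coeff k g (Suc q) r * level_basis k (Suc q) r t)"
proof -
  define y where "y = 2 ^ q * t"
  have y2: "2 ^ Suc q * t = 2 * y" by (simp add: y_def)
  define F where "F = (\<lambda>j. local_interpolant k g (Suc q) j (2 * y - real_of_int j))"
  define B where "B = (1 - frac (2 * y)) * F \<lfloor>2 * y\<rfloor> + frac (2 * y) * F (\<lfloor>2 * y\<rfloor> + 1)"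
  have fine: "quasi_interpolant k A g (Suc q) t = B"
    unfolding quasi_interpolant_def sum_active_nodes[OF A] unfolding y2 B_def F_def ..
  have node: "(\<Sum>e<5. \<Sum>m<k. level_coeff k g (Suc q) (i, e, m) * level_basis k (Suc q) (i, e, m) t)
      = hat (y - real_of_int i) * (B - local_interpolant k g q i (y - real_of_int i))" for i
  proof (cases "\<bar>y - real_of_int i\<bar> < 1")
    case False
    then have "hat (y - real_of_int i) = 0" by (intro hat_eq_0) simp
    then show ?thesis
      by (simp only: level_basis.simps y_def [symmetric] mult_zero_left mult_zero_right sum.neutral_const)
  next
    case True
    have inner: "(\<Sum>m<k. level_coeff k g (Suc q) (i, e, m) * lagrange_basis k m (2 * y - real_of_int (2 * i + int e - 2)))
       = F (2 * i + int e - 2) - local_interpolant k g q i (y - real_of_int i)" for e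
    proof -
      let ?i' = "2 * i + int e - 2"
      have v: "(real_of_int i + (real e - 2 + real m / real k) / 2) / 2 ^ q = (real_of_int ?i' + real m / real k) / 2 ^ Suc q" for m
        by (simp add: field_simps)
      obtain P :: "real poly" where P: "degree P < k" "\<And>z. poly P z = local_interpolant k g q i ((real e - 2 + z) / 2)"
      proof -
        define L where "L = (\<lambda>m. pcompose (lagrange_poly k m) [:(real e - 2) / 2, 1 / 2:])"
        define P where "P = (\<Sum>m<k. smult (g ((real_of_int i + real m / real k) / 2 ^ q)) (L m))"
        have "degree (L m) \<le> k - 1" if "m < k" for m
          using degree_lagrange_poly[OF that] by (simp add: L_def degree_pcompose)
        from order_trans[OF degree_smult_le this] have "degree P \<le> k - 1"
          unfolding P_def by (intro degree_sum_le) (simp_all only: finite_lessThan lessThan_iff)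
        then have "degree P < k" using k by linarith
        moreover have "poly (L m) z = lagrange_basis k m ((real e - 2 + z) / 2)" for m z
          by (simp add: L_def poly_pcompose poly_lagrange_poly add_divide_distrib)
        then have "poly P z = local_interpolant k g q i ((real e - 2 + z) / 2)" for z
          by (simp add: P_def local_interpolant_def poly_sum)
        ultimately show ?thesis using that by blast
      qed
      have "(\<Sum>m<k. level_coeff k g (Suc q) (i, e, m) * lagrange_basis k m (2 * y - real_of_int ?i'))
        = F ?i' - (\<Sum>m<k. poly P (real m / real k) * lagrange_basis k m (2 * y - real_of_int ?i'))"
        unfolding level_coeff.simps v P(2) F_def local_interpolant_def[of k g "Suc q"]
        by (simp only: left_diff_distrib sum_subtractf)
      also have "\<dots> = F ?i' - poly P (2 * y - real_of_int ?i')"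
        by (simp only: lagrange_basis_reproduces[OF P(1)])
      also have "poly P (2 * y - real_of_int ?i') = local_interpolant k g q i (y - real_of_int i)"
      proof -
        have "(real e - 2 + (2 * y - real_of_int ?i')) / 2 = y - real_of_int i" by simp
        then show ?thesis unfolding P(2) by (simp only:)
      qed
      finally show ?thesis .
    qed
    have "(\<Sum>e<5. \<Sum>m<k. level_coeff k g (Suc q) (i, e, m) * level_basis k (Suc q) (i, e, m) t)
      = (\<Sum>e<5. hat (y - real_of_int i) * (hat (2 * y - real_of_int (2 * i + int e - 2)) *
          (\<Sum>m<k. level_coeff k g (Suc q) (i, e, m) * lagrange_basis k m (2 * y - real_of_int (2 * i + int e - 2)))))"
      unfolding level_basis.simps y2 y_def [symmetric] sum_distrib_left
      by (intro sum.cong refl) (simp only: mult.assoc mult.left_commute)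
    also have "\<dots> = hat (y - real_of_int i) * (\<Sum>e<5. hat (2 * y - real_of_int (2 * i + int e - 2)) *
       (F (2 * i + int e - 2) - local_interpolant k g q i (y - real_of_int i)))"
      unfolding inner by (simp only: sum_distrib_left)
    also have "(\<Sum>e<5. hat (2 * y - real_of_int (2 * i + int e - 2)) *
       (F (2 * i + int e - 2) - local_interpolant k g q i (y - real_of_int i)))
       = B - local_interpolant k g q i (y - real_of_int i)"
      unfolding sum_fine_nodes[OF True, of "\<lambda>j. F j - local_interpolant k g q i (y - real_of_int i)"] B_def
      by (simp add: algebra_simps)
    finally show ?thesis .
  qed
  have "(\<Sum>r\<in>level_index k A (Suc q). level_coeff k g (Suc q) r * level_basis k (Suc q) r t)
      = (\<Sum>i\<in>active_nodes A q. \<Sum>e<5. \<Sum>m<k. level_coeff k g (Suc q) (i, e, m) * level_basis k (Suc q) (i, e, m) t)"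
    unfolding level_index_def diff_Suc_1 sum.cartesian_product' by (rule refl)
  also have "\<dots> = (\<Sum>i\<in>active_nodes A q. hat (y - real_of_int i) * B)
      - (\<Sum>i\<in>active_nodes A q. hat (y - real_of_int i) * local_interpolant k g q i (y - real_of_int i))"
    unfolding node by (simp only: right_diff_distrib sum_subtractf)
  also have "(\<Sum>i\<in>active_nodes A q. hat (y - real_of_int i) * B) = B"
    unfolding y_def sum_active_nodes[OF A] by (simp add: algebra_simps)
  also have "(\<Sum>i\<in>active_nodes A q. hat (y - real_of_int i) * local_interpolant k g q i (y - real_of_int i))
      = quasi_interpolant k A g q t"
    by (simp add: quasi_interpolant_def y_def)
  finally show ?thesis using fine by simp
qed

lemma quasi_interpolant_eq_level_sum:
  assumes "A \<subseteq> {0..1}" "t \<in> A" "k > 0"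
  shows "quasi_interpolant k A g K t
    = (\<Sum>q\<le>K. \<Sum>r\<in>level_index k A q. level_coeff k g q r * level_basis k q r t)"
proof (induction K)
  case 0
  then show ?case using quasi_interpolant_0[OF assms(3)] by simp
next
  case (Suc K)
  have "quasi_interpolant k A g (Suc K) t = quasi_interpolant k A g K t
      + (\<Sum>r\<in>level_index k A (Suc K). level_coeff k g (Suc K) r * level_basis k (Suc K) r t)"
    using quasi_interpolant_Suc[OF assms, of g K] by linarith
  then show ?case by (simp only: Suc.IH sum.atMost_Suc)
qed

text \<open>Smoothness of order \<open>s\<close> in a local form: the \<open>p\<close>-norm of the errors \<open>a i\<close> over the nodes, and not
  only their maximum, has to decay.  The bound on \<open>{0..2}\<close> is for the coefficients of the coarsest level,
  since the interpolation points of the nodes \<open>0\<close> and \<open>1\<close> lie in this interval.\<close>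

definition locally_polynomial :: "nat \<Rightarrow> real \<Rightarrow> real \<Rightarrow> real \<Rightarrow> (real \<Rightarrow> real) \<Rightarrow> bool"
  where "locally_polynomial k p s C g \<longleftrightarrow> (\<forall>v\<in>{0..2}. \<bar>g v\<bar> \<le> C) \<and>
    (\<forall>q. \<exists>a :: int \<Rightarrow> real. (\<forall>i. 0 \<le> a i) \<and>
      (\<forall>J. finite J \<longrightarrow> (\<Sum>i\<in>J. a i powr p) \<le> (C * 2 powr (- s * real q)) powr p) \<and>
      (\<forall>i. \<exists>P :: real poly. degree P < k \<and>
         (\<forall>y\<in>{-1..2}. \<bar>g ((real_of_int i + y) / 2 ^ q) - poly P y\<bar> \<le> a i)))"

lemma powr_le_powr_imp_le:
  fixes x y p :: real
  assumes "x powr p \<le> y powr p" "p > 0" "0 \<le> x" "0 \<le> y"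
  shows "x \<le> y"
  using assms by (metis not_le powr_less_mono2)

lemma quasi_interpolant_error:
  assumes A: "A \<subseteq> {0..1}" and t: "t \<in> A" and k: "k > 0" and p: "p > 0" and C: "C \<ge> 0"
    and g: "locally_polynomial k p s C g"
  shows "\<bar>g t - quasi_interpolant k A g q t\<bar> \<le> interpolation_const k * C * 2 powr (- s * real q)"
proof -
  let ?y = "\<lambda>i. 2 ^ q * t - real_of_int i"
  let ?B = "C * 2 powr (- s * real q)"
  obtain a where a: "\<And>i. 0 \<le> a i" "\<And>J. finite J \<Longrightarrow> (\<Sum>i\<in>J. a i powr p) \<le> ?B powr p"
    "\<And>i. \<exists>P :: real poly. degree P < k \<and> (\<forall>y\<in>{-1..2}. \<bar>g ((real_of_int i + y) / 2 ^ q) - poly P y\<bar> \<le> a i)"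
    using g unfolding locally_polynomial_def by metis
  have aB: "a i \<le> ?B" for i
    using a(2)[of "{i}"] a(1)[of i] p C by (intro powr_le_powr_imp_le[of "a i" p]) auto
  have one: "(\<Sum>i\<in>active_nodes A q. hat (?y i)) = 1"
    using A t by (intro hat_partition_of_unity finite_active_nodes) (auto simp: active_nodes_def)
  have "g t - quasi_interpolant k A g q t
      = (\<Sum>i\<in>active_nodes A q. hat (?y i)) * g t - quasi_interpolant k A g q t"
    by (simp only: one mult_1_left)
  also have "\<dots> = (\<Sum>i\<in>active_nodes A q. hat (?y i) * (g t - local_interpolant k g q i (?y i)))"
    unfolding quasi_interpolant_def by (simp only: sum_distrib_right right_diff_distrib sum_subtractf)
  finally have "\<bar>g t - quasi_interpolant k A g q t\<bar>
      \<le> (\<Sum>i\<in>active_nodes A q. \<bar>hat (?y i) * (g t - local_interpolant k g q i (?y i))\<bar>)"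
    using sum_abs[of "\<lambda>i. hat (?y i) * (g t - local_interpolant k g q i (?y i))" "active_nodes A q"] by (simp only:)
  also have "\<dots> \<le> (\<Sum>i\<in>active_nodes A q. hat (?y i) * (interpolation_const k * ?B))"
  proof (rule sum_mono)
    fix i
    show "\<bar>hat (?y i) * (g t - local_interpolant k g q i (?y i))\<bar> \<le> hat (?y i) * (interpolation_const k * ?B)"
    proof (cases "\<bar>?y i\<bar> < 1")
      case False
      then have "hat (?y i) = 0" by (intro hat_eq_0) simp
      then show ?thesis by simp
    next
      case True
      obtain P :: "real poly" where P: "degree P < k"
        "\<And>y. y \<in> {-1..2} \<Longrightarrow> \<bar>g ((real_of_int i + y) / 2 ^ q) - poly P y\<bar> \<le> a i"
        using a(3)[of i] by blast
      have "\<bar>g ((real_of_int i + ?y i) / 2 ^ q) - local_interpolant k g q i (?y i)\<bar> \<le> interpolation_const k * a i"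
        unfolding local_interpolant_def using True
        by (intro interpolation_error[where G = "\<lambda>y. g ((real_of_int i + y) / 2 ^ q)", OF P]) auto
      moreover have "(real_of_int i + ?y i) / 2 ^ q = t" by simp
      moreover have "interpolation_const k * a i \<le> interpolation_const k * ?B"
        using aB interpolation_const_ge_1[of k] by (intro mult_left_mono) auto
      ultimately have "\<bar>g t - local_interpolant k g q i (?y i)\<bar> \<le> interpolation_const k * ?B"
        by (simp only:)
      then show ?thesis unfolding abs_mult using hat_nonneg[of "?y i"] by (simp add: mult_left_mono)
    qed
  qed
  also have "\<dots> = interpolation_const k * ?B"
    using one by (simp only: sum_distrib_right [symmetric] mult_1_left)
  finally show ?thesis by (simp only: mult.assoc)
qed

definition level_const :: "nat \<Rightarrow> real \<Rightarrow> real"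
  where "level_const k s = 10 * real k * interpolation_const k * 2 powr \<bar>s\<bar>"

text \<open>The coefficients at the node \<open>i\<close> are values of an interpolation error there, and each node carries
  only \<open>5 * k\<close> of them, so that their \<open>p\<close>-norm inherits the decay of the local errors.\<close>

lemma level_coeff_bound:
  assumes A: "A \<subseteq> {0..1}" and k: "k > 0" and p: "p \<ge> 1" and C: "C \<ge> 0"
    and g: "locally_polynomial k p s C g"
  shows "(\<Sum>r\<in>level_index k A q. \<bar>level_coeff k g q r\<bar> powr p)
    \<le> (level_const k s * C * 2 powr (- s * real q)) powr p"
proof -
  let ?I = "interpolation_const k"
  have pick: "10 * real k * X powr p \<le> (10 * real k * X) powr p" if "X \<ge> 0" for X
  proof -
    have "1 \<le> 10 * real k" using k by simp
    then have "(10 * real k) powr 1 \<le> (10 * real k) powr p" using p by (intro powr_mono) auto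
    then show ?thesis using that by (simp add: powr_mult mult_right_mono)
  qed
  show ?thesis
  proof (cases q)
    case 0
    have bd: "\<bar>level_coeff k g 0 r\<bar> powr p \<le> C powr p" if "r \<in> level_index k A 0" for r
    proof -
      obtain i e m where rt: "r = (i, e, m)" by (cases r)
      then have r: "r = (i, e, m)" "i \<in> active_nodes A 0" "m < k"
        using that by (auto simp: level_index_def)
      have "i \<in> {0..1}" using active_nodes_subset[OF A, of 0] r(2) by auto
      then have "0 \<le> real_of_int i" "real_of_int i \<le> 1" by auto
      moreover have "0 \<le> real m / real k" "real m / real k \<le> 1" using r(3) by auto
      ultimately have "real_of_int i + real m / real k \<in> {0..2}" unfolding atLeastAtMost_iff by linarith
      then have "\<bar>g (real_of_int i + real m / real k)\<bar> \<le> C"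
        using g unfolding locally_polynomial_def by blast
      then show ?thesis using p by (simp add: r(1) powr_mono2)
    qed
    have "card (level_index k A 0) \<le> 10 * k"
    proof -
      have "card (active_nodes A 0) \<le> card {0..1::int}"
        using active_nodes_subset[OF A, of 0] by (intro card_mono) auto
      then show ?thesis by (simp add: level_index_def card_cartesian_product)
    qed
    then have cardle: "real (card (level_index k A 0)) \<le> 10 * real k" by linarith
    have "(\<Sum>r\<in>level_index k A 0. \<bar>level_coeff k g 0 r\<bar> powr p) \<le> real (card (level_index k A 0)) * C powr p"
      using bd by (intro sum_bounded_above) auto
    also have "\<dots> \<le> 10 * real k * C powr p" using cardle by (intro mult_right_mono) auto
    also have "\<dots> \<le> (10 * real k * C) powr p" by (rule pick[OF C])
    also have "\<dots> \<le> (level_const k s * C * 2 powr (- s * real 0)) powr p"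
    proof (rule powr_mono2)
      have "1 * 1 \<le> ?I * 2 powr \<bar>s\<bar>"
        using interpolation_const_ge_1[of k] by (intro mult_mono) (auto simp: ge_one_powr_ge_zero)
      then have "(10 * real k * C) * 1 \<le> (10 * real k * C) * (?I * 2 powr \<bar>s\<bar>)"
        using C by (intro mult_left_mono) auto
      then show "10 * real k * C \<le> level_const k s * C * 2 powr (- s * real 0)"
        by (simp add: level_const_def mult_ac)
    qed (use p C in auto)
    finally show ?thesis unfolding 0 .
  next
    case (Suc q')
    let ?B = "C * 2 powr (- s * real q')"
    obtain a where a: "\<And>i. 0 \<le> a i" "\<And>J. finite J \<Longrightarrow> (\<Sum>i\<in>J. a i powr p) \<le> ?B powr p"
      "\<And>i. \<exists>P :: real poly. degree P < k \<and> (\<forall>y\<in>{-1..2}. \<bar>g ((real_of_int i + y) / 2 ^ q') - poly P y\<bar> \<le> a i)"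
      using g unfolding locally_polynomial_def by metis
    have bd: "\<bar>level_coeff k g (Suc q') (i, e, m)\<bar> powr p \<le> (?I * a i) powr p" if "e < 5" "m < k" for i e m
    proof (rule powr_mono2)
      obtain P :: "real poly" where P: "degree P < k"
        "\<And>y. y \<in> {-1..2} \<Longrightarrow> \<bar>g ((real_of_int i + y) / 2 ^ q') - poly P y\<bar> \<le> a i"
        using a(3)[of i] by blast
      have "real e \<le> 4" "0 \<le> real e" using that(1) by auto
      moreover have "0 \<le> real m / real k" "real m / real k \<le> 1" using that(2) by auto
      ultimately have y: "(real e - 2 + real m / real k) / 2 \<in> {-1..2}"
        unfolding atLeastAtMost_iff by argo
      show "\<bar>level_coeff k g (Suc q') (i, e, m)\<bar> \<le> ?I * a i"
        unfolding level_coeff.simps local_interpolant_def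
        by (rule interpolation_error[where G = "\<lambda>y. g ((real_of_int i + y) / 2 ^ q')", OF P y])
    qed (use p in auto)
    have "(\<Sum>r\<in>level_index k A (Suc q'). \<bar>level_coeff k g (Suc q') r\<bar> powr p)
       = (\<Sum>i\<in>active_nodes A q'. \<Sum>e<5. \<Sum>m<k. \<bar>level_coeff k g (Suc q') (i, e, m)\<bar> powr p)"
      unfolding level_index_def diff_Suc_1 sum.cartesian_product' by (rule refl)
    also have "\<dots> \<le> (\<Sum>i\<in>active_nodes A q'. \<Sum>e<5::nat. \<Sum>m<k. (?I * a i) powr p)"
      by (intro sum_mono bd) auto
    also have "\<dots> = 5 * real k * ?I powr p * (\<Sum>i\<in>active_nodes A q'. a i powr p)"
      using a(1) interpolation_const_ge_1[of k] by (simp add: powr_mult sum_distrib_left mult_ac)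
    also have "\<dots> \<le> 10 * real k * ?I powr p * ?B powr p"
      by (intro mult_mono a(2) finite_active_nodes A) (auto intro: sum_nonneg)
    also have "\<dots> = 10 * real k * (?I * ?B) powr p"
      using C interpolation_const_ge_1[of k] by (simp add: powr_mult)
    also have "\<dots> \<le> (10 * real k * (?I * ?B)) powr p"
      using C interpolation_const_ge_1[of k] by (intro pick) auto
    also have "\<dots> \<le> (level_const k s * C * 2 powr (- s * real (Suc q'))) powr p"
    proof (rule powr_mono2)
      have "2 powr (- s * real q') \<le> 2 powr (\<bar>s\<bar> + - s * real (Suc q'))"
        by (intro powr_mono) (auto simp: algebra_simps)
      also have "\<dots> = 2 powr \<bar>s\<bar> * 2 powr (- s * real (Suc q'))" by (rule powr_add)
      finally have "10 * real k * ?I * C * 2 powr (- s * real q')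
          \<le> 10 * real k * ?I * C * (2 powr \<bar>s\<bar> * 2 powr (- s * real (Suc q')))"
        using C interpolation_const_ge_1[of k] by (intro mult_left_mono) auto
      then show "10 * real k * (?I * ?B) \<le> level_const k s * C * 2 powr (- s * real (Suc q'))"
        unfolding level_const_def by (simp only: mult_ac)
    qed (use p C interpolation_const_ge_1[of k] in auto)
    finally show ?thesis unfolding Suc .
  qed
qed

lemma continuous_on_level_basis: "continuous_on S (level_basis k q r)"
proof -
  obtain i e m where r: "r = (i, e, m)" by (cases r)
  show ?thesis
  proof (cases q)
    case 0
    have "level_basis k q r = (\<lambda>t. if e = 0 then hat (t - real_of_int i) * lagrange_basis k m (t - real_of_int i) else 0)"
      unfolding 0 r by (rule ext) (rule level_basis.simps)
    then show ?thesis
      by (cases "e = 0") (auto intro!: continuous_intros continuous_on_hat continuous_on_lagrange_basis)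
  next
    case (Suc q')
    have "level_basis k q r = (\<lambda>t. hat (2 ^ q' * t - real_of_int i) * hat (2 ^ Suc q' * t - real_of_int (2 * i + int e - 2))
       * lagrange_basis k m (2 ^ Suc q' * t - real_of_int (2 * i + int e - 2)))"
      unfolding Suc r by (rule ext) (rule level_basis.simps)
    then show ?thesis
      by (auto intro!: continuous_intros continuous_on_hat continuous_on_lagrange_basis)
  qed
qed

lemma sum_level_basis_bound:
  assumes A: "A \<subseteq> {0..1}" and t: "t \<in> A" and k: "k > 0"
  shows "(\<Sum>r\<in>level_index k A q. \<bar>level_basis k q r t\<bar>) \<le> interpolation_const k"
proof -
  let ?M = "(3 * real k) ^ k"
  have hl: "\<bar>hat y * lagrange_basis k m y\<bar> \<le> hat y * ?M" if "m < k" for y m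
  proof (cases "\<bar>y\<bar> < 1")
    case True
    then have "\<bar>lagrange_basis k m y\<bar> \<le> ?M" using that by (intro lagrange_basis_bound) auto
    then show ?thesis using hat_nonneg[of y] by (simp add: abs_mult mult_left_mono)
  next
    case False
    then have "hat y = 0" by (intro hat_eq_0) simp
    then show ?thesis by simp
  qed
  have "(\<Sum>r\<in>level_index k A q. \<bar>level_basis k q r t\<bar>) \<le> real k * ?M"
  proof (cases q)
    case 0
    have one: "(\<Sum>i\<in>active_nodes A 0. hat (t - real_of_int i)) = 1"
      using A t by (intro hat_partition_of_unity finite_active_nodes) (auto simp: active_nodes_def)
    have inner: "(\<Sum>e<5. \<Sum>m<k. \<bar>level_basis k 0 (i, e, m) t\<bar>) \<le> hat (t - real_of_int i) * (real k * ?M)" for i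
    proof -
      have "(\<Sum>m<k. \<bar>level_basis k 0 (i, e, m) t\<bar>) \<le> (if e = 0 then hat (t - real_of_int i) * (real k * ?M) else 0)" for e
      proof (cases "e = 0")
        case True
        have "(\<Sum>m<k. \<bar>level_basis k 0 (i, e, m) t\<bar>) \<le> (\<Sum>m<k. hat (t - real_of_int i) * ?M)"
          unfolding level_basis.simps using hl True by (intro sum_mono) simp
        then show ?thesis using True by (simp add: mult_ac)
      qed simp
      then have "(\<Sum>e<5. \<Sum>m<k. \<bar>level_basis k 0 (i, e, m) t\<bar>)
          \<le> (\<Sum>e<5. if e = (0::nat) then hat (t - real_of_int i) * (real k * ?M) else 0)"
        by (intro sum_mono)
      then show ?thesis by simp
    qed
    have "(\<Sum>r\<in>level_index k A 0. \<bar>level_basis k 0 r t\<bar>)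
        = (\<Sum>i\<in>active_nodes A 0. \<Sum>e<5. \<Sum>m<k. \<bar>level_basis k 0 (i, e, m) t\<bar>)"
      unfolding level_index_def diff_0_eq_0 sum.cartesian_product' by (rule refl)
    also have "\<dots> \<le> (\<Sum>i\<in>active_nodes A 0. hat (t - real_of_int i) * (real k * ?M))"
      by (intro sum_mono inner)
    also have "\<dots> = real k * ?M" by (simp only: sum_distrib_right [symmetric] one mult_1_left)
    finally show ?thesis unfolding 0 .
  next
    case (Suc q')
    define y where "y = 2 ^ q' * t"
    have y2: "2 ^ Suc q' * t = 2 * y" by (simp add: y_def)
    have one: "(\<Sum>i\<in>active_nodes A q'. hat (y - real_of_int i)) = 1"
      unfolding y_def using A t by (intro hat_partition_of_unity finite_active_nodes) (auto simp: active_nodes_def)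
    have inner: "(\<Sum>e<5. \<Sum>m<k. \<bar>level_basis k (Suc q') (i, e, m) t\<bar>) \<le> hat (y - real_of_int i) * (real k * ?M)" for i
    proof (cases "\<bar>y - real_of_int i\<bar> < 1")
      case False
      then have "hat (y - real_of_int i) = 0" by (intro hat_eq_0) simp
      then show ?thesis unfolding level_basis.simps y_def [symmetric] by simp
    next
      case True
      let ?h = "\<lambda>e::nat. hat (2 * y - real_of_int (2 * i + int e - 2))"
      have "(\<Sum>e<5. \<Sum>m<k. \<bar>level_basis k (Suc q') (i, e, m) t\<bar>)
          \<le> (\<Sum>e<5. \<Sum>m<k. hat (y - real_of_int i) * (?h e * ?M))"
      proof (intro sum_mono)
        fix e m assume "m \<in> {..<k}"
        then have m: "m < k" by simp
        let ?z = "2 * y - real_of_int (2 * i + int e - 2)"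
        have "\<bar>level_basis k (Suc q') (i, e, m) t\<bar> = hat (y - real_of_int i) * \<bar>hat ?z * lagrange_basis k m ?z\<bar>"
          unfolding level_basis.simps y2 y_def [symmetric]
          by (simp only: abs_mult mult.assoc abs_of_nonneg[OF hat_nonneg])
        also have "\<dots> \<le> hat (y - real_of_int i) * (hat ?z * ?M)"
          by (intro mult_left_mono hl m hat_nonneg)
        finally show "\<bar>level_basis k (Suc q') (i, e, m) t\<bar> \<le> hat (y - real_of_int i) * (hat ?z * ?M)" .
      qed
      also have "\<dots> = hat (y - real_of_int i) * (real k * ?M) * (\<Sum>e<5. ?h e * 1)"
        unfolding sum_constant card_lessThan sum_distrib_left by (intro sum.cong refl) (simp only: mult_ac mult_1_right mult_1_left)
      also have "(\<Sum>e<5. ?h e * 1) = 1"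
        using sum_fine_nodes[OF True, of "\<lambda>_. 1"] by simp
      finally show ?thesis by simp
    qed
    have "(\<Sum>r\<in>level_index k A (Suc q'). \<bar>level_basis k (Suc q') r t\<bar>)
        = (\<Sum>i\<in>active_nodes A q'. \<Sum>e<5. \<Sum>m<k. \<bar>level_basis k (Suc q') (i, e, m) t\<bar>)"
      unfolding level_index_def diff_Suc_1 sum.cartesian_product' by (rule refl)
    also have "\<dots> \<le> (\<Sum>i\<in>active_nodes A q'. hat (y - real_of_int i) * (real k * ?M))"
      by (intro sum_mono inner)
    also have "\<dots> = real k * ?M" by (simp only: sum_distrib_right [symmetric] one mult_1_left)
    finally show ?thesis unfolding Suc .
  qed
  then show ?thesis by (simp add: interpolation_const_def)
qed

section \<open>Counting active grid nodes\<close>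

definition rate :: "real \<Rightarrow> real \<Rightarrow> nat \<Rightarrow> real"
  where "rate a b n = real n powr a * (log 2 (real n + 1)) powr b"

lemma log_Suc_ge_1: "n \<ge> 1 \<Longrightarrow> 1 \<le> log 2 (real n + 1)"
  by (subst le_log_iff) auto

lemma rate_pos:
  assumes "n \<ge> 1"
  shows "rate a b n > 0"
proof -
  have "log 2 (real n + 1) \<noteq> 0" using log_Suc_ge_1[OF assms] by linarith
  then show ?thesis using assms by (simp add: rate_def)
qed

lemma rate_powr: "n \<ge> 1 \<Longrightarrow> rate a b n powr s = rate (a * s) (b * s) n"
  using log_Suc_ge_1[of n] by (simp add: rate_def powr_mult powr_powr)

lemma log_Suc_ratio:
  assumes "1 \<le> m" "m \<le> n"
  shows "log 2 (real n + 1) \<le> 3 * (real n / real m) * log 2 (real m + 1)"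
proof -
  let ?r = "real n / real m"
  have r: "?r \<ge> 1" using assms by simp
  have ln2: "1 \<le> 2 * ln (2::real)"
  proof -
    have "exp (1/2) * exp (1/2 :: real) = exp 1" by (simp add: mult_exp_exp)
    then have "(exp (1/2))\<^sup>2 \<le> (2::real)\<^sup>2" using exp_le by (simp add: power2_eq_square)
    then have "exp (1/2) \<le> (2::real)" by (rule power2_le_imp_le) simp
    then have "ln (exp (1/2)) \<le> ln (2::real)" by (subst ln_le_cancel_iff) auto
    then show ?thesis by simp
  qed
  have lnm: "ln 2 \<le> ln (real m + 1)" using assms by (subst ln_le_cancel_iff) auto
  have "ln (real n + 1) = ln (real m + 1) + ln ((real n + 1) / (real m + 1))"
    by (simp add: ln_div)
  also have "ln ((real n + 1) / (real m + 1)) \<le> (real n + 1) / (real m + 1) - 1"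
    by (rule ln_le_minus_one) simp
  also have "(real n + 1) / (real m + 1) \<le> ?r + 1"
  proof -
    have "(real n + 1) / (real m + 1) = real n / (real m + 1) + 1 / (real m + 1)"
      by (rule add_divide_distrib)
    also have "\<dots> \<le> real n / real m + 1" using assms by (intro add_mono divide_left_mono) auto
    finally show ?thesis .
  qed
  finally have "ln (real n + 1) \<le> ln (real m + 1) + ?r * 1" by simp
  moreover have "?r * 1 \<le> ?r * (2 * ln (real m + 1))" using ln2 lnm r by (intro mult_left_mono) linarith+
  moreover have "1 * ln (real m + 1) \<le> ?r * ln (real m + 1)" using r by (intro mult_right_mono) auto
  ultimately have "ln (real n + 1) \<le> 3 * ?r * ln (real m + 1)" by argo
  then have "ln (real n + 1) / ln 2 \<le> 3 * ?r * ln (real m + 1) / ln 2"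
    by (intro divide_right_mono) auto
  then show ?thesis by (simp add: log_def)
qed

text \<open>Since the logarithm grows at most linearly, values of a rate at different arguments differ at most
  by a power of the ratio of the arguments.  So constant factors of the argument can be absorbed.\<close>

lemma rate_ratio:
  assumes "1 \<le> m" "m \<le> n"
  shows "rate a b m \<le> rate a b n * (3 * (real n / real m)) powr (\<bar>a\<bar> + \<bar>b\<bar>)"
proof -
  let ?R = "3 * (real n / real m)"
  have R: "?R \<ge> 1" using assms by (simp add: field_simps)
  have general: "x powr e \<le> y powr e * ?R powr \<bar>e\<bar>" if "0 < x" "x \<le> y" "y \<le> ?R * x" for x y e :: real
  proof -
    have "x powr e = y powr e * (y / x) powr (- e)"
      using that by (simp add: powr_divide powr_minus_divide)
    also have "(y / x) powr (- e) \<le> (y / x) powr \<bar>e\<bar>" using that by (intro powr_mono) auto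
    also have "(y / x) powr \<bar>e\<bar> \<le> ?R powr \<bar>e\<bar>"
      using that by (intro powr_mono2) (auto simp: divide_le_eq)
    finally show ?thesis by (simp add: mult_left_mono)
  qed
  have "real n \<le> ?R * real m" using assms by simp
  then have 1: "real m powr a \<le> real n powr a * ?R powr \<bar>a\<bar>"
    using assms by (intro general) auto
  have 2: "log 2 (real m + 1) powr b \<le> log 2 (real n + 1) powr b * ?R powr \<bar>b\<bar>"
    using assms log_Suc_ge_1[of m] log_Suc_ratio[OF assms] by (intro general) auto
  have "rate a b m \<le> (real n powr a * ?R powr \<bar>a\<bar>) * (log 2 (real n + 1) powr b * ?R powr \<bar>b\<bar>)"
    unfolding rate_def by (intro mult_mono 1 2) auto
  also have "\<dots> = rate a b n * ?R powr (\<bar>a\<bar> + \<bar>b\<bar>)"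
    by (simp only: rate_def powr_add mult_ac)
  finally show ?thesis .
qed

lemma card_ints_near_le:
  fixes y \<rho> :: real
  assumes "\<rho> \<ge> 0"
  shows "finite {j::int. \<bar>y - real_of_int j\<bar> < \<rho>}" "real (card {j::int. \<bar>y - real_of_int j\<bar> < \<rho>}) \<le> 2 * \<rho> + 1"
proof -
  have sub: "{j::int. \<bar>y - real_of_int j\<bar> < \<rho>} \<subseteq> {\<lceil>y - \<rho>\<rceil>..\<lfloor>y + \<rho>\<rfloor>}"
    by (auto simp: ceiling_le_iff le_floor_iff)
  then show "finite {j::int. \<bar>y - real_of_int j\<bar> < \<rho>}" by (rule finite_subset) simp
  have "card {j::int. \<bar>y - real_of_int j\<bar> < \<rho>} \<le> card {\<lceil>y - \<rho>\<rceil>..\<lfloor>y + \<rho>\<rfloor>}"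
    using sub by (intro card_mono) auto
  moreover have "real (card {\<lceil>y - \<rho>\<rceil>..\<lfloor>y + \<rho>\<rfloor>}) \<le> 2 * \<rho> + 1"
  proof -
    have "real_of_int (\<lfloor>y + \<rho>\<rfloor> - \<lceil>y - \<rho>\<rceil> + 1) \<le> 2 * \<rho> + 1"
      using of_int_floor_le[of "y + \<rho>"] le_of_int_ceiling[of "y - \<rho>"]
      unfolding of_int_add of_int_diff of_int_1 by linarith
    moreover have "0 \<le> 2 * \<rho> + 1" using assms by simp
    moreover have "real (nat z) = max 0 (real_of_int z)" for z by (cases "z \<ge> 0") auto
    ultimately show ?thesis unfolding card_atLeastAtMost_int by (simp only: add.commute diff_add_eq)
  qed
  ultimately show "real (card {j::int. \<bar>y - real_of_int j\<bar> < \<rho>}) \<le> 2 * \<rho> + 1" by linarith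
qed

lemma card_active_nodes_cover:
  fixes x :: "nat \<Rightarrow> real"
  assumes "A \<subseteq> (\<Union>i\<in>{1..m}. {t. \<bar>t - x i\<bar> \<le> \<epsilon>})" "\<epsilon> \<ge> 0"
  shows "real (card (active_nodes A q)) \<le> real m * (3 + 2 * (2 ^ q * \<epsilon>))"
proof -
  let ?N = "\<lambda>i. {j::int. \<bar>2 ^ q * x i - real_of_int j\<bar> < 2 ^ q * \<epsilon> + 1}"
  have e0: "0 \<le> 2 ^ q * \<epsilon> + 1" using assms(2) by simp
  have sub: "active_nodes A q \<subseteq> (\<Union>i\<in>{1..m}. ?N i)"
  proof
    fix j assume "j \<in> active_nodes A q"
    then obtain t where t: "t \<in> A" "\<bar>2 ^ q * t - real_of_int j\<bar> < 1" by (auto simp: active_nodes_def)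
    then obtain i where i: "i \<in> {1..m}" "\<bar>t - x i\<bar> \<le> \<epsilon>" using assms(1) by blast
    have "\<bar>2 ^ q * t - 2 ^ q * x i\<bar> = 2 ^ q * \<bar>t - x i\<bar>"
      by (simp add: abs_mult right_diff_distrib [symmetric])
    also have "\<dots> \<le> 2 ^ q * \<epsilon>" using i(2) by simp
    finally have "\<bar>2 ^ q * x i - real_of_int j\<bar> < 2 ^ q * \<epsilon> + 1" using t(2) by linarith
    then show "j \<in> (\<Union>i\<in>{1..m}. ?N i)" using i(1) by blast
  qed
  have "card (active_nodes A q) \<le> card (\<Union>i\<in>{1..m}. ?N i)"
    using sub card_ints_near_le(1)[OF e0] by (intro card_mono) auto
  also have "\<dots> \<le> (\<Sum>i\<in>{1..m}. card (?N i))" by (rule card_UN_le) simp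
  finally have "real (card (active_nodes A q)) \<le> (\<Sum>i\<in>{1..m}. real (card (?N i)))"
    unfolding of_nat_sum [symmetric] by (rule of_nat_mono)
  also have "\<dots> \<le> (\<Sum>i\<in>{1..m}. 2 * (2 ^ q * \<epsilon> + 1) + 1)"
    by (intro sum_mono card_ints_near_le(2)[OF e0])
  also have "\<dots> = real m * (3 + 2 * (2 ^ q * \<epsilon>))" by (simp add: algebra_simps)
  finally show ?thesis .
qed

lemma covering_entropy_imp_covers:
  fixes A :: "real set"
  assumes "covering_entropy euclidean_metric A \<preceq> (\<lambda>n. real n powr (- \<delta>) * (log 2 (real n + 1)) powr \<theta>)"
  obtains c where "c > 0"
    and "\<And>n. n \<ge> 1 \<Longrightarrow> \<exists>x :: nat \<Rightarrow> real. A \<subseteq> (\<Union>i\<in>{1..n}. {t. \<bar>t - x i\<bar> \<le> c * rate (- \<delta>) \<theta> n})"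
proof -
  obtain c where c: "c > 0" "\<And>n. n \<ge> 1 \<Longrightarrow> covering_entropy euclidean_metric A n \<le> ennreal (c * rate (- \<delta>) \<theta> n)"
    using assms unfolding asymp_le_def rate_def by blast
  show ?thesis
  proof (rule that[of "2 * c"])
    show "2 * c > 0" using c by simp
    fix n :: nat assume n: "n \<ge> 1"
    have "covering_entropy euclidean_metric A n \<le> ennreal (c * rate (- \<delta>) \<theta> n)" by (rule c(2)[OF n])
    also have "\<dots> < ennreal (2 * c * rate (- \<delta>) \<theta> n)"
      using c(1) rate_pos[OF n] by (intro ennreal_lessI) auto
    finally obtain \<epsilon> x where e: "0 \<le> \<epsilon>" "ennreal \<epsilon> < ennreal (2 * c * rate (- \<delta>) \<theta> n)"
      "A \<subseteq> (\<Union>i\<in>{1..n}. mcball_of euclidean_metric (x i) \<epsilon>)"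
      unfolding covering_entropy_def INF_less_iff by (elim bexE CollectE conjE exE)
    have le: "\<epsilon> \<le> 2 * c * rate (- \<delta>) \<theta> n" using e(1,2) by (simp add: ennreal_less_iff)
    have "A \<subseteq> (\<Union>i\<in>{1..n}. {t. \<bar>t - x i\<bar> \<le> 2 * c * rate (- \<delta>) \<theta> n})"
    proof
      fix t assume t: "t \<in> A"
      from subsetD[OF e(3) t] obtain i where i: "i \<in> {1..n}" "t \<in> mcball_of euclidean_metric (x i) \<epsilon>"
        by (rule UN_E)
      from i(2) have "\<bar>x i - t\<bar> \<le> \<epsilon>" unfolding in_mcball_of mdist_euclidean_metric dist_real_def by (elim conjE)
      then have "\<bar>t - x i\<bar> \<le> 2 * c * rate (- \<delta>) \<theta> n" using le by linarith
      then show "t \<in> (\<Union>i\<in>{1..n}. {t. \<bar>t - x i\<bar> \<le> 2 * c * rate (- \<delta>) \<theta> n})"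
        by (intro UN_I[OF i(1)] CollectI)
    qed
    then show "\<exists>x :: nat \<Rightarrow> real. A \<subseteq> (\<Union>i\<in>{1..n}. {t. \<bar>t - x i\<bar> \<le> 2 * c * rate (- \<delta>) \<theta> n})"
      by (rule exI[of _ x])
  qed
qed

text \<open>The critical scale for \<open>n\<close> is the one where the grid width \<open>1 / 2 ^ Q\<close> is comparable with the
  assumed covering radius, so that about \<open>n\<close> nodes are active.  Below it, the number of active nodes
  decreases geometrically because \<open>A\<close> is already covered by fewer intervals of the larger length;
  above it, the trivial subdivision bound suffices.\<close>

lemma critical_scale:
  fixes \<delta> \<theta> c :: real
  assumes A: "A \<subseteq> {0..1}" and delta: "\<delta> \<ge> 1" and c: "c > 0"
    and cover: "\<And>n. n \<ge> 1 \<Longrightarrow> \<exists>x :: nat \<Rightarrow> real. A \<subseteq> (\<Union>i\<in>{1..n}. {t. \<bar>t - x i\<bar> \<le> c * rate (- \<delta>) \<theta> n})"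
  obtains C \<kappa> where "C \<ge> 1" "\<kappa> > 0"
    "\<And>n. n \<ge> 1 \<Longrightarrow> \<exists>Q. 2 powr (- real Q) \<le> rate (- \<delta>) \<theta> n \<and>
      (\<forall>q\<le>Q. real (card (active_nodes A q)) \<le> C * real n * 2 powr (- \<kappa> * (real Q - real q))) \<and>
      (\<forall>q\<ge>Q. real (card (active_nodes A q)) \<le> C * real n * 2 powr (real q - real Q))"
proof -
  (* The covering radii decay at most like n powr (- \<rho>), so that A is covered by about
     n * 2 powr (- k / \<rho>) intervals that are 2 powr k times longer than those for n. *)
  define \<rho> where "\<rho> = \<delta> + \<bar>\<theta>\<bar>"
  define \<kappa> where "\<kappa> = 1 / \<rho>"
  define K where "K = 3 + 4 * c * 3 powr \<rho>"
  let ?\<phi> = "rate (- \<delta>) \<theta>"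
  have rho: "\<rho> \<ge> 1" using delta by (simp add: \<rho>_def)
  have kappa: "\<kappa> > 0" "\<kappa> \<le> 1" "\<rho> * \<kappa> = 1" "\<kappa> * \<rho> = 1" using rho by (auto simp: \<kappa>_def)
  have K: "K \<ge> 3" using c by (simp add: K_def)
  have count: "real (card (active_nodes A q)) \<le> real m * (3 + 2 * (2 ^ q * (c * ?\<phi> m)))" if m: "m \<ge> 1" for m q
  proof -
    obtain x :: "nat \<Rightarrow> real" where "A \<subseteq> (\<Union>i\<in>{1..m}. {t. \<bar>t - x i\<bar> \<le> c * ?\<phi> m})"
      using cover[OF m] by blast
    then show ?thesis by (rule card_active_nodes_cover) (intro less_imp_le mult_pos_pos c rate_pos m)
  qed
  have ratio: "?\<phi> m \<le> ?\<phi> n * (3 * (real n / real m)) powr \<rho>" if "1 \<le> m" "m \<le> n" for m n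
    using rate_ratio[OF that, of "- \<delta>" \<theta>] delta by (simp add: \<rho>_def)
  show ?thesis
  proof (rule that[of "7 * K" \<kappa>])
    show "7 * K \<ge> 1" using K by simp
    show "\<kappa> > 0" by (rule kappa)
    fix n :: nat assume n: "n \<ge> 1"
    have trivial: "real (card (active_nodes A q)) \<le> 2 * 2 ^ q" for q
    proof -
      have "card (active_nodes A q) \<le> card {0..2 ^ q::int}"
        using active_nodes_subset[OF A] by (intro card_mono) auto
      also have "\<dots> = nat (2 ^ q + 1)" by simp
      also have "\<dots> = 2 ^ q + 1" by (simp add: nat_add_distrib nat_power_eq)
      finally have "real (card (active_nodes A q)) \<le> real (2 ^ q + 1)" by (rule of_nat_mono)
      then have "real (card (active_nodes A q)) \<le> 2 ^ q + 1" by simp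
      then show ?thesis using one_le_power[of "2::real" q] by linarith
    qed
    show "\<exists>Q. 2 powr (- real Q) \<le> ?\<phi> n \<and>
      (\<forall>q\<le>Q. real (card (active_nodes A q)) \<le> 7 * K * real n * 2 powr (- \<kappa> * (real Q - real q))) \<and>
      (\<forall>q\<ge>Q. real (card (active_nodes A q)) \<le> 7 * K * real n * 2 powr (real q - real Q))"
    proof (cases "?\<phi> n \<ge> 1")
      case True
      have "real (card (active_nodes A q)) \<le> 7 * K * real n * 2 powr real q" for q
      proof -
        have "2 * 1 \<le> 7 * K * real n" using K n by (intro mult_mono) auto
        then have "2 * 2 ^ q \<le> 7 * K * real n * (2::real) ^ q" by (intro mult_right_mono) auto
        with trivial[of q] have "real (card (active_nodes A q)) \<le> 7 * K * real n * 2 ^ q"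
          by (rule order_trans)
        then show ?thesis by (simp only: powr_realpow zero_less_numeral)
      qed
      note bound = this
      show ?thesis
      proof (intro exI[of _ 0] conjI allI impI)
        show "2 powr (- real 0) \<le> ?\<phi> n" using True by simp
        fix q
        show "real (card (active_nodes A q)) \<le> 7 * K * real n * 2 powr (real q - real 0)"
          using bound[of q] by simp
        show "real (card (active_nodes A q)) \<le> 7 * K * real n * 2 powr (- \<kappa> * (real 0 - real q))" if "q \<le> 0"
          using bound[of 0] that by simp
      qed
    next
      case False
      define Q where "Q = nat \<lceil>- log 2 (?\<phi> n)\<rceil>"
      have pos: "?\<phi> n > 0" by (rule rate_pos[OF n])
      then have "log 2 (?\<phi> n) < 0" using False by simp
      then have Q: "- log 2 (?\<phi> n) \<le> real Q" "real Q < - log 2 (?\<phi> n) + 1"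
        unfolding Q_def by linarith+
      have log_powr: "2 powr (log 2 (?\<phi> n)) = ?\<phi> n" using pos by (intro powr_log_cancel) simp_all
      have Q1: "2 powr (- real Q) \<le> ?\<phi> n"
      proof -
        have "2 powr (- real Q) \<le> 2 powr (log 2 (?\<phi> n))" using Q(1) by (intro powr_mono) auto
        then show ?thesis by (simp only: log_powr)
      qed
      have Q2: "?\<phi> n \<le> 2 * 2 powr (- real Q)"
      proof -
        have "2 powr (log 2 (?\<phi> n)) \<le> 2 powr (1 + - real Q)" using Q(2) by (intro powr_mono) auto
        moreover have "2 powr (1 + - real Q) = 2 * 2 powr (- real Q)" by (subst powr_add) simp
        ultimately show ?thesis by (simp only: log_powr)
      qed
      have low: "real (card (active_nodes A q)) \<le> 7 * K * real n * 2 powr (- \<kappa> * (real Q - real q))" if q: "q \<le> Q" for q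
      proof -
        define k where "k = real Q - real q"
        have k: "0 \<le> k" "k \<le> real Q" using q by (auto simp: k_def)
        define z where "z = real n * 2 powr (- \<kappa> * k)"
        define m where "m = nat \<lceil>z\<rceil>"
        have z0: "z > 0" using n by (simp add: z_def)
        have "2 powr (- \<kappa> * k) \<le> 2 powr 0" using kappa k by (intro powr_mono) auto
        then have "z \<le> real n * 1" unfolding z_def using n by (intro mult_left_mono) auto
        then have "z \<le> real n" by simp
        have "0 < \<lceil>z\<rceil>" "\<lceil>z\<rceil> \<le> int n" using z0 \<open>z \<le> real n\<close> by (simp_all add: ceiling_le_iff)
        then have m12: "1 \<le> m" "m \<le> n" unfolding m_def by linarith+
        have "real m = real_of_int \<lceil>z\<rceil>" using \<open>0 < \<lceil>z\<rceil>\<close> unfolding m_def by simp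
        then have m: "1 \<le> m" "m \<le> n" "z \<le> real m" "real m \<le> z + 1"
          using m12 le_of_int_ceiling[of z] ceiling_correct[of z] by linarith+
        have nm: "real n / real m \<le> 2 powr (\<kappa> * k)"
        proof -
          have "2 powr (- \<kappa> * k) * 2 powr (\<kappa> * k) = (1::real)"
            by (subst powr_add [symmetric]) simp
          then have "real n = z * 2 powr (\<kappa> * k)" by (simp only: z_def mult.assoc mult_1_right)
          also have "\<dots> \<le> real m * 2 powr (\<kappa> * k)" using m(3) by (intro mult_right_mono) auto
          finally show ?thesis using m(1) by (simp add: divide_le_eq mult.commute)
        qed
        have "?\<phi> m \<le> ?\<phi> n * (3 * (real n / real m)) powr \<rho>" by (rule ratio[OF m(1,2)])
        also have "\<dots> \<le> (2 * 2 powr (- real Q)) * (3 * 2 powr (\<kappa> * k)) powr \<rho>"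
          using Q2 nm rho pos m by (intro mult_mono powr_mono2) auto
        also have "(3 * 2 powr (\<kappa> * k)) powr \<rho> = 3 powr \<rho> * 2 powr k"
        proof -
          have "\<kappa> * k * \<rho> = k" using kappa(3) by (simp add: mult_ac)
          then show ?thesis by (simp only: powr_mult powr_powr)
        qed
        also have "2 * 2 powr (- real Q) * (3 powr \<rho> * 2 powr k) = 2 * 3 powr \<rho> * 2 powr (- real Q + k)"
          by (simp only: powr_add mult_ac)
        also have "- real Q + k = - real q" by (simp add: k_def)
        finally have "2 ^ q * (c * ?\<phi> m) \<le> 2 ^ q * (c * (2 * 3 powr \<rho> * 2 powr (- real q)))"
          using c by (intro mult_left_mono) auto
        also have "\<dots> = 2 * c * 3 powr \<rho>"
          by (simp add: powr_minus powr_realpow)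
        finally have "3 + 2 * (2 ^ q * (c * ?\<phi> m)) \<le> K" unfolding K_def by linarith
        then have "real m * (3 + 2 * (2 ^ q * (c * ?\<phi> m))) \<le> real m * K" by (intro mult_left_mono) auto
        with count[OF m(1), of q] have cardm: "real (card (active_nodes A q)) \<le> real m * K" by linarith
        (* Rounding z up to an integer costs only a constant factor. *)
        have "1 \<le> 6 * z"
        proof -
          have "1 = ?\<phi> 1" by (simp add: rate_def)
          also have "\<dots> \<le> ?\<phi> n * (3 * (real n / real 1)) powr \<rho>" using n by (intro ratio) auto
          also have "\<dots> \<le> (2 * 2 powr (- real Q)) * (3 * real n) powr \<rho>"
            using Q2 by (simp add: mult_right_mono)
          finally have "1 \<le> (2 * 2 powr (- real Q)) * (3 * real n) powr \<rho>" .
          then have "1 powr \<kappa> \<le> ((2 * 2 powr (- real Q)) * (3 * real n) powr \<rho>) powr \<kappa>"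
            using kappa by (intro powr_mono2) auto
          also have "\<dots> = (2 powr \<kappa> * (2 powr (- real Q)) powr \<kappa>) * ((3 * real n) powr \<rho>) powr \<kappa>"
            by (simp only: powr_mult[of "2 * 2 powr (- real Q)"] powr_mult[of 2 "2 powr (- real Q)"])
          also have "((3 * real n) powr \<rho>) powr \<kappa> = 3 * real n"
            using n by (simp only: powr_powr kappa(3)) simp
          also have "(2 powr (- real Q)) powr \<kappa> = 2 powr (- \<kappa> * real Q)"
            by (simp add: powr_powr mult.commute)
          finally have "1 \<le> 2 powr \<kappa> * 2 powr (- \<kappa> * real Q) * (3 * real n)" by simp
          also have "\<dots> \<le> 2 * 2 powr (- \<kappa> * k) * (3 * real n)"
          proof (rule mult_right_mono, rule mult_mono)
            show "2 powr \<kappa> \<le> (2::real)" using powr_mono[of \<kappa> 1 2] kappa by simp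
            have "\<kappa> * k \<le> \<kappa> * real Q" using kappa k by (intro mult_left_mono) auto
            then show "2 powr (- \<kappa> * real Q) \<le> (2::real) powr (- \<kappa> * k)" by (intro powr_mono) simp_all
          qed simp_all
          also have "\<dots> = 6 * z"
          proof -
            have "2 * P * (3 * N) = 6 * (N * P)" for P N :: real by simp
            then show ?thesis unfolding z_def .
          qed
          finally show ?thesis .
        qed
        then have "real m \<le> 7 * z" using m(4) by simp
        then have "real m * K \<le> 7 * z * K" using K by (intro mult_right_mono) auto
        also have "\<dots> = 7 * K * real n * 2 powr (- \<kappa> * (real Q - real q))"
          unfolding z_def k_def by (simp only: mult_ac)
        finally show ?thesis using cardm by linarith
      qed
      have high: "real (card (active_nodes A q)) \<le> 7 * K * real n * 2 powr (real q - real Q)" if q: "Q \<le> q" for q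
      proof -
        have "2 ^ q * (c * ?\<phi> n) \<le> 2 ^ q * (c * (2 * 2 powr (- real Q)))"
          using Q2 c by (intro mult_left_mono) auto
        also have "\<dots> = 2 * c * (2 ^ q * 2 powr (- real Q))" by simp
        also have "2 ^ q * 2 powr (- real Q) = 2 powr (real q - real Q)"
          using powr_add[of 2 "real q" "- real Q"] by (simp add: powr_realpow)
        finally have e: "2 ^ q * (c * ?\<phi> n) \<le> 2 * c * 2 powr (real q - real Q)" .
        have p1: "1 \<le> 2 powr (real q - real Q)" using q by (intro ge_one_powr_ge_zero) auto
        have "3 + 2 * (2 ^ q * (c * ?\<phi> n)) \<le> 3 * 2 powr (real q - real Q) + 4 * c * 2 powr (real q - real Q)"
          using e p1 by linarith
        also have "\<dots> = (3 + 4 * c * 1) * 2 powr (real q - real Q)" by (simp add: algebra_simps)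
        also have "\<dots> \<le> (7 * K) * 2 powr (real q - real Q)"
        proof (intro mult_right_mono)
          have "4 * c * 1 \<le> 4 * c * 3 powr \<rho>" using c rho by (intro mult_left_mono ge_one_powr_ge_zero) auto
          then show "3 + 4 * c * 1 \<le> 7 * K" using K by (simp add: K_def)
        qed simp
        finally have "real n * (3 + 2 * (2 ^ q * (c * ?\<phi> n))) \<le> real n * ((7 * K) * 2 powr (real q - real Q))"
          by (intro mult_left_mono) auto
        also have "\<dots> = 7 * K * real n * 2 powr (real q - real Q)" by (simp only: mult_ac)
        finally show ?thesis using count[OF n, of q] by linarith
      qed
      show ?thesis using Q1 low high by blast
    qed
  qed
qed

section \<open>Covering and approximating a single level\<close>

lemma sum_fun_at: "(\<Sum>i\<in>S. F i) x = (\<Sum>i\<in>S. F i x)"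
  for F :: "'i \<Rightarrow> 'a \<Rightarrow> 'b::comm_monoid_add"
  by (induction S rule: infinite_finite_induct) auto

lemma lincomb_at: "(\<Sum>i\<in>S. c i *\<^sub>R F i) x = (\<Sum>i\<in>S. c i * F i x)"
  for F :: "'i \<Rightarrow> 'a \<Rightarrow> real"
  unfolding sum_fun_at by simp

text \<open>Coefficients in an \<open>l\<^sub>p\<close> ball of radius \<open>R\<close> are rounded towards \<open>0\<close> to multiples of the mesh
  size \<open>\<tau>\<close>.  The resulting integer vectors have \<open>l\<^sub>1\<close> norm at most \<open>(R / \<tau>) powr p\<close>, because
  \<open>\<bar>z\<bar> \<le> \<bar>z\<bar> powr p\<close> for integers.\<close>

lemma quantize_level:
  fixes \<psi> :: "'i \<Rightarrow> real \<Rightarrow> real" and p R \<tau> \<mu> :: real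
  assumes I: "finite I" and psi: "\<And>r. r \<in> I \<Longrightarrow> \<psi> r \<in> vecs (C_space A)"
    and sum_psi: "\<And>t. t \<in> A \<Longrightarrow> (\<Sum>r\<in>I. \<bar>\<psi> r t\<bar>) \<le> B"
    and p: "p \<ge> 1" and tau: "\<tau> > 0" and mu: "\<mu> > 0" and R: "R \<ge> 0"
  shows "\<exists>Z. finite Z \<and> Z \<subseteq> vecs (C_space A)
    \<and> real (card Z) \<le> exp (\<mu> * (R / \<tau>) powr p) * (1 + 2 / (exp \<mu> - 1)) ^ card I
    \<and> (\<forall>c. (\<Sum>r\<in>I. \<bar>c r\<bar> powr p) \<le> R powr p \<longrightarrow> (\<exists>h\<in>Z. \<forall>t\<in>A. \<bar>(\<Sum>r\<in>I. c r * \<psi> r t) - h t\<bar> \<le> B * \<tau>))"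
proof -
  let ?L = "lattice_ball I ((R / \<tau>) powr p)"
  let ?H = "\<lambda>z. \<Sum>r\<in>I. (\<tau> * real_of_int (z r)) *\<^sub>R \<psi> r"
  note L = card_lattice_ball(1,2)[OF I mu, of "(R / \<tau>) powr p"]
  have "?H ` ?L \<subseteq> vecs (C_space A)"
    using psi by (auto intro!: subspace_sum[OF subspace_C_space] subspace_scale[OF subspace_C_space])
  moreover have "real (card (?H ` ?L)) \<le> exp (\<mu> * (R / \<tau>) powr p) * (1 + 2 / (exp \<mu> - 1)) ^ card I"
    using card_image_le[OF L(1), of ?H] L(2) by linarith
  moreover have "\<exists>h\<in>?H ` ?L. \<forall>t\<in>A. \<bar>(\<Sum>r\<in>I. c r * \<psi> r t) - h t\<bar> \<le> B * \<tau>"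
    if c: "(\<Sum>r\<in>I. \<bar>c r\<bar> powr p) \<le> R powr p" for c
  proof -
    define z where "z = (\<lambda>r. if r \<in> I then trunc (c r / \<tau>) else 0)"
    have int_le: "\<bar>real_of_int k\<bar> \<le> \<bar>real_of_int k\<bar> powr p" for k :: int
    proof (cases "k = 0")
      case False
      then have "1 \<le> \<bar>real_of_int k\<bar>" by linarith
      then have "\<bar>real_of_int k\<bar> powr 1 \<le> \<bar>real_of_int k\<bar> powr p" using p by (intro powr_mono) auto
      then show ?thesis by simp
    qed simp
    have "(\<Sum>r\<in>I. \<bar>real_of_int (z r)\<bar>) \<le> (\<Sum>r\<in>I. \<bar>c r\<bar> powr p / \<tau> powr p)"
    proof (rule sum_mono)
      fix r assume "r \<in> I"
      then have "\<bar>real_of_int (z r)\<bar> \<le> \<bar>real_of_int (trunc (c r / \<tau>))\<bar> powr p"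
        using int_le by (simp add: z_def)
      also have "\<dots> \<le> \<bar>c r / \<tau>\<bar> powr p" using p by (intro powr_mono2 abs_trunc_le) auto
      also have "\<dots> = \<bar>c r\<bar> powr p / \<tau> powr p" using tau by (simp add: powr_divide)
      finally show "\<bar>real_of_int (z r)\<bar> \<le> \<bar>c r\<bar> powr p / \<tau> powr p" .
    qed
    also have "\<dots> \<le> R powr p / \<tau> powr p"
      unfolding sum_divide_distrib [symmetric] using c by (intro divide_right_mono) auto
    also have "\<dots> = (R / \<tau>) powr p" using tau R by (simp add: powr_divide)
    finally have "z \<in> ?L" by (simp add: lattice_ball_def z_def)
    moreover have "\<bar>(\<Sum>r\<in>I. c r * \<psi> r t) - ?H z t\<bar> \<le> B * \<tau>" if t: "t \<in> A" for t
    proof -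
      have "(\<Sum>r\<in>I. c r * \<psi> r t) - ?H z t = (\<Sum>r\<in>I. (c r - \<tau> * real_of_int (z r)) * \<psi> r t)"
        unfolding lincomb_at by (simp only: left_diff_distrib sum_subtractf)
      also have "\<bar>\<dots>\<bar> \<le> (\<Sum>r\<in>I. \<tau> * \<bar>\<psi> r t\<bar>)"
      proof (rule order_trans[OF sum_abs], rule sum_mono)
        fix r assume r: "r \<in> I"
        have "c r - \<tau> * real_of_int (z r) = \<tau> * (c r / \<tau> - real_of_int (trunc (c r / \<tau>)))"
          using tau r by (simp add: z_def right_diff_distrib)
        then have "\<bar>c r - \<tau> * real_of_int (z r)\<bar> = \<tau> * \<bar>c r / \<tau> - real_of_int (trunc (c r / \<tau>))\<bar>"
          using tau by (simp add: abs_mult)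
        also have "\<dots> \<le> \<tau> * 1" using tau by (intro mult_left_mono abs_diff_trunc_le) auto
        finally show "\<bar>(c r - \<tau> * real_of_int (z r)) * \<psi> r t\<bar> \<le> \<tau> * \<bar>\<psi> r t\<bar>"
          unfolding abs_mult by (intro mult_right_mono) auto
      qed
      also have "\<dots> = \<tau> * (\<Sum>r\<in>I. \<bar>\<psi> r t\<bar>)" by (simp only: sum_distrib_left)
      also have "\<dots> \<le> \<tau> * B" using tau by (intro mult_left_mono sum_psi t) auto
      finally show ?thesis by (simp only: mult.commute)
    qed
    ultimately show ?thesis by (intro bexI[of _ "?H z"] ballI) auto
  qed
  ultimately show ?thesis using L(1) by (intro exI[of _ "?H ` ?L"] conjI allI impI) simp_all
qed

text \<open>The approximation of the Euclidean ball is transported to functions: sup-norm errors of the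
  coefficients become uniform errors because \<open>\<Sum>r. \<bar>\<psi> r t\<bar>\<close> is bounded.\<close>

lemma low_dimensional_level:
  fixes \<psi> :: "'i \<Rightarrow> real \<Rightarrow> real" and R \<mu> :: real and d m :: nat
  assumes I: "finite I" and psi: "\<And>r. r \<in> I \<Longrightarrow> \<psi> r \<in> vecs (C_space A)"
    and sum_psi: "\<And>t. t \<in> A \<Longrightarrow> (\<Sum>r\<in>I. \<bar>\<psi> r t\<bar>) \<le> B"
    and d: "d \<ge> 1" and mu: "\<mu> > 0" and R: "R > 0"
    and m: "98304 * (2 * \<mu> * (real d)\<^sup>2 + 4 / (exp \<mu> - 1) * real (card I) + 1) \<le> real m"
  shows "\<exists>W. finite W \<and> W \<subseteq> vecs (C_space A) \<and> card W \<le> m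
    \<and> (\<forall>c. (\<Sum>r\<in>I. (c r)\<^sup>2) \<le> R\<^sup>2 \<longrightarrow> (\<exists>h\<in>span W. \<forall>t\<in>A. \<bar>(\<Sum>r\<in>I. c r * \<psi> r t) - h t\<bar> \<le> B * (R * 4 / real d)))"
proof -
  obtain w :: "nat \<Rightarrow> 'i \<Rightarrow> real" where w: "\<And>x. (\<Sum>i\<in>I. (x i)\<^sup>2) \<le> 1 \<Longrightarrow>
      \<exists>y. \<forall>i\<in>I. \<bar>x i - (\<Sum>l<m. y l * w l i)\<bar> \<le> 4 / real d"
    using euclidean_ball_sup_norm_approximation[OF I d mu m] by blast
  define F where "F = (\<lambda>l. \<Sum>r\<in>I. w l r *\<^sub>R \<psi> r)"
  have "F ` {..<m} \<subseteq> vecs (C_space A)"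
    unfolding F_def using psi by (auto intro!: subspace_sum[OF subspace_C_space] subspace_scale[OF subspace_C_space])
  moreover have "card (F ` {..<m}) \<le> m" using card_image_le[of "{..<m}" F] by simp
  moreover have "\<exists>h\<in>span (F ` {..<m}). \<forall>t\<in>A. \<bar>(\<Sum>r\<in>I. c r * \<psi> r t) - h t\<bar> \<le> B * (R * 4 / real d)"
    if c: "(\<Sum>r\<in>I. (c r)\<^sup>2) \<le> R\<^sup>2" for c
  proof -
    have "(\<Sum>r\<in>I. (c r / R)\<^sup>2) = (\<Sum>r\<in>I. (c r)\<^sup>2) / R\<^sup>2"
      by (simp add: power_divide sum_divide_distrib)
    also have "\<dots> \<le> 1" using c R by simp
    finally obtain y where y: "\<And>i. i \<in> I \<Longrightarrow> \<bar>c i / R - (\<Sum>l<m. y l * w l i)\<bar> \<le> 4 / real d"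
      using w[of "\<lambda>r. c r / R"] by auto
    define h where "h = (\<Sum>l<m. (R * y l) *\<^sub>R F l)"
    have "h \<in> span (F ` {..<m})"
      unfolding h_def by (intro span_sum span_scale span_base) auto
    moreover have "\<bar>(\<Sum>r\<in>I. c r * \<psi> r t) - h t\<bar> \<le> B * (R * 4 / real d)" if t: "t \<in> A" for t
    proof -
      have "h t = (\<Sum>l<m. \<Sum>r\<in>I. R * y l * (w l r * \<psi> r t))"
        unfolding h_def F_def lincomb_at by (simp only: sum_distrib_left)
      also have "\<dots> = (\<Sum>r\<in>I. R * (\<Sum>l<m. y l * w l r) * \<psi> r t)"
        by (subst sum.swap) (simp only: sum_distrib_left sum_distrib_right mult.assoc)
      finally have "(\<Sum>r\<in>I. c r * \<psi> r t) - h t = (\<Sum>r\<in>I. (c r - R * (\<Sum>l<m. y l * w l r)) * \<psi> r t)"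
        by (simp only: left_diff_distrib sum_subtractf)
      also have "\<bar>\<dots>\<bar> \<le> (\<Sum>r\<in>I. (R * 4 / real d) * \<bar>\<psi> r t\<bar>)"
      proof (rule order_trans[OF sum_abs], rule sum_mono)
        fix r assume r: "r \<in> I"
        have "c r - R * (\<Sum>l<m. y l * w l r) = R * (c r / R - (\<Sum>l<m. y l * w l r))"
          using R by (simp add: right_diff_distrib)
        then have "\<bar>c r - R * (\<Sum>l<m. y l * w l r)\<bar> = R * \<bar>c r / R - (\<Sum>l<m. y l * w l r)\<bar>"
          using R by (simp add: abs_mult)
        also have "\<dots> \<le> R * (4 / real d)" using R by (intro mult_left_mono y r) auto
        finally have "\<bar>c r - R * (\<Sum>l<m. y l * w l r)\<bar> \<le> R * 4 / real d" by simp
        then show "\<bar>(c r - R * (\<Sum>l<m. y l * w l r)) * \<psi> r t\<bar> \<le> (R * 4 / real d) * \<bar>\<psi> r t\<bar>"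
          unfolding abs_mult by (intro mult_right_mono) auto
      qed
      also have "\<dots> = (R * 4 / real d) * (\<Sum>r\<in>I. \<bar>\<psi> r t\<bar>)" by (simp only: sum_distrib_left)
      also have "\<dots> \<le> (R * 4 / real d) * B" using R by (intro mult_left_mono sum_psi t) auto
      finally show ?thesis by (simp only: mult.commute)
    qed
    ultimately show ?thesis by blast
  qed
  ultimately show ?thesis by (intro exI[of _ "F ` {..<m}"] conjI allI impI) simp_all
qed

lemma sum_two_sided_geometric:
  fixes \<mu> :: real
  assumes mu: "\<mu> > 0"
  obtains S where "S \<ge> 1"
    and "\<And>K Q. (\<Sum>q\<le>K. (1 + \<bar>real q - real Q\<bar>) * 2 powr (- \<mu> * \<bar>real q - real Q\<bar>)) \<le> S"
proof -
  define x :: real where "x = 2 powr (- \<mu>)"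
  have x: "0 \<le> x" "x < 1" using mu powr_less_mono[of "- \<mu>" 0 2] by (auto simp: x_def)
  define f where "f = (\<lambda>n. real (Suc n) * x ^ n)"
  have sm: "summable f"
    using geometric_deriv_sums[of x] x by (auto simp: f_def sums_iff)
  have f0: "f n \<ge> 0" for n using x by (simp add: f_def)
  have summand: "(1 + \<bar>real q - real Q\<bar>) * 2 powr (- \<mu> * \<bar>real q - real Q\<bar>) = f (q - Q) * (if Q \<le> q then 1 else 0) + f (Q - q) * (if Q \<le> q then 0 else 1)"
    for q Q :: nat
  proof -
    have pw: "2 powr (- \<mu> * real n) = x ^ n" for n
    proof -
      have "x > 0" by (simp add: x_def)
      then have "x ^ n = x powr real n" by (rule powr_realpow [symmetric])
      then show ?thesis by (simp only: x_def powr_powr)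
    qed
    show ?thesis
    proof (cases "Q \<le> q")
      case True
      then have "\<bar>real q - real Q\<bar> = real (q - Q)" by (simp add: of_nat_diff)
      then show ?thesis using True by (simp only: pw f_def) simp
    next
      case False
      then have "\<bar>real q - real Q\<bar> = real (Q - q)" by (simp add: of_nat_diff)
      then show ?thesis using False by (simp only: pw f_def) simp
    qed
  qed
  have part: "(\<Sum>q\<in>J. f (h q)) \<le> suminf f" if "finite J" "inj_on h J" for J :: "nat set" and h
  proof -
    have "(\<Sum>q\<in>J. f (h q)) = sum f (h ` J)" using that by (simp add: sum.reindex)
    also have "\<dots> \<le> suminf f" using that f0 by (intro sum_le_suminf[OF sm]) auto
    finally show ?thesis .
  qed
  have "(\<Sum>q\<le>K. (1 + \<bar>real q - real Q\<bar>) * 2 powr (- \<mu> * \<bar>real q - real Q\<bar>)) \<le> 2 * suminf f + 1" for K Q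
  proof -
    have "(\<Sum>q\<le>K. (1 + \<bar>real q - real Q\<bar>) * 2 powr (- \<mu> * \<bar>real q - real Q\<bar>))
        = (\<Sum>q\<le>K. f (q - Q) * (if Q \<le> q then 1 else 0)) + (\<Sum>q\<le>K. f (Q - q) * (if Q \<le> q then 0 else 1))"
      unfolding summand sum.distrib ..
    also have "(\<Sum>q\<le>K. f (q - Q) * (if Q \<le> q then 1 else 0)) = (\<Sum>q\<in>{q\<in>{..K}. Q \<le> q}. f (q - Q))"
      by (simp only: if_distrib[of "\<lambda>x. _ * x"] mult_1_right mult_zero_right sum.inter_filter[OF finite_atMost])
    also have "(\<Sum>q\<le>K. f (Q - q) * (if Q \<le> q then 0 else 1)) = (\<Sum>q\<in>{q\<in>{..K}. \<not> Q \<le> q}. f (Q - q))"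
      by (subst sum.inter_filter) (auto intro!: sum.cong)
    also have "(\<Sum>q\<in>{q\<in>{..K}. Q \<le> q}. f (q - Q)) \<le> suminf f"
      by (intro part) (auto simp: inj_on_def)
    also have "(\<Sum>q\<in>{q\<in>{..K}. \<not> Q \<le> q}. f (Q - q)) \<le> suminf f"
      by (intro part) (auto simp: inj_on_def)
    finally show ?thesis by simp
  qed
  moreover have "2 * suminf f + 1 \<ge> 1" using suminf_nonneg[OF sm f0] by simp
  ultimately show ?thesis using that by blast
qed

section \<open>Balancing the levels\<close>

text \<open>All that remains of the operator after the multiscale expansion: \<open>V\<close> is the image of the unit ball,
  and the \<open>\<psi> q r\<close> turn sup-norm errors of the coefficients of a level into uniform errors on \<open>A\<close>.\<close>

locale level_system =
  fixes A :: "real set" and p s B :: real and I :: "nat \<Rightarrow> 'i set"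
    and \<psi> :: "nat \<Rightarrow> 'i \<Rightarrow> real \<Rightarrow> real" and V :: "(real \<Rightarrow> real) set"
  assumes p: "p \<ge> 1" and s: "s > 0" and B: "B \<ge> 1"
    and finite_I: "finite (I q)"
    and psi_C: "r \<in> I q \<Longrightarrow> \<psi> q r \<in> vecs (C_space A)"
    and sum_psi: "t \<in> A \<Longrightarrow> (\<Sum>r\<in>I q. \<bar>\<psi> q r t\<bar>) \<le> B"
    and expand: "g \<in> V \<Longrightarrow> \<exists>c. (\<forall>q. (\<Sum>r\<in>I q. \<bar>c q r\<bar> powr p) \<le> (B * 2 powr (- s * real q)) powr p) \<and>
      (\<forall>K. \<forall>t\<in>A. \<bar>g t - (\<Sum>q\<le>K. \<Sum>r\<in>I q. c q r * \<psi> q r t)\<bar> \<le> B * 2 powr (- s * real K))"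
begin

abbreviation gap :: "nat \<Rightarrow> nat \<Rightarrow> real"
  where "gap q Q \<equiv> \<bar>real q - real Q\<bar>"

abbreviation decay :: "real \<Rightarrow> nat \<Rightarrow> nat \<Rightarrow> real"
  where "decay \<mu> q Q \<equiv> (1 + gap q Q) * 2 powr (- \<mu> * gap q Q)"

text \<open>The error to be achieved with about \<open>n\<close> bits or dimensions if \<open>Q\<close> is the level with about \<open>n\<close>
  coefficients.\<close>

abbreviation radius :: "nat \<Rightarrow> nat \<Rightarrow> real"
  where "radius n Q \<equiv> real n powr (- 1 / p) * 2 powr (- s * real Q)"

abbreviation level_sum :: "nat \<Rightarrow> ('i \<Rightarrow> real) \<Rightarrow> real \<Rightarrow> real"
  where "level_sum q c t \<equiv> (\<Sum>r\<in>I q. c r * \<psi> q r t)"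

abbreviation level_ball :: "nat \<Rightarrow> ('i \<Rightarrow> real) \<Rightarrow> bool"
  where "level_ball q c \<equiv> (\<Sum>r\<in>I q. \<bar>c r\<bar> powr p) \<le> (B * 2 powr (- s * real q)) powr p"

definition sizes_bounded :: "real \<Rightarrow> real \<Rightarrow> nat \<Rightarrow> nat \<Rightarrow> bool"
  where "sizes_bounded C \<kappa> n Q \<longleftrightarrow>
    (\<forall>q\<le>Q. real (card (I q)) \<le> C * real n * 2 powr (- \<kappa> * (real Q - real q))) \<and>
    (\<forall>q\<ge>Q. real (card (I q)) \<le> C * real n * 2 powr (real q - real Q))"

lemma two_powr_le_exp: "0 \<le> x \<Longrightarrow> 2 powr x \<le> exp x" for x :: real
proof -
  assume "0 \<le> x"
  have "ln (2::real) \<le> 1" using ln_le_minus_one[of "2::real"] by simp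
  then have "x * ln 2 \<le> x * 1" using \<open>0 \<le> x\<close> by (intro mult_left_mono) auto
  then show ?thesis by (simp add: powr_def)
qed

lemma ln_one_plus_powr_le:
  fixes k :: real
  assumes "k \<ge> 0"
  shows "ln (1 + 2 powr (2 * k)) > 0" "ln (1 + 2 powr (2 * k)) \<le> 1 + 2 * k"
    "exp (ln (1 + 2 powr (2 * k))) - 1 = 2 powr (2 * k)"
proof -
  have pos: "2 powr (2 * k) > (0::real)" by simp
  show "ln (1 + 2 powr (2 * k)) > 0" using pos by (intro ln_gt_zero) linarith
  have "1 \<le> 2 powr (2 * k)" using assms by (intro ge_one_powr_ge_zero) auto
  then have "1 + 2 powr (2 * k) \<le> 2 powr (2 * k) + 2 powr (2 * k)" by simp
  also have "\<dots> \<le> exp (2 * k) + exp (2 * k)" using assms by (intro add_mono two_powr_le_exp) auto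
  also have "\<dots> = 2 * exp (2 * k)" by simp
  also have "\<dots> \<le> exp 1 * exp (2 * k)"
    using exp_ge_add_one_self[of 1] by (intro mult_right_mono) auto
  finally have "1 + 2 powr (2 * k) \<le> exp (1 + 2 * k)" by (simp only: exp_add)
  then have "ln (1 + 2 powr (2 * k)) \<le> ln (exp (1 + 2 * k))"
    using pos by (subst ln_le_cancel_iff) (auto intro: add_pos_pos)
  then show "ln (1 + 2 powr (2 * k)) \<le> 1 + 2 * k" by (simp only: ln_exp)
  show "exp (ln (1 + 2 powr (2 * k))) - 1 = 2 powr (2 * k)"
    using pos by (subst exp_ln) linarith+
qed

lemma weaken_decay:
  fixes \<mu> \<nu> k :: real
  assumes "\<mu> \<le> \<nu>" "0 \<le> k"
  shows "2 powr (- \<nu> * k) \<le> 2 powr (- \<mu> * k)"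
proof -
  have "\<mu> * k \<le> \<nu> * k" using assms by (intro mult_right_mono) auto
  then show ?thesis by (intro powr_mono) auto
qed

text \<open>The mesh size at level \<open>q\<close> decreases away from the critical level, slowly enough for the
  entropies to decrease geometrically as well: below \<open>Q\<close> since there are few coefficients, above \<open>Q\<close>
  since almost all of them are rounded to \<open>0\<close>.\<close>

lemma entropy_of_level:
  assumes kappa: "\<kappa> > 0" and C: "C \<ge> 1"
  obtains D \<mu> where "D > 0" "\<mu> > 0"
    and "\<And>n Q q. n \<ge> 1 \<Longrightarrow> sizes_bounded C \<kappa> n Q \<Longrightarrow>
      \<exists>Z. finite Z \<and> Z \<subseteq> vecs (C_space A)
      \<and> real (card Z) \<le> exp (real n * (D * (decay \<mu> q Q)))
      \<and> (\<forall>c. level_ball q c \<longrightarrow>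
          (\<exists>h\<in>Z. \<forall>t\<in>A. \<bar>level_sum q c t - h t\<bar>
             \<le> B * (radius n Q * 2 powr (- (s / 2) * gap q Q))))"
proof -
  define E where "E = B powr p"
  define b where "b = 3 / 2 * (p * s) + \<kappa>"
  define D where "D = 2 * E + 2 * C + b * C"
  define \<mu> where "\<mu> = min \<kappa> (min (p * s / 2) 1)"
  have E: "E \<ge> 0" by (simp add: E_def)
  have b: "b > 0" using p s kappa by (simp add: b_def add_pos_pos)
  have bC: "b * C > 0" using b C by simp
  have D: "D > 0" using E C bC by (simp add: D_def)
  have mu: "\<mu> > 0" "\<mu> \<le> \<kappa>" "\<mu> \<le> p * s / 2" "\<mu> \<le> 1" using kappa p s by (auto simp: \<mu>_def)
  show ?thesis
  proof (rule that[OF D mu(1)])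
    fix n Q q :: nat
    assume n: "n \<ge> 1" and sizes: "sizes_bounded C \<kappa> n Q"
    define k where "k = \<bar>real q - real Q\<bar>"
    have k: "k \<ge> 0" by (simp add: k_def)
    define \<tau> where "\<tau> = radius n Q * 2 powr (- (s / 2) * k)"
    define R where "R = B * 2 powr (- s * real q)"
    define M where "M = real (card (I q))"
    have tau: "\<tau> > 0" using n by (simp add: \<tau>_def)
    have R: "R \<ge> 0" using B by (simp add: R_def)
    have T: "(R / \<tau>) powr p = E * real n * 2 powr (p * (s * (real Q - real q) + s / 2 * k))"
    proof -
      have "B * real n powr (1 / p) * 2 powr (s * (real Q - real q) + s / 2 * k) * \<tau>
          = B * (real n powr (1 / p) * real n powr (- 1 / p))
            * (2 powr (s * (real Q - real q) + s / 2 * k) * 2 powr (- s * real Q) * 2 powr (- (s / 2) * k))"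
        unfolding \<tau>_def by (simp only: mult_ac)
      also have "real n powr (1 / p) * real n powr (- 1 / p) = 1"
        using n by (subst powr_add [symmetric]) simp
      also have "2 powr (s * (real Q - real q) + s / 2 * k) * 2 powr (- s * real Q) * 2 powr (- (s / 2) * k)
          = 2 powr (- s * real q)"
        by (subst powr_add [symmetric])+ (simp add: algebra_simps)
      finally have "R = B * real n powr (1 / p) * 2 powr (s * (real Q - real q) + s / 2 * k) * \<tau>"
        by (simp only: R_def mult_1_right)
      then have "R / \<tau> = B * real n powr (1 / p) * 2 powr (s * (real Q - real q) + s / 2 * k)"
        using tau by simp
      then have "(R / \<tau>) powr p
          = B powr p * (real n powr (1 / p)) powr p * (2 powr (s * (real Q - real q) + s / 2 * k)) powr p"
        by (simp only: powr_mult)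
      also have "(real n powr (1 / p)) powr p = real n"
        using n p by (simp add: powr_powr)
      also have "(2 powr (s * (real Q - real q) + s / 2 * k)) powr p = 2 powr (p * (s * (real Q - real q) + s / 2 * k))"
        by (simp only: powr_powr mult.commute)
      finally show ?thesis by (simp only: E_def)
    qed
    let ?bound = "real n * (D * ((1 + k) * 2 powr (- \<mu> * k)))"
    (* The parameter of the counting bound: below Q it is so small that each coefficient gets about
       b * k bits, above Q it is about 2 * k, since the number of coefficients grows like 2 powr k
       but the number of nonzero integer entries decreases. *)
    obtain \<nu> where l: "\<nu> > 0"
      "exp (\<nu> * (R / \<tau>) powr p) * (1 + 2 / (exp \<nu> - 1)) ^ card (I q) \<le> exp ?bound"
    proof (cases "q \<le> Q")
      case True
      then have kq: "k = real Q - real q" by (simp add: k_def)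
      define l where "l = 2 powr (- b * k)"
      have l0: "l > 0" by (simp add: l_def)
      have l1: "l \<le> 1" using weaken_decay[of 0 b k] b k by (simp add: l_def)
      have lT: "l * (R / \<tau>) powr p = E * real n * 2 powr (- \<kappa> * k)"
      proof -
        have "l * (R / \<tau>) powr p = E * real n * (2 powr (- b * k) * 2 powr (p * (s * k + s / 2 * k)))"
          unfolding T kq [symmetric] l_def by (simp only: mult_ac)
        also have "2 powr (- b * k) * 2 powr (p * (s * k + s / 2 * k)) = 2 powr (- \<kappa> * k)"
          by (subst powr_add [symmetric]) (simp add: b_def algebra_simps)
        finally show ?thesis .
      qed
      have M: "M \<le> C * real n * 2 powr (- \<kappa> * k)"
        using sizes True unfolding sizes_bounded_def M_def kq by blast
      have fac: "1 + 2 / (exp l - 1) \<le> exp (2 + b * k)"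
      proof -
        have "l \<le> exp l - 1" using exp_ge_add_one_self[of l] by linarith
        then have "2 / (exp l - 1) \<le> 2 / l" using l0 by (intro divide_left_mono) auto
        moreover have "1 \<le> 1 / l" using l0 l1 by simp
        ultimately have "1 + 2 / (exp l - 1) \<le> 3 * (1 / l)" by simp
        also have "1 / l = 2 powr (b * k)"
          unfolding l_def by (simp add: powr_minus_divide)
        also have "3 * 2 powr (b * k) \<le> exp 2 * exp (b * k)"
          using exp_ge_add_one_self[of 2] b k by (intro mult_mono two_powr_le_exp) auto
        finally show ?thesis by (simp only: exp_add)
      qed
      have "1 + 2 / (exp l - 1) \<ge> 0" using l0 by simp
      then have "(1 + 2 / (exp l - 1)) ^ card (I q) \<le> exp (2 + b * k) ^ card (I q)"
        using fac by (intro power_mono) auto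
      also have "\<dots> = exp (M * (2 + b * k))" by (simp only: M_def exp_of_nat_mult)
      also have "\<dots> \<le> exp (C * real n * 2 powr (- \<kappa> * k) * (2 + b * k))"
        using M b k by (simp add: mult_right_mono)
      finally have "exp (l * (R / \<tau>) powr p) * (1 + 2 / (exp l - 1)) ^ card (I q)
          \<le> exp (E * real n * 2 powr (- \<kappa> * k)) * exp (C * real n * 2 powr (- \<kappa> * k) * (2 + b * k))"
        unfolding lT by (intro mult_left_mono) auto
      also have "\<dots> = exp (real n * ((E + 2 * C + b * C * k) * 2 powr (- \<kappa> * k)))"
        unfolding exp_add [symmetric] by (simp add: algebra_simps)
      also have "\<dots> \<le> exp (real n * (D * (1 + k) * 2 powr (- \<mu> * k)))"
      proof -
        have "E + 2 * C + b * C * k \<le> D * 1 + D * k"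
        proof (intro add_mono mult_right_mono k)
          show "E + 2 * C \<le> D * 1" "b * C \<le> D" using E C bC by (auto simp: D_def)
        qed
        then have "E + 2 * C + b * C * k \<le> D * (1 + k)" by (simp add: algebra_simps)
        then have "(E + 2 * C + b * C * k) * 2 powr (- \<kappa> * k) \<le> D * (1 + k) * 2 powr (- \<mu> * k)"
          using D k weaken_decay[OF mu(2) k] by (intro mult_mono) auto
        then show ?thesis by (simp add: mult_left_mono)
      qed
      finally show ?thesis using that[OF l0] by (simp only: mult.assoc)
    next
      case False
      then have kq: "k = real q - real Q" by (simp add: k_def)
      define l where "l = ln (1 + 2 powr (2 * k))"
      note l = ln_one_plus_powr_le[OF k, folded l_def]
      have T': "(R / \<tau>) powr p = E * real n * 2 powr (- (p * s / 2) * k)"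
      proof -
        have "real Q - real q = - k" by (simp add: kq)
        moreover have "p * (s * (- k) + s / 2 * k) = - (p * s / 2) * k" by (simp add: field_simps)
        ultimately show ?thesis unfolding T by (simp only:)
      qed
      have M: "M \<le> C * real n * 2 powr k"
        using sizes False unfolding sizes_bounded_def M_def kq by simp
      have lT: "l * (R / \<tau>) powr p \<le> real n * (2 * E * ((1 + k) * 2 powr (- \<mu> * k)))"
      proof -
        have "l * (R / \<tau>) powr p \<le> (2 * (1 + k)) * (E * real n * 2 powr (- \<mu> * k))"
          unfolding T' using l k E weaken_decay[OF mu(3) k] by (intro mult_mono mult_left_mono) auto
        also have "\<dots> = real n * (2 * E * ((1 + k) * 2 powr (- \<mu> * k)))" by (simp only: mult_ac)
        finally show ?thesis .
      qed
      have "(1 + 2 / (exp l - 1)) ^ card (I q) \<le> exp (2 / (exp l - 1)) ^ card (I q)"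
        unfolding l(3) by (intro power_mono exp_ge_add_one_self) simp
      also have "\<dots> = exp (M * (2 / 2 powr (2 * k)))" by (simp only: M_def exp_of_nat_mult l(3))
      also have "M * (2 / 2 powr (2 * k)) \<le> real n * (2 * C * ((1 + k) * 2 powr (- \<mu> * k)))"
      proof -
        have "M * (2 / 2 powr (2 * k)) \<le> C * real n * 2 powr k * (2 / 2 powr (2 * k))"
          using M by (intro mult_right_mono) auto
        also have "\<dots> = real n * (2 * C * (2 powr k / 2 powr (2 * k)))" by simp
        also have "2 powr k / 2 powr (2 * k) = 2 powr (- 1 * k)"
          by (subst powr_diff [symmetric]) simp
        also have "2 powr (- 1 * k) \<le> (1 + k) * 2 powr (- \<mu> * k)"
        proof -
          have "2 powr (- 1 * k) \<le> 1 * 2 powr (- \<mu> * k)" using weaken_decay[OF mu(4) k] by simp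
          also have "\<dots> \<le> (1 + k) * 2 powr (- \<mu> * k)" using k by (intro mult_right_mono) auto
          finally show ?thesis .
        qed
        finally show ?thesis using C by (simp add: mult_left_mono)
      qed
      finally have "exp (l * (R / \<tau>) powr p) * (1 + 2 / (exp l - 1)) ^ card (I q)
         \<le> exp (real n * (2 * E * ((1 + k) * 2 powr (- \<mu> * k)))) * exp (real n * (2 * C * ((1 + k) * 2 powr (- \<mu> * k))))"
        using lT by (intro mult_mono) (auto simp: l(3))
      also have "\<dots> = exp (real n * ((2 * E + 2 * C) * ((1 + k) * 2 powr (- \<mu> * k))))"
        unfolding exp_add [symmetric] by (simp only: distrib_left distrib_right mult.assoc add_ac)
      also have "\<dots> \<le> exp (real n * (D * ((1 + k) * 2 powr (- \<mu> * k))))"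
        using k bC unfolding exp_le_cancel_iff D_def by (intro mult_left_mono mult_right_mono) auto
      finally show ?thesis using that[OF l(1)] by blast
    qed
    obtain Z where Z: "finite Z" "Z \<subseteq> vecs (C_space A)"
      "real (card Z) \<le> exp (\<nu> * (R / \<tau>) powr p) * (1 + 2 / (exp \<nu> - 1)) ^ card (I q)"
      "\<And>c. (\<Sum>r\<in>I q. \<bar>c r\<bar> powr p) \<le> R powr p \<Longrightarrow> \<exists>h\<in>Z. \<forall>t\<in>A. \<bar>level_sum q c t - h t\<bar> \<le> B * \<tau>"
      using quantize_level[OF finite_I[of q] psi_C sum_psi p tau l(1) R] by blast
    show "\<exists>Z. finite Z \<and> Z \<subseteq> vecs (C_space A)
      \<and> real (card Z) \<le> exp (real n * (D * (decay \<mu> q Q)))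
      \<and> (\<forall>c. level_ball q c \<longrightarrow>
          (\<exists>h\<in>Z. \<forall>t\<in>A. \<bar>level_sum q c t - h t\<bar>
             \<le> B * (radius n Q * 2 powr (- (s / 2) * gap q Q))))"
      unfolding k_def [symmetric] R_def [symmetric] \<tau>_def [symmetric]
      by (intro exI[of _ Z] conjI allI impI Z(1,2,4) order_trans[OF Z(3) l(2)])
  qed
qed

text \<open>Up to rounding, a function in \<open>V\<close> is the sum of one element of each of the finite sets of the
  levels up to some level \<open>K\<close>; the remaining levels are negligible if \<open>K\<close> is large.\<close>

theorem finite_approximation:
  assumes kappa: "\<kappa> > 0" and C: "C \<ge> 1"
  obtains D E where "D > 0" "E > 0"
    and "\<And>n Q. n \<ge> 1 \<Longrightarrow> sizes_bounded C \<kappa> n Q \<Longrightarrow>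
      \<exists>Z. finite Z \<and> Z \<subseteq> vecs (C_space A) \<and> real (card Z) \<le> exp (D * real n) \<and>
        (\<forall>g\<in>V. \<exists>h\<in>Z. \<forall>t\<in>A. \<bar>g t - h t\<bar> \<le> E * (radius n Q))"
proof (rule entropy_of_level[OF assms])
  fix D \<mu> :: real
  assume D: "D > 0" "\<mu> > 0" and levels: "\<And>n Q q. n \<ge> 1 \<Longrightarrow> sizes_bounded C \<kappa> n Q \<Longrightarrow>
      \<exists>Z. finite Z \<and> Z \<subseteq> vecs (C_space A)
      \<and> real (card Z) \<le> exp (real n * (D * (decay \<mu> q Q)))
      \<and> (\<forall>c. level_ball q c \<longrightarrow>
          (\<exists>h\<in>Z. \<forall>t\<in>A. \<bar>level_sum q c t - h t\<bar>
             \<le> B * (radius n Q * 2 powr (- (s / 2) * gap q Q))))"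
  obtain S1 where S1: "S1 \<ge> 1" "\<And>K Q. (\<Sum>q\<le>K. decay \<mu> q Q) \<le> S1"
    using sum_two_sided_geometric[OF D(2)] by blast
  obtain S2 where S2: "S2 \<ge> 1" "\<And>K Q. (\<Sum>q\<le>K. decay (s / 2) q Q) \<le> S2"
    using sum_two_sided_geometric[of "s / 2"] s by auto
  show ?thesis
  proof (rule that[of "D * S1" "B + B * S2"])
    show "D * S1 > 0" "B + B * S2 > 0" using D S1(1) S2(1) B by (auto intro: add_pos_pos)
    fix n Q :: nat assume n: "n \<ge> 1" and sizes: "sizes_bounded C \<kappa> n Q"
    define \<epsilon> where "\<epsilon> = radius n Q"
    have eps: "\<epsilon> \<ge> 0" by (simp add: \<epsilon>_def)
    define K where "K = Q + nat \<lceil>log 2 (real n) / (p * s)\<rceil>"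
    have tail: "B * 2 powr (- s * real K) \<le> B * \<epsilon>"
    proof -
      have "log 2 (real n) / (p * s) \<le> real K - real Q" unfolding K_def by simp linarith
      then have "log 2 (real n) \<le> (real K - real Q) * (p * s)" using p s by (simp add: pos_divide_le_eq)
      then have "log 2 (real n) / p \<le> s * (real K - real Q)" using p by (simp add: divide_le_eq mult_ac)
      then have e: "- s * real K \<le> log 2 (real n) * (- 1 / p) + - s * real Q" by (simp add: algebra_simps)
      have "2 powr (- s * real K) \<le> 2 powr (log 2 (real n) * (- 1 / p) + - s * real Q)"
        using e by (intro powr_mono) auto
      also have "\<dots> = (2 powr log 2 (real n)) powr (- 1 / p) * 2 powr (- s * real Q)"
        by (simp only: powr_add powr_powr)
      also have "2 powr log 2 (real n) = real n" using n by (intro powr_log_cancel) auto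
      finally show ?thesis using B unfolding \<epsilon>_def by (intro mult_left_mono) auto
    qed
    have "\<forall>q. \<exists>Z. finite Z \<and> Z \<subseteq> vecs (C_space A)
      \<and> real (card Z) \<le> exp (real n * (D * (decay \<mu> q Q)))
      \<and> (\<forall>c. level_ball q c \<longrightarrow>
          (\<exists>h\<in>Z. \<forall>t\<in>A. \<bar>level_sum q c t - h t\<bar> \<le> B * (\<epsilon> * 2 powr (- (s / 2) * gap q Q))))"
      unfolding \<epsilon>_def by (intro allI levels n sizes)
    from choice[OF this] obtain Z where Zall: "\<forall>q. finite (Z q) \<and> Z q \<subseteq> vecs (C_space A)
      \<and> real (card (Z q)) \<le> exp (real n * (D * (decay \<mu> q Q)))
      \<and> (\<forall>c. level_ball q c \<longrightarrow>
          (\<exists>h\<in>Z q. \<forall>t\<in>A. \<bar>level_sum q c t - h t\<bar> \<le> B * (\<epsilon> * 2 powr (- (s / 2) * gap q Q))))"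
      by (rule exE)
    note Z = Zall[THEN spec, THEN conjunct1]
      Zall[THEN spec, THEN conjunct2, THEN conjunct1]
      Zall[THEN spec, THEN conjunct2, THEN conjunct2, THEN conjunct1]
      Zall[THEN spec, THEN conjunct2, THEN conjunct2, THEN conjunct2, THEN spec, THEN mp]
    let ?P = "PiE {..K} Z"
    let ?F = "\<lambda>h. \<Sum>q\<le>K. h q"
    have finP: "finite ?P" using Z(1) by (intro finite_PiE) auto
    have "real (card (?F ` ?P)) \<le> real (card ?P)" using card_image_le[OF finP, of ?F] by simp
    also have "\<dots> = (\<Prod>q\<le>K. real (card (Z q)))" by (simp add: card_PiE)
    also have "\<dots> \<le> (\<Prod>q\<le>K. exp (real n * (D * (decay \<mu> q Q))))"
      using Z(3) by (intro prod_mono) auto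
    also have "\<dots> = exp (real n * D * (\<Sum>q\<le>K. decay \<mu> q Q))"
      by (simp only: exp_sum [OF finite_atMost, symmetric] sum_distrib_left mult.assoc)
    also have "\<dots> \<le> exp (real n * D * S1)"
      unfolding exp_le_cancel_iff using D by (intro mult_left_mono S1(2)) auto
    finally have card: "real (card (?F ` ?P)) \<le> exp (D * S1 * real n)" by (simp add: mult_ac)
    have sub: "?F ` ?P \<subseteq> vecs (C_space A)"
    proof
      fix u assume "u \<in> ?F ` ?P"
      then obtain h where h: "h \<in> ?P" "u = ?F h" by (rule imageE)
      have "h q \<in> vecs (C_space A)" if "q \<le> K" for q
        using PiE_mem[OF h(1), of q] Z(2) that by auto
      then show "u \<in> vecs (C_space A)"
        unfolding h(2) by (intro subspace_sum[OF subspace_C_space]) auto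
    qed
    have "\<exists>h\<in>?F ` ?P. \<forall>t\<in>A. \<bar>g t - h t\<bar> \<le> (B + B * S2) * \<epsilon>" if g: "g \<in> V" for g
    proof -
      from expand[OF g] obtain c
        where c1: "\<forall>q. level_ball q (c q)"
        and c2: "\<forall>K. \<forall>t\<in>A. \<bar>g t - (\<Sum>q\<le>K. level_sum q (c q) t)\<bar> \<le> B * 2 powr (- s * real K)"
        by (elim exE conjE)
      note c = c1[THEN spec] c2[THEN spec, of K, THEN bspec]
      have "\<forall>q. \<exists>h. h \<in> Z q \<and> (\<forall>t\<in>A. \<bar>level_sum q (c q) t - h t\<bar> \<le> B * (\<epsilon> * 2 powr (- (s / 2) * gap q Q)))"
        using Z(4)[OF c(1)] by (intro allI) (simp only: Bex_def)
      from choice[OF this] obtain h where hall: "\<forall>q. h q \<in> Z q \<and>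
          (\<forall>t\<in>A. \<bar>level_sum q (c q) t - h q t\<bar> \<le> B * (\<epsilon> * 2 powr (- (s / 2) * gap q Q)))"
        by (rule exE)
      note h = hall[THEN spec, THEN conjunct1] hall[THEN spec, THEN conjunct2, THEN bspec]
      have "\<bar>g t - (\<Sum>q\<le>K. h q) t\<bar> \<le> (B + B * S2) * \<epsilon>" if t: "t \<in> A" for t
      proof -
        have "\<bar>(\<Sum>q\<le>K. level_sum q (c q) t) - (\<Sum>q\<le>K. h q) t\<bar>
            \<le> (\<Sum>q\<le>K. \<bar>level_sum q (c q) t - h q t\<bar>)"
          unfolding sum_fun_at sum_subtractf [symmetric] by (rule sum_abs)
        also have "\<dots> \<le> (\<Sum>q\<le>K. B * \<epsilon> * (decay (s / 2) q Q))"
        proof (rule sum_mono)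
          fix q
          have "\<bar>level_sum q (c q) t - h q t\<bar> \<le> B * (\<epsilon> * 2 powr (- (s / 2) * gap q Q))" by (rule h(2)[OF t])
          also have "\<dots> = B * \<epsilon> * (1 * 2 powr (- (s / 2) * gap q Q))" by (simp only: mult.assoc mult_1_left)
          also have "\<dots> \<le> B * \<epsilon> * (decay (s / 2) q Q)"
            using B eps by (intro mult_left_mono mult_right_mono) auto
          finally show "\<bar>level_sum q (c q) t - h q t\<bar> \<le> B * \<epsilon> * (decay (s / 2) q Q)" .
        qed
        also have "\<dots> = B * \<epsilon> * (\<Sum>q\<le>K. decay (s / 2) q Q)"
          by (simp only: sum_distrib_left)
        also have "\<dots> \<le> B * \<epsilon> * S2" using B eps by (intro mult_left_mono S2(2)) auto
        finally have "\<bar>g t - (\<Sum>q\<le>K. h q) t\<bar> \<le> B * \<epsilon> + B * \<epsilon> * S2"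
          using c(2)[OF t] tail by linarith
        also have "B * \<epsilon> + B * \<epsilon> * S2 = (B + B * S2) * \<epsilon>" by (simp add: algebra_simps)
        finally show ?thesis .
      qed
      moreover have "(\<Sum>q\<le>K. h q) \<in> ?F ` ?P"
      proof (rule image_eqI)
        show "(\<Sum>q\<le>K. h q) = ?F (restrict h {..K})" by (intro sum.cong) auto
        show "restrict h {..K} \<in> ?P" using h(1) by auto
      qed
      ultimately show ?thesis by (intro bexI ballI)
    qed
    then show "\<exists>Z. finite Z \<and> Z \<subseteq> vecs (C_space A) \<and> real (card Z) \<le> exp (D * S1 * real n) \<and>
        (\<forall>g\<in>V. \<exists>h\<in>Z. \<forall>t\<in>A. \<bar>g t - h t\<bar> \<le> (B + B * S2) * (radius n Q))"
      using finP card sub unfolding \<epsilon>_def by (intro exI[of _ "?F ` ?P"] conjI ballI) simp_all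
  qed
qed

text \<open>For \<open>p = 2\<close> the levels up to the critical one are kept exactly, and the finer ones are
  approximated from random subspaces of geometrically decreasing dimension.  The dimension must be
  at least \<open>1\<close>, which limits this to the levels with \<open>2 powr (s * (q - Q)) \<le> n\<close>.\<close>

lemma subspace_of_level:
  assumes p2: "p = 2" and kappa: "\<kappa> > 0" and C: "C \<ge> 1"
  obtains D \<mu> where "D > 0" "\<mu> > 0"
    and "\<And>n Q q. n \<ge> 1 \<Longrightarrow> sizes_bounded C \<kappa> n Q \<Longrightarrow> 2 powr (s * (real q - real Q)) \<le> real n \<Longrightarrow>
      \<exists>W. finite W \<and> W \<subseteq> vecs (C_space A)
      \<and> real (card W) \<le> real n * (D * (decay \<mu> q Q))
      \<and> (\<forall>c. level_ball q c \<longrightarrow>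
          (\<exists>h\<in>span W. \<forall>t\<in>A. \<bar>level_sum q c t - h t\<bar>
             \<le> 8 * B\<^sup>2 * (radius n Q * 2 powr (- (s / 2) * gap q Q))))"
proof -
  define D where "D = 98304 * (4 + 4 * C) + 1"
  define \<mu> where "\<mu> = min \<kappa> (min s 1)"
  have D: "D > 0" "D \<ge> C" using C by (auto simp: D_def)
  have mu: "\<mu> > 0" "\<mu> \<le> \<kappa>" "\<mu> \<le> s" "\<mu> \<le> 1" using kappa s by (auto simp: \<mu>_def)
  show ?thesis
  proof (rule that[OF D(1) mu(1)])
    fix n Q q :: nat
    assume n: "n \<ge> 1" and sizes: "sizes_bounded C \<kappa> n Q" and qn: "2 powr (s * (real q - real Q)) \<le> real n"
    define k where "k = \<bar>real q - real Q\<bar>"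
    have k: "k \<ge> 0" by (simp add: k_def)
    define \<tau> where "\<tau> = radius n Q * 2 powr (- (s / 2) * k)"
    define R where "R = B * 2 powr (- s * real q)"
    define M where "M = real (card (I q))"
    have tau: "\<tau> \<ge> 0" by (simp add: \<tau>_def)
    have R: "R > 0" using B by (simp add: R_def)
    let ?bound = "real n * (D * ((1 + k) * 2 powr (- \<mu> * k)))"
    have "\<exists>W. finite W \<and> W \<subseteq> vecs (C_space A) \<and> real (card W) \<le> ?bound
      \<and> (\<forall>c. (\<Sum>r\<in>I q. (c r)\<^sup>2) \<le> R\<^sup>2 \<longrightarrow>
          (\<exists>h\<in>span W. \<forall>t\<in>A. \<bar>level_sum q c t - h t\<bar> \<le> 8 * B\<^sup>2 * \<tau>))"
    proof (cases "q \<le> Q")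
      case True
      then have kq: "k = real Q - real q" by (simp add: k_def)
      have "M \<le> C * real n * 2 powr (- \<kappa> * k)"
        using sizes True unfolding sizes_bounded_def M_def kq by blast
      also have "\<dots> = real n * (C * (1 * 2 powr (- \<kappa> * k)))" by (simp only: mult_ac mult_1_left)
      also have "\<dots> \<le> ?bound"
        using weaken_decay[OF mu(2) k] D C k by (intro mult_left_mono mult_mono) auto
      finally have "real (card (\<psi> q ` I q)) \<le> ?bound"
        using card_image_le[OF finite_I[of q], of "\<psi> q"] by (simp add: M_def)
      moreover have "\<exists>h\<in>span (\<psi> q ` I q). \<forall>t\<in>A. \<bar>level_sum q c t - h t\<bar> \<le> 8 * B\<^sup>2 * \<tau>" for c
      proof (rule bexI[of _ "\<Sum>r\<in>I q. c r *\<^sub>R \<psi> q r"])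
        show "\<forall>t\<in>A. \<bar>level_sum q c t - (\<Sum>r\<in>I q. c r *\<^sub>R \<psi> q r) t\<bar> \<le> 8 * B\<^sup>2 * \<tau>"
          using tau unfolding lincomb_at by simp
        show "(\<Sum>r\<in>I q. c r *\<^sub>R \<psi> q r) \<in> span (\<psi> q ` I q)"
          by (intro span_sum span_scale span_base) auto
      qed
      moreover have "\<psi> q ` I q \<subseteq> vecs (C_space A)" using psi_C by auto
      ultimately show ?thesis using finite_I[of q] by (intro exI[of _ "\<psi> q ` I q"] conjI allI impI) simp_all
    next
      case False
      then have kq: "k = real q - real Q" by (simp add: k_def)
      define l where "l = ln (1 + 2 powr (2 * k))"
      note l = ln_one_plus_powr_le[OF k, folded l_def]
      define z where "z = real n * 2 powr (- s * k)"
      have z1: "1 \<le> z"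
      proof -
        have "2 powr (s * k) * 2 powr (- s * k) \<le> real n * 2 powr (- s * k)"
          using qn unfolding kq by (intro mult_right_mono) auto
        moreover have "2 powr (s * k) * 2 powr (- s * k) = (1::real)"
          by (subst powr_add [symmetric]) simp
        ultimately show ?thesis by (simp only: z_def)
      qed
      define d where "d = nat \<lfloor>sqrt z\<rfloor>"
      have sq1: "1 \<le> sqrt z" using z1 by simp
      then have dz: "real d \<le> sqrt z" "sqrt z < real d + 1" unfolding d_def by linarith+
      have d1: "1 \<le> d" using sq1 unfolding d_def by (simp add: le_nat_floor)
      have d2: "(real d)\<^sup>2 \<le> z"
        using power_mono[OF dz(1), of 2] z1 by simp
      have sqrt_le: "sqrt z \<le> 2 * real d" using dz d1 by simp
      have M: "M \<le> C * real n * 2 powr k"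
        using sizes False unfolding sizes_bounded_def M_def kq by simp
      define X where "X = 98304 * (2 * l * (real d)\<^sup>2 + 4 / (exp l - 1) * M + 1)"
      define m where "m = nat \<lceil>X\<rceil>"
      have X0: "X \<ge> 0" unfolding X_def l(3) using l(1) by (simp add: M_def)
      then have mX: "X \<le> real m" "real m \<le> X + 1" unfolding m_def by linarith+
      have zmu: "z \<le> real n * 2 powr (- \<mu> * k)"
        unfolding z_def using weaken_decay[OF mu(3) k] by (intro mult_left_mono) auto
      have e1: "2 * l * (real d)\<^sup>2 \<le> (2 + 4 * k) * (real n * 2 powr (- \<mu> * k))"
        using l(1,2) d2 zmu k by (intro mult_mono) auto
      have e2: "4 / (exp l - 1) * M \<le> 4 * C * (real n * 2 powr (- \<mu> * k))"
      proof -
        have "4 / (exp l - 1) * M \<le> 4 / 2 powr (2 * k) * (C * real n * 2 powr k)"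
          unfolding l(3) using M by (intro mult_left_mono) auto
        also have "\<dots> = 4 * C * (real n * (2 powr k / 2 powr (2 * k)))" by simp
        also have "2 powr k / 2 powr (2 * k) = 2 powr (- 1 * k)"
          by (subst powr_diff [symmetric]) simp
        also have "4 * C * (real n * 2 powr (- 1 * k)) \<le> 4 * C * (real n * 2 powr (- \<mu> * k))"
          using C weaken_decay[OF mu(4) k] by (intro mult_left_mono) auto
        finally show ?thesis .
      qed
      define N where "N = real n * 2 powr (- \<mu> * k)"
      have N1: "1 \<le> N" using z1 zmu by (simp add: N_def)
      have "X + 1 \<le> 98304 * ((2 + 4 * k) * N + 4 * C * N + N) + N"
        unfolding X_def using e1 e2 N1 by (simp only: N_def [symmetric]) argo
      also have "\<dots> \<le> 98304 * ((4 + 4 * C) * (1 + k) * N) + 1 * (1 + k) * N"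
      proof -
        have "0 \<le> C * k * N" "0 \<le> k * N" using C k N1 by auto
        then show ?thesis using N1 by (simp add: algebra_simps)
      qed
      also have "\<dots> = ?bound" by (simp add: D_def N_def algebra_simps)
      finally have mb: "real m \<le> ?bound" using mX by linarith
      have mm: "98304 * (2 * l * (real d)\<^sup>2 + 4 / (exp l - 1) * real (card (I q)) + 1) \<le> real m"
        using mX(1) by (simp only: X_def M_def)
      obtain W where W: "finite W" "W \<subseteq> vecs (C_space A)" "card W \<le> m"
        "\<And>c. (\<Sum>r\<in>I q. (c r)\<^sup>2) \<le> R\<^sup>2 \<Longrightarrow>
          \<exists>h\<in>span W. \<forall>t\<in>A. \<bar>level_sum q c t - h t\<bar> \<le> B * (R * 4 / real d)"
        using low_dimensional_level[OF finite_I[of q] psi_C sum_psi d1 l(1) R mm] by blast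
      have err: "B * (R * 4 / real d) \<le> 8 * B\<^sup>2 * \<tau>"
      proof -
        have "4 / real d \<le> 8 / sqrt z" using sqrt_le sq1 d1 by (simp add: field_simps)
        then have "B * (R * (4 / real d)) \<le> B * (R * (8 / sqrt z))"
          using B R by (intro mult_left_mono) auto
        also have "\<dots> = 8 * B\<^sup>2 * (2 powr (- s * real q) * (1 / sqrt z))"
          by (simp add: R_def power2_eq_square)
        also have "1 / sqrt z = real n powr (- 1 / p) * 2 powr (s / 2 * k)"
        proof -
          have "1 / sqrt z = z powr (- (1 / 2))"
            using z1 by (simp add: powr_half_sqrt [symmetric] powr_minus_divide)
          also have "\<dots> = real n powr (- (1 / 2)) * (2 powr (- s * k)) powr (- (1 / 2))"
            unfolding z_def by (simp only: powr_mult)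
          also have "(2 powr (- s * k)) powr (- (1 / 2)) = 2 powr (s / 2 * k)"
            by (simp add: powr_powr)
          finally show ?thesis by (simp add: p2)
        qed
        also have "2 powr (- s * real q) * (real n powr (- 1 / p) * 2 powr (s / 2 * k))
            = real n powr (- 1 / p) * (2 powr (- s * real q) * 2 powr (s / 2 * k))" by (simp only: mult_ac)
        also have "2 powr (- s * real q) * 2 powr (s / 2 * k) = 2 powr (- s * real Q) * 2 powr (- (s / 2) * k)"
        proof -
          have "real q = real Q + k" by (simp add: kq)
          moreover have "- s * (real Q + k) + s / 2 * k = - s * real Q + - (s / 2) * k"
            by (simp add: distrib_left)
          ultimately show ?thesis unfolding powr_add [symmetric] by (simp only:)
        qed
        finally show ?thesis by (simp add: \<tau>_def mult_ac)
      qed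
      have "real (card W) \<le> ?bound" using W(3) mb by linarith
      moreover have "\<exists>h\<in>span W. \<forall>t\<in>A. \<bar>level_sum q c t - h t\<bar> \<le> 8 * B\<^sup>2 * \<tau>"
        if "(\<Sum>r\<in>I q. (c r)\<^sup>2) \<le> R\<^sup>2" for c
        using W(4)[OF that] err by (meson order_trans)
      ultimately show ?thesis using W(1,2) by (intro exI[of _ W] conjI allI impI) simp_all
    qed
    then obtain W where W: "finite W" "W \<subseteq> vecs (C_space A)" "real (card W) \<le> ?bound"
      "\<And>c. (\<Sum>r\<in>I q. (c r)\<^sup>2) \<le> R\<^sup>2 \<Longrightarrow>
          \<exists>h\<in>span W. \<forall>t\<in>A. \<bar>level_sum q c t - h t\<bar> \<le> 8 * B\<^sup>2 * \<tau>" by blast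
    have sq: "\<bar>x\<bar> powr p = x\<^sup>2" for x :: real
      unfolding p2 by (cases "x = 0") (simp_all add: powr_numeral)
    have Rsq: "(B * 2 powr (- s * real q)) powr p = R\<^sup>2" using sq[of R] R by (simp add: R_def)
    show "\<exists>W. finite W \<and> W \<subseteq> vecs (C_space A)
      \<and> real (card W) \<le> real n * (D * (decay \<mu> q Q))
      \<and> (\<forall>c. level_ball q c \<longrightarrow>
          (\<exists>h\<in>span W. \<forall>t\<in>A. \<bar>level_sum q c t - h t\<bar>
             \<le> 8 * B\<^sup>2 * (radius n Q * 2 powr (- (s / 2) * gap q Q))))"
      unfolding sq Rsq k_def [symmetric] \<tau>_def [symmetric]
      by (intro exI[of _ W] conjI allI impI W)
  qed
qed

theorem finite_dimensional_approximation:
  assumes p2: "p = 2" and kappa: "\<kappa> > 0" and C: "C \<ge> 1"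
  obtains D E where "D > 0" "E > 0"
    and "\<And>n Q. n \<ge> 1 \<Longrightarrow> sizes_bounded C \<kappa> n Q \<Longrightarrow>
      \<exists>W. finite W \<and> W \<subseteq> vecs (C_space A) \<and> real (card W) \<le> D * real n \<and>
        (\<forall>g\<in>V. \<exists>h\<in>span W. \<forall>t\<in>A. \<bar>g t - h t\<bar> \<le> E * (radius n Q))"
proof (rule subspace_of_level[OF assms])
  fix D \<mu> :: real
  assume D: "D > 0" "\<mu> > 0" and levels: "\<And>n Q q. n \<ge> 1 \<Longrightarrow> sizes_bounded C \<kappa> n Q \<Longrightarrow>
      2 powr (s * (real q - real Q)) \<le> real n \<Longrightarrow>
      \<exists>W. finite W \<and> W \<subseteq> vecs (C_space A)
      \<and> real (card W) \<le> real n * (D * (decay \<mu> q Q))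
      \<and> (\<forall>c. level_ball q c \<longrightarrow>
          (\<exists>h\<in>span W. \<forall>t\<in>A. \<bar>level_sum q c t - h t\<bar>
             \<le> 8 * B\<^sup>2 * (radius n Q * 2 powr (- (s / 2) * gap q Q))))"
  obtain S1 where S1: "S1 \<ge> 1" "\<And>K Q. (\<Sum>q\<le>K. decay \<mu> q Q) \<le> S1"
    using sum_two_sided_geometric[OF D(2)] by blast
  obtain S2 where S2: "S2 \<ge> 1" "\<And>K Q. (\<Sum>q\<le>K. decay (s / 2) q Q) \<le> S2"
    using sum_two_sided_geometric[of "s / 2"] s by auto
  define B' where "B' = 8 * B\<^sup>2"
  have B': "B' > 0" using B by (simp add: B'_def)
  define E where "E = B * 2 powr s + B' * S2"
  show ?thesis
  proof (rule that[of "D * S1" E])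
    show "D * S1 > 0" "E > 0" using D S1(1) S2(1) B B' by (auto simp: E_def intro!: add_pos_pos)
    fix n Q :: nat assume n: "n \<ge> 1" and sizes: "sizes_bounded C \<kappa> n Q"
    define \<epsilon> where "\<epsilon> = radius n Q"
    have eps: "\<epsilon> \<ge> 0" by (simp add: \<epsilon>_def)
    define L where "L = nat \<lfloor>log 2 (real n) / s\<rfloor>"
    define K where "K = Q + L"
    have log0: "0 \<le> log 2 (real n)" using n by simp
    have log_n: "2 powr log 2 (real n) = real n" using n by (intro powr_log_cancel) auto
    have "0 \<le> log 2 (real n) / s" using log0 s by simp
    then have "real L \<le> log 2 (real n) / s" "log 2 (real n) / s < real L + 1"
      unfolding L_def by linarith+
    then have L: "s * real L \<le> log 2 (real n)" "log 2 (real n) < s * (real L + 1)"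
      using s by (simp_all add: field_simps)
    have qn: "2 powr (s * (real q - real Q)) \<le> real n" if "q \<le> K" for q
    proof -
      have "real q - real Q \<le> real L" using that by (simp add: K_def)
      then have "s * (real q - real Q) \<le> s * real L" using s by (intro mult_left_mono) auto
      then have "2 powr (s * (real q - real Q)) \<le> 2 powr log 2 (real n)"
        using L(1) by (intro powr_mono) auto
      then show ?thesis by (simp only: log_n)
    qed
    have tail: "B * 2 powr (- s * real K) \<le> B * 2 powr s * \<epsilon>"
    proof -
      have "- s * real K = - s * real Q + (s - s * (real L + 1))" by (simp add: K_def algebra_simps)
      also have "\<dots> \<le> - s * real Q + (s + log 2 (real n) * (- 1 / p))"
      proof -
        have "log 2 (real n) * (1 / 2) \<le> log 2 (real n) * 1" using log0 by (intro mult_left_mono) auto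
        then show ?thesis using L(2) unfolding p2 by simp
      qed
      finally have "2 powr (- s * real K) \<le> 2 powr (- s * real Q + (s + log 2 (real n) * (- 1 / p)))"
        by (intro powr_mono) auto
      also have "\<dots> = 2 powr (- s * real Q) * (2 powr s * (2 powr log 2 (real n)) powr (- 1 / p))"
        by (simp only: powr_add powr_powr)
      also have "\<dots> = 2 powr s * \<epsilon>" unfolding log_n \<epsilon>_def by (simp only: mult_ac)
      finally show ?thesis using B by (simp add: mult_left_mono mult.assoc)
    qed
    have "\<forall>q. \<exists>W. q \<le> K \<longrightarrow> finite W \<and> W \<subseteq> vecs (C_space A)
      \<and> real (card W) \<le> real n * (D * (decay \<mu> q Q))
      \<and> (\<forall>c. level_ball q c \<longrightarrow>
          (\<exists>h\<in>span W. \<forall>t\<in>A. \<bar>level_sum q c t - h t\<bar> \<le> B' * (\<epsilon> * 2 powr (- (s / 2) * gap q Q))))"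
      unfolding \<epsilon>_def B'_def ex_simps by (intro allI impI levels n sizes qn)
    from choice[OF this] obtain W where Wall: "\<forall>q. q \<le> K \<longrightarrow> finite (W q) \<and> W q \<subseteq> vecs (C_space A)
      \<and> real (card (W q)) \<le> real n * (D * (decay \<mu> q Q))
      \<and> (\<forall>c. level_ball q c \<longrightarrow>
          (\<exists>h\<in>span (W q). \<forall>t\<in>A. \<bar>level_sum q c t - h t\<bar> \<le> B' * (\<epsilon> * 2 powr (- (s / 2) * gap q Q))))"
      by (rule exE)
    note W = Wall[THEN spec, THEN mp, THEN conjunct1]
      Wall[THEN spec, THEN mp, THEN conjunct2, THEN conjunct1]
      Wall[THEN spec, THEN mp, THEN conjunct2, THEN conjunct2, THEN conjunct1]
      Wall[THEN spec, THEN mp, THEN conjunct2, THEN conjunct2, THEN conjunct2, THEN spec, THEN mp]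
    let ?W = "\<Union>q\<in>{..K}. W q"
    have fin: "finite ?W" using W(1) by auto
    have sub: "?W \<subseteq> vecs (C_space A)" using W(2) by auto
    have "card ?W \<le> (\<Sum>q\<le>K. card (W q))" by (rule card_UN_le) simp
    then have "real (card ?W) \<le> (\<Sum>q\<le>K. real (card (W q)))"
      unfolding of_nat_sum [symmetric] by (rule of_nat_mono)
    also have "\<dots> \<le> (\<Sum>q\<le>K. real n * (D * (decay \<mu> q Q)))"
      using W(3) by (intro sum_mono) auto
    also have "\<dots> = real n * D * (\<Sum>q\<le>K. decay \<mu> q Q)"
      by (simp only: sum_distrib_left mult.assoc)
    also have "\<dots> \<le> real n * D * S1" using D by (intro mult_left_mono S1(2)) auto
    finally have card: "real (card ?W) \<le> D * S1 * real n" by (simp only: mult_ac)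
    have "\<exists>h\<in>span ?W. \<forall>t\<in>A. \<bar>g t - h t\<bar> \<le> E * \<epsilon>" if g: "g \<in> V" for g
    proof -
      from expand[OF g] obtain c
        where c1: "\<forall>q. level_ball q (c q)"
        and c2: "\<forall>K. \<forall>t\<in>A. \<bar>g t - (\<Sum>q\<le>K. level_sum q (c q) t)\<bar> \<le> B * 2 powr (- s * real K)"
        by (elim exE conjE)
      note c = c1[THEN spec] c2[THEN spec, of K, THEN bspec]
      have "\<forall>q. \<exists>h. q \<le> K \<longrightarrow> h \<in> span (W q) \<and>
        (\<forall>t\<in>A. \<bar>level_sum q (c q) t - h t\<bar> \<le> B' * (\<epsilon> * 2 powr (- (s / 2) * gap q Q)))"
        using W(4)[OF _ c(1)] unfolding ex_simps by (intro allI impI) (simp only: Bex_def)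
      from choice[OF this] obtain h where hall: "\<forall>q. q \<le> K \<longrightarrow> h q \<in> span (W q) \<and>
          (\<forall>t\<in>A. \<bar>level_sum q (c q) t - h q t\<bar> \<le> B' * (\<epsilon> * 2 powr (- (s / 2) * gap q Q)))"
        by (rule exE)
      note h = hall[THEN spec, THEN mp, THEN conjunct1] hall[THEN spec, THEN mp, THEN conjunct2, THEN bspec]
      have "\<bar>g t - (\<Sum>q\<le>K. h q) t\<bar> \<le> E * \<epsilon>" if t: "t \<in> A" for t
      proof -
        have "\<bar>(\<Sum>q\<le>K. level_sum q (c q) t) - (\<Sum>q\<le>K. h q) t\<bar>
            \<le> (\<Sum>q\<le>K. \<bar>level_sum q (c q) t - h q t\<bar>)"
          unfolding sum_fun_at sum_subtractf [symmetric] by (rule sum_abs)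
        also have "\<dots> \<le> (\<Sum>q\<le>K. B' * \<epsilon> * (decay (s / 2) q Q))"
        proof (rule sum_mono)
          fix q assume "q \<in> {..K}"
          then have "\<bar>level_sum q (c q) t - h q t\<bar> \<le> B' * (\<epsilon> * 2 powr (- (s / 2) * gap q Q))"
            by (intro h(2) t) simp
          also have "\<dots> = B' * \<epsilon> * (1 * 2 powr (- (s / 2) * gap q Q))" by (simp only: mult.assoc mult_1_left)
          also have "\<dots> \<le> B' * \<epsilon> * (decay (s / 2) q Q)"
            using B' eps by (intro mult_left_mono mult_right_mono) auto
          finally show "\<bar>level_sum q (c q) t - h q t\<bar> \<le> B' * \<epsilon> * (decay (s / 2) q Q)" .
        qed
        also have "\<dots> = B' * \<epsilon> * (\<Sum>q\<le>K. decay (s / 2) q Q)"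
          by (simp only: sum_distrib_left)
        also have "\<dots> \<le> B' * \<epsilon> * S2" using B' eps by (intro mult_left_mono S2(2)) auto
        finally have "\<bar>g t - (\<Sum>q\<le>K. h q) t\<bar> \<le> B * 2 powr s * \<epsilon> + B' * \<epsilon> * S2"
          using c(2)[OF t] tail by linarith
        also have "B * 2 powr s * \<epsilon> + B' * \<epsilon> * S2 = E * \<epsilon>" by (simp add: E_def algebra_simps)
        finally show ?thesis .
      qed
      moreover have "(\<Sum>q\<le>K. h q) \<in> span ?W"
      proof (rule span_sum)
        fix q assume "q \<in> {..K}"
        then show "h q \<in> span ?W" using h(1)[of q] span_mono[of "W q" ?W] by auto
      qed
      ultimately show ?thesis by (intro bexI ballI)
    qed
    then show "\<exists>W. finite W \<and> W \<subseteq> vecs (C_space A) \<and> real (card W) \<le> D * S1 * real n \<and>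
        (\<forall>g\<in>V. \<exists>h\<in>span W. \<forall>t\<in>A. \<bar>g t - h t\<bar> \<le> E * (radius n Q))"
      using fin card sub unfolding \<epsilon>_def by (intro exI[of _ ?W] conjI ballI) simp_all
  qed
qed

end

section \<open>From approximating sets to entropy and Kolmogorov numbers\<close>

context level_system
begin

text \<open>The partial sums of the expansion are continuous and converge uniformly.  So the Riemann-Liouville
  integrals are elements of the space \<open>C(A)\<close>, which is needed for the covering balls.\<close>

lemma continuous_on_V:
  assumes g: "g \<in> V"
  shows "continuous_on A g"
proof -
  obtain c where c: "\<forall>K. \<forall>t\<in>A. \<bar>g t - (\<Sum>q\<le>K. \<Sum>r\<in>I q. c q r * \<psi> q r t)\<bar> \<le> B * 2 powr (- s * real K)"
    using expand[OF g] by (elim exE conjE)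
  define F where "F = (\<lambda>K t. \<Sum>q\<le>K. \<Sum>r\<in>I q. c q r * \<psi> q r t)"
  define x :: real where "x = 2 powr (- s)"
  have x: "0 < x" "x < 1" using s powr_less_mono[of "- s" 0 2] by (auto simp: x_def)
  have pw: "2 powr (- s * real K) = x ^ K" for K
  proof -
    have "x ^ K = x powr real K" using x(1) by (rule powr_realpow [symmetric])
    then show ?thesis by (simp only: x_def powr_powr)
  qed
  have lim: "(\<lambda>K. B * x ^ K) \<longlonglongrightarrow> 0"
    using tendsto_mult_right_zero[OF LIMSEQ_power_zero[of x]] x by simp
  have "uniform_limit A F g sequentially"
  proof (rule uniform_limitI)
    fix e :: real assume "e > 0"
    have "\<forall>\<^sub>F K in sequentially. B * x ^ K < e" using order_tendstoD(2)[OF lim \<open>e > 0\<close>] .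
    then show "\<forall>\<^sub>F K in sequentially. \<forall>t\<in>A. dist (F K t) (g t) < e"
    proof (rule eventually_mono)
      fix K assume K: "B * x ^ K < e"
      show "\<forall>t\<in>A. dist (F K t) (g t) < e"
      proof
        fix t assume t: "t \<in> A"
        have "\<bar>g t - F K t\<bar> \<le> B * x ^ K" using c[THEN spec, of K, THEN bspec, OF t] by (simp only: F_def pw)
        then show "dist (F K t) (g t) < e" using K by (simp add: dist_real_def abs_minus_commute)
      qed
    qed
  qed
  moreover have "continuous_on A (F K)" for K
    unfolding F_def using psi_C by (intro continuous_intros) (auto simp: C_space_def)
  ultimately show ?thesis by (intro uniform_limit_theorem[where f = F and F = sequentially]) auto
qed

end

lemma operator_entropy_le:
  fixes X :: "'a nspace" and T :: "'a \<Rightarrow> real \<Rightarrow> real"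
  assumes A: "compact A" and T: "T ` unit_ball X \<subseteq> vecs (C_space A)" and ne: "unit_ball X \<noteq> {}"
    and Z: "finite Z" "Z \<subseteq> vecs (C_space A)" "card Z \<le> 2 ^ (N - 1)" and rho: "0 \<le> \<rho>"
    and approx: "\<And>f. f \<in> unit_ball X \<Longrightarrow> \<exists>h\<in>Z. \<forall>t\<in>A. \<bar>T f t - h t\<bar> \<le> \<rho>"
  shows "operator_entropy X (C_space A) T N \<le> ennreal \<rho>"
proof -
  let ?M = "norm_metric (C_space A)"
  obtain e where e: "bij_betw e {1..card Z} Z" using ex_bij_betw_nat_finite_1[OF Z(1)] by blast
  obtain f0 where "f0 \<in> unit_ball X" using ne by auto
  with approx obtain z0 where z0: "z0 \<in> Z" by blast
  define x where "x = (\<lambda>i. if i \<in> {1..card Z} then e i else z0)"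
  have xZ: "x i \<in> Z" for i using bij_betwE[OF e] z0 by (auto simp: x_def)
  have "T ` unit_ball X \<subseteq> (\<Union>i\<in>{1..2 ^ (N - 1)}. mcball_of ?M (x i) \<rho>)"
  proof
    fix g assume g: "g \<in> T ` unit_ball X"
    then obtain f where f: "f \<in> unit_ball X" "g = T f" by (rule imageE)
    obtain h where h: "h \<in> Z" "\<And>t. t \<in> A \<Longrightarrow> \<bar>g t - h t\<bar> \<le> \<rho>" using approx[OF f(1)] f(2) by auto
    have "h \<in> e ` {1..card Z}" using bij_betw_imp_surj_on[OF e] h(1) by simp
    then obtain i where i: "h = e i" "i \<in> {1..card Z}" by (rule imageE)
    have hC: "h \<in> vecs (C_space A)" and gC: "g \<in> vecs (C_space A)"
      using h(1) Z(2) g T by (auto dest: subsetD)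
    have "vnorm (C_space A) (h - g) \<le> \<rho>"
      by (rule C_space_norm_le[OF rho]) (use h(2) in \<open>simp add: abs_minus_commute\<close>)
    then have "g \<in> mcball_of ?M h \<rho>"
      using hC gC by (simp add: mspace_C_space[OF A] mdist_C_space[OF A])
    moreover have "x i = h" using i by (simp add: x_def)
    moreover have "i \<in> {1..2 ^ (N - 1)}" using i Z(3) by auto
    ultimately show "g \<in> (\<Union>i\<in>{1..2 ^ (N - 1)}. mcball_of ?M (x i) \<rho>)" by auto
  qed
  moreover have "x i \<in> mspace ?M" for i using xZ[of i] Z(2) unfolding mspace_C_space[OF A] by auto
  ultimately show ?thesis
    unfolding operator_entropy_def dyadic_entropy_def covering_entropy_def
    using rho by (intro INF_lower CollectI conjI exI[of _ x] ballI)
qed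

lemma kolmogorov_number_le:
  fixes X :: "'a nspace" and T :: "'a \<Rightarrow> real \<Rightarrow> real"
  assumes W: "finite W" "W \<subseteq> vecs (C_space A)" "card W < N" and rho: "0 \<le> \<rho>"
    and approx: "\<And>f. f \<in> unit_ball X \<Longrightarrow> \<exists>h\<in>span W. \<forall>t\<in>A. \<bar>T f t - h t\<bar> \<le> \<rho>"
  shows "kolmogorov_number X (C_space A) T N \<le> ennreal \<rho>"
proof -
  have "(SUP f\<in>unit_ball X. quotient_norm (C_space A) (span W) (T f)) \<le> ennreal \<rho>"
  proof (rule SUP_least)
    fix f assume "f \<in> unit_ball X"
    then obtain h where h: "h \<in> span W" "\<And>t. t \<in> A \<Longrightarrow> \<bar>T f t - h t\<bar> \<le> \<rho>" using approx by blast
    have "vnorm (C_space A) (T f - h) \<le> \<rho>"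
      by (rule C_space_norm_le[OF rho]) (use h(2) in simp)
    then show "quotient_norm (C_space A) (span W) (T f) \<le> ennreal \<rho>"
      unfolding quotient_norm_def by (intro INF_lower2[OF h(1)] ennreal_leI)
  qed
  moreover have "span W \<subseteq> vecs (C_space A)"
    by (intro span_minimal W(2) subspace_C_space)
  moreover have "dim (span W) < N"
    using dim_le_card'[OF W(1)] W(3) by (simp add: dim_span)
  ultimately show ?thesis
    unfolding kolmogorov_number_def using W(1)
    by (intro INF_lower2[of "span W"] CollectI conjI subspace_span exI[of _ W] refl)
qed

text \<open>Constant factors of the index are harmless for these rates, and boundedness takes care of the finitely
  many indices that are too small for the main estimate.\<close>

lemma asymp_le_rateI:
  fixes x :: "nat \<Rightarrow> ennreal" and D :: nat
  assumes D: "D \<ge> 1" and C: "C \<ge> 0" and E: "E \<ge> 0"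
    and bounded: "\<And>N. N \<ge> 1 \<Longrightarrow> x N \<le> ennreal C"
    and main: "\<And>n N. n \<ge> 1 \<Longrightarrow> D * n < N \<Longrightarrow> x N \<le> ennreal (E * rate a b n)"
  shows "x \<preceq> (\<lambda>n. real n powr a * (log 2 (real n + 1)) powr b)"
proof -
  define e where "e = \<bar>a\<bar> + \<bar>b\<bar>"
  define P where "P = (6 * real D) powr e"
  have e: "e \<ge> 0" by (simp add: e_def)
  have P: "P > 0" using D by (simp add: P_def)
  have step: "rate a b m \<le> rate a b N * P" if "1 \<le> m" "m \<le> N" "real N \<le> 2 * real D * real m" for m N
  proof -
    have "3 * (real N / real m) \<le> 6 * real D" using that by (simp add: divide_le_eq)
    then have "(3 * (real N / real m)) powr e \<le> P" unfolding P_def using e that by (intro powr_mono2) auto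
    then have "rate a b N * (3 * (real N / real m)) powr e \<le> rate a b N * P"
      using rate_pos[of N a b] that by (intro mult_left_mono) auto
    then show ?thesis using rate_ratio[OF that(1,2), of a b] unfolding e_def by linarith
  qed
  have "x N \<le> ennreal ((C + E + 1) * P * rate a b N)" if N: "N \<ge> 1" for N
  proof (cases "D < N")
    case True
    define n where "n = (N - 1) div D"
    have n: "1 \<le> n" "D * n < N" "N \<le> D * (n + 1)"
    proof -
      show "1 \<le> n" using True D unfolding n_def by (simp add: div_greater_zero_iff Suc_le_eq)
      show "D * n < N" using times_div_less_eq_dividend[of D "N - 1"] N unfolding n_def by linarith
      have "N - 1 < D * (n + 1)" using dividend_less_times_div[of D "N - 1"] D unfolding n_def by simp
      then show "N \<le> D * (n + 1)" using N by linarith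
    qed
    have "D * 1 \<le> D * n" using n(1) by (intro mult_le_mono2)
    then have "N \<le> D * n + D * n" using n(3) unfolding distrib_left by linarith
    then have "N \<le> 2 * D * n" by simp
    then have "real N \<le> real (2 * D * n)" by (rule of_nat_mono)
    then have "real N \<le> 2 * real D * real n" by simp
    moreover have "n \<le> N"
    proof -
      have "1 * n \<le> D * n" using D by (intro mult_right_mono) auto
      then show ?thesis using n(2) by linarith
    qed
    ultimately have r: "rate a b n \<le> rate a b N * P" using n(1) by (intro step)
    have "x N \<le> ennreal (E * rate a b n)" by (rule main[OF n(1,2)])
    also have "E * rate a b n \<le> E * (rate a b N * P)" using E r by (intro mult_left_mono)
    also have "\<dots> \<le> (C + E + 1) * (rate a b N * P)"
      using C P rate_pos[OF N, of a b] by (intro mult_right_mono) auto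
    finally show ?thesis by (simp add: mult_ac ennreal_leI)
  next
    case False
    have "real N \<le> 2 * real D * real 1" using False by simp
    then have "rate a b 1 \<le> rate a b N * P" using N by (intro step) auto
    then have r: "1 \<le> rate a b N * P" by (simp add: rate_def)
    have "x N \<le> ennreal C" by (rule bounded[OF N])
    also have "C \<le> C * (rate a b N * P)" using C r by (simp add: mult_le_cancel_left1)
    also have "\<dots> \<le> (C + E + 1) * (rate a b N * P)"
      using E P rate_pos[OF N, of a b] by (intro mult_right_mono) auto
    finally show ?thesis by (simp add: mult_ac ennreal_leI)
  qed
  moreover have "(C + E + 1) * P > 0" using C E P by simp
  ultimately show ?thesis
    unfolding asymp_le_def rate_def [symmetric] by blast
qed

text \<open>The error exponent is \<open>(\<alpha> - 1) + 1 / q = \<alpha> - 1 / p\<close>, and the local errors are \<open>p\<close>-summable over the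
  nodes because the weights of all nodes add up to at most \<open>15\<close>.\<close>

lemma riemann_liouville_locally_polynomial:
  fixes p \<alpha> :: real
  assumes p: "p > 1" and alpha: "\<alpha> > 1 / p"
  obtains k C where "k > 0" "C \<ge> 0"
    and "\<And>f. f \<in> unit_ball (Lp_space I01 p) \<Longrightarrow>
      locally_polynomial k p (\<alpha> - 1 / p) C (\<lambda>v. 1 / Gamma \<alpha> * rl_integral (\<alpha> - 1) f v)"
proof -
  define q where "q = p / (p - 1)"
  define \<beta> where "\<beta> = \<alpha> - 1"
  define s where "s = \<alpha> - 1 / p"
  define k where "k = Suc (nat \<lceil>\<beta> + 2\<rceil>)"
  have pq: "p > 1" "q > 1" "1 / p + 1 / q = 1" using p by (auto simp: q_def field_simps)
  have beta: "\<beta> * q > -1"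
  proof -
    have "1 < \<alpha> * p" using alpha p by (simp add: divide_less_eq)
    then have "- (p - 1) < \<beta> * p" by (simp add: \<beta>_def algebra_simps)
    then show ?thesis using p by (simp add: q_def less_divide_eq)
  qed
  have bs: "\<beta> + 1 / q = s" using pq(3) by (simp add: \<beta>_def s_def)
  have k: "real k \<ge> \<beta> + 2" "k > 0" unfolding k_def by (simp_all, linarith)
  have "\<alpha> > 0" using alpha p by (smt (verit) divide_pos_pos)
  then have G: "1 / Gamma \<alpha> > 0" by (simp add: Gamma_real_pos)
  define G where "G = 1 / Gamma \<alpha>"
  obtain C1 where C1: "C1 > 0" and local: "\<And>D i f. D > 0 \<Longrightarrow> f \<in> borel_measurable I01 \<Longrightarrow> integrable I01 (\<lambda>x. \<bar>f x\<bar> powr p) \<Longrightarrow>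
      \<exists>P :: real poly. degree P < k \<and> (\<forall>y\<in>{-1..2}. \<bar>rl_integral \<beta> f ((real_of_int i + y) / D) - poly P y\<bar>
        \<le> C1 * D powr (- (\<beta> + 1 / q)) * (\<integral>x. node_weight D i x * \<bar>f x\<bar> powr p \<partial>I01) powr (1 / p))"
    by (rule rl_integral_local_polynomial[OF pq beta k]) (rule that)
  define C2 where "C2 = (2 powr (\<beta> * q + 1) / (\<beta> * q + 1)) powr (1 / q)"
  define C where "C = G * C2 + 15 * (G * C1)"
  have C2: "C2 \<ge> 0" by (simp add: C2_def)
  have G0: "G > 0" using G by (simp add: G_def)
  show ?thesis
  proof (rule that[OF k(2), of C])
    show "C \<ge> 0" using G0 C1 C2 by (simp add: C_def)
    fix f assume "f \<in> unit_ball (Lp_space I01 p)"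
    then have f: "f \<in> borel_measurable I01" "integrable I01 (\<lambda>x. \<bar>f x\<bar> powr p)"
      and norm: "(\<integral>x. \<bar>f x\<bar> powr p \<partial>I01) powr (1 / p) \<le> 1"
      by (auto simp: unit_ball_def Lp_space_def)
    define J where "J = (\<integral>x. \<bar>f x\<bar> powr p \<partial>I01)"
    have J0: "J \<ge> 0" unfolding J_def by (intro Bochner_Integration.integral_nonneg) simp
    have J1: "J \<le> 1"
    proof (rule ccontr)
      assume "\<not> J \<le> 1"
      then have "1 < J powr (1 / p)" using p by (intro gr_one_powr) auto
      then show False using norm by (simp add: J_def)
    qed
    have bounded: "\<bar>G * rl_integral \<beta> f v\<bar> \<le> C" if "v \<in> {0..2}" for v
    proof -
      have "\<bar>rl_integral \<beta> f v\<bar> \<le> C2 * J powr (1 / p)"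
        unfolding C2_def J_def using that by (intro rl_integral_bounded(2)[OF pq beta _ _ f]) auto
      also have "\<dots> \<le> C2 * 1" using C2 norm unfolding J_def by (intro mult_left_mono) auto
      finally have "G * \<bar>rl_integral \<beta> f v\<bar> \<le> G * C2" using G0 by simp
      also have "\<dots> \<le> C" using G0 C1 by (simp add: C_def)
      finally show ?thesis using G0 by (simp add: abs_mult)
    qed
    have "\<exists>a :: int \<Rightarrow> real. (\<forall>i. 0 \<le> a i) \<and>
      (\<forall>M. finite M \<longrightarrow> (\<Sum>i\<in>M. a i powr p) \<le> (C * 2 powr (- s * real l)) powr p) \<and>
      (\<forall>i. \<exists>P :: real poly. degree P < k \<and>
         (\<forall>y\<in>{-1..2}. \<bar>G * rl_integral \<beta> f ((real_of_int i + y) / 2 ^ l) - poly P y\<bar> \<le> a i))" for l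
    proof -
      let ?D = "2 ^ l :: real"
      define w where "w = (\<lambda>i. \<integral>x. node_weight ?D i x * \<bar>f x\<bar> powr p \<partial>I01)"
      define S where "S = 2 powr (- s * real l)"
      define a where "a = (\<lambda>i. G * C1 * S * w i powr (1 / p))"
      have w0: "w i \<ge> 0" for i
        unfolding w_def using node_weight_pos[of ?D i]
        by (intro Bochner_Integration.integral_nonneg) (simp add: less_imp_le)
      have DS: "?D powr (- (\<beta> + 1 / q)) = S"
      proof -
        have "?D = 2 powr real l" by (simp add: powr_realpow)
        then show ?thesis unfolding bs S_def by (simp only: powr_powr) (simp add: mult.commute)
      qed
      have a0: "0 \<le> a i" for i using G0 C1 by (simp add: a_def S_def)
      have "(\<Sum>i\<in>M. a i powr p) \<le> (C * S) powr p" if M: "finite M" for M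
      proof -
        have ai: "a i powr p = (G * C1 * S) powr p * w i" for i
          using G0 C1 w0[of i] p unfolding a_def by (simp add: powr_mult powr_powr)
        have "(\<Sum>i\<in>M. a i powr p) = (G * C1 * S) powr p * (\<Sum>i\<in>M. w i)"
          unfolding ai by (simp only: sum_distrib_left)
        also have "\<dots> \<le> (G * C1 * S) powr p * (15 * J)"
          unfolding w_def J_def by (intro mult_left_mono node_weight_Lp(2)[OF f M]) simp
        also have "\<dots> \<le> (G * C1 * S) powr p * (15 powr p)"
        proof (intro mult_left_mono)
          have "(15::real) powr 1 \<le> 15 powr p" using p by (intro powr_mono) auto
          then show "15 * J \<le> 15 powr p" using J1 by simp
        qed simp
        also have "\<dots> = (15 * (G * C1) * S) powr p"
          using G0 C1 by (simp add: powr_mult S_def mult_ac)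
        also have "\<dots> \<le> (C * S) powr p"
          using G0 C1 C2 p by (intro powr_mono2 mult_right_mono) (auto simp: C_def S_def)
        finally show ?thesis .
      qed
      moreover have "\<exists>P :: real poly. degree P < k \<and>
         (\<forall>y\<in>{-1..2}. \<bar>G * rl_integral \<beta> f ((real_of_int i + y) / 2 ^ l) - poly P y\<bar> \<le> a i)" for i
      proof -
        have D0: "?D > 0" by simp
        from local[OF D0 f, of i] obtain P :: "real poly" where P: "degree P < k"
          "\<And>y. y \<in> {-1..2} \<Longrightarrow> \<bar>rl_integral \<beta> f ((real_of_int i + y) / ?D) - poly P y\<bar> \<le> C1 * S * w i powr (1 / p)"
          unfolding DS w_def by blast
        show ?thesis
        proof (intro exI[of _ "smult G P"] conjI ballI)
          show "degree (smult G P) < k" using P(1) degree_smult_le[of G P] by linarith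
          fix y :: real assume y: "y \<in> {-1..2}"
          have "\<bar>G * rl_integral \<beta> f ((real_of_int i + y) / ?D) - poly (smult G P) y\<bar>
              = G * \<bar>rl_integral \<beta> f ((real_of_int i + y) / ?D) - poly P y\<bar>"
            using G0 by (simp add: right_diff_distrib [symmetric] abs_mult)
          also have "\<dots> \<le> G * (C1 * S * w i powr (1 / p))" using G0 P(2)[OF y] by (intro mult_left_mono) auto
          finally show "\<bar>G * rl_integral \<beta> f ((real_of_int i + y) / ?D) - poly (smult G P) y\<bar> \<le> a i"
            by (simp only: a_def mult.assoc)
        qed
      qed
      ultimately show ?thesis using a0 unfolding S_def by (intro exI[of _ a] conjI allI impI)
    qed
    then show "locally_polynomial k p (\<alpha> - 1 / p) C (\<lambda>v. 1 / Gamma \<alpha> * rl_integral (\<alpha> - 1) f v)"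
      unfolding locally_polynomial_def s_def [symmetric] \<beta>_def [symmetric] G_def [symmetric]
      using bounded by (intro conjI ballI allI)
  qed
qed

theorem proposition5p23:
  fixes A :: "real set" and \<delta> \<theta> :: real
  assumes "A \<subseteq> {0..1}" and "compact A" and "\<delta> \<ge> 1"
    and "covering_entropy euclidean_metric A
           \<preceq> (\<lambda>n. real n powr (- \<delta>) * (log 2 (real n + 1)) powr \<theta>)"
  shows "(\<forall>p \<alpha> :: real. 2 \<le> p \<longrightarrow> \<alpha> > 1 / p \<longrightarrow>
            operator_entropy (Lp_space (lebesgue_on {0..1}) p) (C_space A)
                (riemann_liouville_on A \<alpha>)
              \<preceq> (\<lambda>n. real n powr (- 1 / p - \<delta> * (\<alpha> - 1 / p))
                       * (log 2 (real n + 1)) powr (\<theta> * (\<alpha> - 1 / p))))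
       \<and> (\<forall>\<alpha> :: real. \<alpha> > 1 / 2 \<longrightarrow>
            kolmogorov_number (Lp_space (lebesgue_on {0..1}) 2) (C_space A)
                (riemann_liouville_on A \<alpha>)
              \<preceq> (\<lambda>n. real n powr (- 1 / 2 - \<delta> * (\<alpha> - 1 / 2))
                       * (log 2 (real n + 1)) powr (\<theta> * (\<alpha> - 1 / 2))))"
proof -
  obtain c where c: "c > 0" and cover: "\<And>n. n \<ge> 1 \<Longrightarrow>
      \<exists>x :: nat \<Rightarrow> real. A \<subseteq> (\<Union>i\<in>{1..n}. {t. \<bar>t - x i\<bar> \<le> c * rate (- \<delta>) \<theta> n})"
    by (rule covering_entropy_imp_covers[OF assms(4)]) (rule that)
  obtain C0 \<kappa> where C0: "C0 \<ge> 1" and kappa: "\<kappa> > 0" and critical: "\<And>n. n \<ge> 1 \<Longrightarrow>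
      \<exists>Q. 2 powr (- real Q) \<le> rate (- \<delta>) \<theta> n \<and>
      (\<forall>q\<le>Q. real (card (active_nodes A q)) \<le> C0 * real n * 2 powr (- \<kappa> * (real Q - real q))) \<and>
      (\<forall>q\<ge>Q. real (card (active_nodes A q)) \<le> C0 * real n * 2 powr (real q - real Q))"
    by (rule critical_scale[OF assms(1,3) c cover]) (assumption, rule that)
  have entropy: "operator_entropy (Lp_space I01 p) (C_space A) (riemann_liouville_on A \<alpha>)
        \<preceq> (\<lambda>n. real n powr (- 1 / p - \<delta> * (\<alpha> - 1 / p)) * (log 2 (real n + 1)) powr (\<theta> * (\<alpha> - 1 / p)))"
      (is ?entropy)
    and kolmogorov: "p = 2 \<Longrightarrow> kolmogorov_number (Lp_space I01 p) (C_space A) (riemann_liouville_on A \<alpha>)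
        \<preceq> (\<lambda>n. real n powr (- 1 / p - \<delta> * (\<alpha> - 1 / p)) * (log 2 (real n + 1)) powr (\<theta> * (\<alpha> - 1 / p)))"
      (is "_ \<Longrightarrow> ?kolmogorov")
    if p: "2 \<le> p" and alpha: "\<alpha> > 1 / p" for p \<alpha> :: real
  proof -
    let ?T = "riemann_liouville_on A \<alpha>" and ?X = "Lp_space I01 p"
    define s where "s = \<alpha> - 1 / p"
    have s: "s > 0" using alpha by (simp add: s_def)
    have p1: "p > 1" using p by simp
    obtain k C where k: "k > 0" and C: "C \<ge> 0" and loc': "\<And>f. f \<in> unit_ball ?X \<Longrightarrow>
      locally_polynomial k p (\<alpha> - 1 / p) C (\<lambda>v. 1 / Gamma \<alpha> * rl_integral (\<alpha> - 1) f v)"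
      by (rule riemann_liouville_locally_polynomial[OF p1 alpha]) (rule that)
    note loc = loc' [folded s_def]
    define B where "B = 1 + interpolation_const k + level_const k s * C + interpolation_const k * C"
    have lc: "level_const k s * C \<ge> 0" "interpolation_const k * C \<ge> 0"
      using C k interpolation_const_ge_1[of k] by (auto simp: level_const_def)
    have B: "B \<ge> 1" "interpolation_const k \<le> B" "level_const k s * C \<le> B" "interpolation_const k * C \<le> B"
      using lc interpolation_const_ge_1[of k] by (auto simp: B_def)
    define \<psi> where "\<psi> = (\<lambda>q r t. if t \<in> A then level_basis k q r t else 0)"
    have Tt: "?T f t = 1 / Gamma \<alpha> * rl_integral (\<alpha> - 1) f t" if "t \<in> A" for f t
      using that assms(1) riemann_liouville_eq[of t \<alpha> f] by (auto simp: riemann_liouville_on_def)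
    interpret level_system A p s B "level_index k A" \<psi> "?T ` unit_ball ?X"
    proof
      show "1 \<le> p" "0 < s" "1 \<le> B" using p1 s B by auto
      show "finite (level_index k A q)" for q
        unfolding level_index_def by (intro finite_cartesian_product finite_active_nodes assms(1) finite_lessThan)
      show "\<psi> q r \<in> vecs (C_space A)" for q r
      proof -
        have "continuous_on A (\<psi> q r)"
          using continuous_on_level_basis[of A k q r] by (subst continuous_on_cong[OF refl, of A _ "level_basis k q r"]) (auto simp: \<psi>_def)
        then show ?thesis by (simp add: C_space_def \<psi>_def)
      qed
      show "(\<Sum>r\<in>level_index k A q. \<bar>\<psi> q r t\<bar>) \<le> B" if "t \<in> A" for q t
        using sum_level_basis_bound[OF assms(1) that k, of q] B(2) that by (simp add: \<psi>_def)
      fix g assume "g \<in> ?T ` unit_ball ?X"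
      then obtain f where f: "g = ?T f" "f \<in> unit_ball ?X" by (rule imageE)
      define h where "h = (\<lambda>v. 1 / Gamma \<alpha> * rl_integral (\<alpha> - 1) f v)"
      have h: "locally_polynomial k p s C h" unfolding h_def by (rule loc[OF f(2)])
      show "\<exists>c. (\<forall>q. (\<Sum>r\<in>level_index k A q. \<bar>c q r\<bar> powr p) \<le> (B * 2 powr (- s * real q)) powr p) \<and>
        (\<forall>K. \<forall>t\<in>A. \<bar>g t - (\<Sum>q\<le>K. \<Sum>r\<in>level_index k A q. c q r * \<psi> q r t)\<bar> \<le> B * 2 powr (- s * real K))"
      proof (intro exI[of _ "level_coeff k h"] conjI allI ballI)
        fix q
        have "(\<Sum>r\<in>level_index k A q. \<bar>level_coeff k h q r\<bar> powr p) \<le> (level_const k s * C * 2 powr (- s * real q)) powr p"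
          using p1 by (intro level_coeff_bound assms(1) k C h) simp
        also have "\<dots> \<le> (B * 2 powr (- s * real q)) powr p"
          using p1 lc(1) B(3) by (intro powr_mono2 mult_right_mono) auto
        finally show "(\<Sum>r\<in>level_index k A q. \<bar>level_coeff k h q r\<bar> powr p) \<le> (B * 2 powr (- s * real q)) powr p" .
      next
        fix K t assume t: "t \<in> A"
        have "(\<Sum>q\<le>K. \<Sum>r\<in>level_index k A q. level_coeff k h q r * \<psi> q r t) = quasi_interpolant k A h K t"
          unfolding quasi_interpolant_eq_level_sum[OF assms(1) t k] using t by (simp add: \<psi>_def)
        moreover have "g t = h t" using Tt[OF t, of f] by (simp add: f(1) h_def)
        moreover have "\<bar>h t - quasi_interpolant k A h K t\<bar> \<le> interpolation_const k * C * 2 powr (- s * real K)"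
          by (rule quasi_interpolant_error[OF assms(1) t k _ C h]) (use p1 in simp)
        moreover have "interpolation_const k * C * 2 powr (- s * real K) \<le> B * 2 powr (- s * real K)"
          by (intro mult_right_mono B(4)) simp
        ultimately show "\<bar>g t - (\<Sum>q\<le>K. \<Sum>r\<in>level_index k A q. level_coeff k h q r * \<psi> q r t)\<bar> \<le> B * 2 powr (- s * real K)"
          by linarith
      qed
    qed
    define C1 where "C1 = 5 * real k * C0"
    have C1: "C1 \<ge> 1"
    proof -
      have "1 * 1 \<le> (5 * real k) * C0" using k C0 by (intro mult_mono) auto
      then show ?thesis by (simp add: C1_def)
    qed
    have sizes: "\<exists>Q. 2 powr (- real Q) \<le> rate (- \<delta>) \<theta> n \<and> sizes_bounded C1 \<kappa> n Q" if n: "n \<ge> 1" for n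
    proof -
      obtain Q where Q: "2 powr (- real Q) \<le> rate (- \<delta>) \<theta> n"
        "\<And>q. q \<le> Q \<Longrightarrow> real (card (active_nodes A q)) \<le> C0 * real n * 2 powr (- \<kappa> * (real Q - real q))"
        "\<And>q. q \<ge> Q \<Longrightarrow> real (card (active_nodes A q)) \<le> C0 * real n * 2 powr (real q - real Q)"
        using critical[OF n] by blast
      have card: "real (card (level_index k A q)) = 5 * real k * real (card (active_nodes A (q - 1)))" for q
        by (simp add: level_index_def card_cartesian_product)
      have Cn: "0 \<le> C0 * real n" using C0 by simp
      have low: "real (card (active_nodes A (q - 1))) \<le> C0 * real n * 2 powr (- \<kappa> * (real Q - real q))" if "q \<le> Q" for q
      proof -
        have "real (card (active_nodes A (q - 1))) \<le> C0 * real n * 2 powr (- \<kappa> * (real Q - real (q - 1)))"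
          using that by (intro Q(2)) simp
        also have "\<dots> \<le> C0 * real n * 2 powr (- \<kappa> * (real Q - real q))"
        proof (intro mult_left_mono[OF _ Cn] powr_mono)
          have "\<kappa> * (real Q - real q) \<le> \<kappa> * (real Q - real (q - 1))"
            using kappa by (intro mult_left_mono) auto
          then show "- \<kappa> * (real Q - real (q - 1)) \<le> - \<kappa> * (real Q - real q)" by simp
        qed simp
        finally show ?thesis .
      qed
      have high: "real (card (active_nodes A (q - 1))) \<le> C0 * real n * 2 powr (real q - real Q)" if "Q \<le> q" for q
      proof (cases "q = Q")
        case True
        then show ?thesis using low[of q] by simp
      next
        case False
        then have "real (card (active_nodes A (q - 1))) \<le> C0 * real n * 2 powr (real (q - 1) - real Q)"
          using that by (intro Q(3)) simp
        also have "\<dots> \<le> C0 * real n * 2 powr (real q - real Q)"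
          using Cn by (intro mult_left_mono powr_mono) auto
        finally show ?thesis .
      qed
      have "5 * real k * a \<le> C1 * real n * b" if "a \<le> C0 * real n * b" for a b
        using mult_left_mono[OF that, of "5 * real k"] by (simp add: C1_def mult_ac)
      then have "sizes_bounded C1 \<kappa> n Q"
        unfolding sizes_bounded_def card using low high by blast
      then show ?thesis using Q(1) by blast
    qed
    have T_C: "?T ` unit_ball ?X \<subseteq> vecs (C_space A)"
    proof
      fix g assume g: "g \<in> ?T ` unit_ball ?X"
      then have "\<forall>t. t \<notin> A \<longrightarrow> g t = 0" by (auto simp: riemann_liouville_on_def)
      then show "g \<in> vecs (C_space A)" using continuous_on_V[OF g] by (simp add: C_space_def)
    qed
    have T_bdd: "\<bar>?T f t\<bar> \<le> C" if "f \<in> unit_ball ?X" "t \<in> A" for f t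
    proof -
      have "t \<in> {0..2}" using that(2) assms(1) by auto
      then show ?thesis using loc[OF that(1)] unfolding Tt[OF that(2)] locally_polynomial_def by blast
    qed
    have ball_ne: "unit_ball ?X \<noteq> {}"
    proof -
      have "(\<lambda>_. 0) \<in> unit_ball ?X" using p1 by (simp add: unit_ball_def Lp_space_def)
      then show ?thesis by blast
    qed
    have radius: "real n powr (- 1 / p) * 2 powr (- s * real Q) \<le> rate (- 1 / p - \<delta> * s) (\<theta> * s) n"
      if n: "n \<ge> 1" and Q: "2 powr (- real Q) \<le> rate (- \<delta>) \<theta> n" for n Q
    proof -
      have "2 powr (- s * real Q) = (2 powr (- real Q)) powr s" by (simp add: powr_powr mult.commute)
      also have "\<dots> \<le> rate (- \<delta>) \<theta> n powr s" using Q s by (intro powr_mono2) auto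
      also have "\<dots> = rate (- \<delta> * s) (\<theta> * s) n" by (rule rate_powr[OF n])
      finally have "real n powr (- 1 / p) * 2 powr (- s * real Q) \<le> real n powr (- 1 / p) * rate (- \<delta> * s) (\<theta> * s) n"
        by (intro mult_left_mono) auto
      also have "\<dots> = rate (- 1 / p - \<delta> * s) (\<theta> * s) n"
        unfolding rate_def mult.assoc [symmetric] powr_add [symmetric] by simp
      finally show ?thesis .
    qed
    have zero_C: "(0 :: real \<Rightarrow> real) \<in> vecs (C_space A)" by (rule subspace_0[OF subspace_C_space])
    show ?entropy
    proof -
      obtain D E where D: "D > 0" and E: "E > 0" and fa: "\<And>n Q. n \<ge> 1 \<Longrightarrow> sizes_bounded C1 \<kappa> n Q \<Longrightarrow>
        \<exists>Z. finite Z \<and> Z \<subseteq> vecs (C_space A) \<and> real (card Z) \<le> exp (D * real n) \<and>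
          (\<forall>g\<in>?T ` unit_ball ?X. \<exists>h\<in>Z. \<forall>t\<in>A. \<bar>g t - h t\<bar> \<le> E * (real n powr (- 1 / p) * 2 powr (- s * real Q)))"
        by (rule finite_approximation[OF kappa C1]) (rule that)
      define d where "d = nat \<lceil>D\<rceil>"
      have d: "1 \<le> d" "D \<le> real d" using D unfolding d_def by linarith+
      show ?thesis
        unfolding s_def [symmetric]
      proof (rule asymp_le_rateI[of "2 * d" C E])
        show "1 \<le> 2 * d" "0 \<le> C" "0 \<le> E" using d C E by auto
        (* The single centre 0 serves for the finitely many N that are too small for the rate. *)
        show "operator_entropy ?X (C_space A) ?T N \<le> ennreal C" for N
          by (rule operator_entropy_le[OF assms(2) T_C ball_ne, of "{0}"]) (use zero_C C T_bdd in auto)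
        fix n N :: nat assume n: "n \<ge> 1" and N: "2 * d * n < N"
        obtain Q where Q: "2 powr (- real Q) \<le> rate (- \<delta>) \<theta> n" "sizes_bounded C1 \<kappa> n Q" using sizes[OF n] by blast
        obtain Z where Z: "finite Z" "Z \<subseteq> vecs (C_space A)" "real (card Z) \<le> exp (D * real n)"
          "\<And>g. g \<in> ?T ` unit_ball ?X \<Longrightarrow> \<exists>h\<in>Z. \<forall>t\<in>A. \<bar>g t - h t\<bar> \<le> E * (real n powr (- 1 / p) * 2 powr (- s * real Q))"
          using fa[OF n Q(2)] by blast
        have "card Z \<le> 2 ^ (N - 1)"
        proof -
          have "exp (D * real n) \<le> exp (real (d * n))" using d(2) by (simp add: mult_right_mono)
          also have "\<dots> = exp 1 ^ (d * n)" using exp_of_nat_mult[of "d * n" "1::real"] by simp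
          also have "\<dots> \<le> (2 ^ 2) ^ (d * n)" using exp_le by (intro power_mono) auto
          also have "\<dots> = 2 ^ (2 * d * n)" by (simp only: power_mult mult.assoc)
          also have "\<dots> \<le> 2 ^ (N - 1)" using N by (intro power_increasing) auto
          also have "\<dots> = real (2 ^ (N - 1))" by (simp only: of_nat_power of_nat_numeral)
          finally have "real (card Z) \<le> real (2 ^ (N - 1))" by (rule order_trans[OF Z(3)])
          then show ?thesis by (simp only: of_nat_le_iff)
        qed
        moreover have "\<exists>h\<in>Z. \<forall>t\<in>A. \<bar>?T f t - h t\<bar> \<le> E * rate (- 1 / p - \<delta> * s) (\<theta> * s) n"
          if f: "f \<in> unit_ball ?X" for f
        proof -
          have "E * (real n powr (- 1 / p) * 2 powr (- s * real Q)) \<le> E * rate (- 1 / p - \<delta> * s) (\<theta> * s) n"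
            using E radius[OF n Q(1)] by simp
          moreover obtain h where "h \<in> Z" "\<forall>t\<in>A. \<bar>?T f t - h t\<bar> \<le> E * (real n powr (- 1 / p) * 2 powr (- s * real Q))"
            using Z(4)[OF imageI[OF f]] by (rule bexE)
          ultimately show ?thesis by (intro bexI[of _ h] ballI) (auto intro: order_trans)
        qed
        moreover have "0 \<le> E * rate (- 1 / p - \<delta> * s) (\<theta> * s) n"
          using E rate_pos[OF n] by (simp add: less_imp_le)
        ultimately show "operator_entropy ?X (C_space A) ?T N \<le> ennreal (E * rate (- 1 / p - \<delta> * s) (\<theta> * s) n)"
          using Z(1,2) by (intro operator_entropy_le[OF assms(2) T_C ball_ne])
      qed
    qed
    show ?kolmogorov if p2: "p = 2"
    proof -
      obtain D E where D: "D > 0" and E: "E > 0" and fa: "\<And>n Q. n \<ge> 1 \<Longrightarrow> sizes_bounded C1 \<kappa> n Q \<Longrightarrow>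
        \<exists>W. finite W \<and> W \<subseteq> vecs (C_space A) \<and> real (card W) \<le> D * real n \<and>
          (\<forall>g\<in>?T ` unit_ball ?X. \<exists>h\<in>span W. \<forall>t\<in>A. \<bar>g t - h t\<bar> \<le> E * (real n powr (- 1 / p) * 2 powr (- s * real Q)))"
        by (rule finite_dimensional_approximation[OF p2 kappa C1]) (rule that)
      define d where "d = nat \<lceil>D\<rceil>"
      have d: "1 \<le> d" "D \<le> real d" using D unfolding d_def by linarith+
      show ?thesis
        unfolding s_def [symmetric]
      proof (rule asymp_le_rateI[of d C E])
        show "1 \<le> d" "0 \<le> C" "0 \<le> E" using d C E by auto
        show "kolmogorov_number ?X (C_space A) ?T N \<le> ennreal C" if "1 \<le> N" for N
          by (rule kolmogorov_number_le[of "{}"]) (use that C T_bdd in auto)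
        fix n N :: nat assume n: "n \<ge> 1" and N: "d * n < N"
        obtain Q where Q: "2 powr (- real Q) \<le> rate (- \<delta>) \<theta> n" "sizes_bounded C1 \<kappa> n Q" using sizes[OF n] by blast
        obtain W where W: "finite W" "W \<subseteq> vecs (C_space A)" "real (card W) \<le> D * real n"
          "\<And>g. g \<in> ?T ` unit_ball ?X \<Longrightarrow> \<exists>h\<in>span W. \<forall>t\<in>A. \<bar>g t - h t\<bar> \<le> E * (real n powr (- 1 / p) * 2 powr (- s * real Q))"
          using fa[OF n Q(2)] by blast
        have "card W < N"
        proof -
          have "D * real n \<le> real (d * n)" using d(2) by (simp add: mult_right_mono)
          then have "real (card W) \<le> real (d * n)" using W(3) by linarith
          then have "card W \<le> d * n" by (simp only: of_nat_le_iff)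
          then show ?thesis using N by linarith
        qed
        moreover have "\<exists>h\<in>span W. \<forall>t\<in>A. \<bar>?T f t - h t\<bar> \<le> E * rate (- 1 / p - \<delta> * s) (\<theta> * s) n"
          if f: "f \<in> unit_ball ?X" for f
        proof -
          have "E * (real n powr (- 1 / p) * 2 powr (- s * real Q)) \<le> E * rate (- 1 / p - \<delta> * s) (\<theta> * s) n"
            using E radius[OF n Q(1)] by simp
          moreover obtain h where "h \<in> span W" "\<forall>t\<in>A. \<bar>?T f t - h t\<bar> \<le> E * (real n powr (- 1 / p) * 2 powr (- s * real Q))"
            using W(4)[OF imageI[OF f]] by (rule bexE)
          ultimately show ?thesis by (intro bexI[of _ h] ballI) (auto intro: order_trans)
        qed
        moreover have "0 \<le> E * rate (- 1 / p - \<delta> * s) (\<theta> * s) n"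
          using E rate_pos[OF n] by (simp add: less_imp_le)
        ultimately show "kolmogorov_number ?X (C_space A) ?T N \<le> ennreal (E * rate (- 1 / p - \<delta> * s) (\<theta> * s) n)"
          using W(1,2) by (intro kolmogorov_number_le)
      qed
    qed
  qed
  show ?thesis using entropy kolmogorov[of 2] by auto
qed

end
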